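(* Let $N\ge2$, let $x=(x_1,\ldots,x_N)$ with $x_1(t)<\cdots<x_N(t)$ be a solution on $\mathbb{R}$ of $\ddot x_j=\sum_{k\ne j}8(x_j-x_k)^{-3}$, and let $c_1,\ldots,c_N$ (distinct reals), $\gamma_1,\ldots,\gamma_N\in\mathbb{R}$ and $H(t)$ be its Moser data and Moser matrix (see context), so that $x_1(t)<\cdots<x_N(t)$ are the eigenvalues of $H(t)$. Fix $m\in\{1,\ldots,N\}$, let $P_m=e_me_m^*$ and $y_j(t)=x_j(t)-c_mt$, and for $\varepsilon>0$ let $$\mathcal M_\varepsilon(t)=H(t)-c_mtI-i\varepsilon P_m .$$ There exist $\varepsilon_0>0$ and a constant $C$, where $C$ depends only on $N$, $x(0)$, $\dot x(0)$ (in particular not on $t$ or $\varepsilon$), such that for all $0<\varepsilon<\varepsilon_0$ the following hold. (1) For every $t\in\mathbb{R}$ the matrix $\mathcal M_\varepsilon(t)$ has $N$ simple eigenvalues, all in the open lower half-plane, and they may be labelled $z_1^\varepsilon(t),\ldots,z_N^\varepsilon(t)$ so that $$\sup_{t\in\mathbb{R}}\max_j|z_j^\varepsilon(t)-y_j(t)|\le\varepsilon .$$ (2) Let $E_j(t)$ be the spectral projection of $H(t)$ associated with the eigenvalue $x_j(t)$ and $a_j(t)=\mathrm{Tr}(P_mE_j(t))$. Then $a_j(t)>0$, $\sum_ja_j(t)=1$, and $$z_j^\varepsilon(t)=y_j(t)-i\varepsilon a_j(t)-\varepsilon^2a_j(t)\sum_{k\ne j}\frac{a_k(t)}{y_j(t)-y_k(t)}+r_j^\varepsilon(t),$$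 where $$\sup_{t\in\mathbb{R}}\max_j\bigl(|r_j^\varepsilon(t)|+|\partial_tr_j^\varepsilon(t)|\bigr)\le C\varepsilon^3 .$$ (3) Consequently, $$\sup_{t\in\mathbb{R}}\max_j|\mathrm{Re}\,z_j^\varepsilon(t)-y_j(t)|\le C\varepsilon^2,\qquad \sup_{t\in\mathbb{R}}\max_j|\mathrm{Re}\,\dot z_j^\varepsilon(t)-\dot y_j(t)|\le C\varepsilon^2 .$$ (4) If $\beta_j^\varepsilon(t):=-\mathrm{Im}\,z_j^\varepsilon(t)$, then for all $t$ and $j$ $$0<\beta_j^\varepsilon(t)<\varepsilon,\qquad \sum_{j=1}^N\beta_j^\varepsilon(t)=\varepsilon,\qquad |\beta_j^\varepsilon(t)-\varepsilon a_j(t)|\le C\varepsilon^3 .$$ (5) Let $q^\varepsilon(t,x)=\sqrt{2\varepsilon}\,e^{i\phi}\,e_m^*(\mathcal M_\varepsilon(t)-xI)^{-1}\mathbf 1$, where $\phi\in\mathbb{R}$ is a constant phase, be the corresponding multisoliton. Then $$\sup_{t\in\mathbb{R}}d_{\mathrm{BL}}\Bigl(|q^\varepsilon(t,x)|^2\,dx,\ 2\pi\sum_{j=1}^N\delta_{y_j(t)}\Bigr)\le C\varepsilon(1+|\log\varepsilon|).$$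
   Context: $e_m$ is the $m$th standard basis vector of $\mathbb{C}^N$ and $\mathbf 1=(1,\ldots,1)^T\in\mathbb{C}^N$. Moser data and Moser matrix. Let $X_0=\mathrm{diag}(x_1(0),\ldots,x_N(0))$ and let $L_0$ be the Hermitian matrix with entries $(L_0)_{jk}=\dot x_j(0)\delta_{jk}-\frac{2i(1-\delta_{jk})}{x_j(0)-x_k(0)}$. Moser's theorem states that for every $t\in\mathbb{R}$ the particle positions $x_1(t),\ldots,x_N(t)$ are the eigenvalues of $X_0+tL_0$. The eigenvalues $c_1,\ldots,c_N$ of $L_0$ are distinct, and there are a unitary $U$ and real numbers $\gamma_1,\ldots,\gamma_N$ such that $U^*L_0U=\mathrm{diag}(c_1,\ldots,c_N)$ and $U^*(X_0+tL_0)U=H(t)$, where $$H(t)_{jk}=(\gamma_j+c_jt)\delta_{jk}+\frac{2i(1-\delta_{jk})}{c_j-c_k}$$ (the second term being $0$ for $j=k$). Hence the eigenvalues of $H(t)$, in increasing order, are $x_1(t)<\cdots<x_N(t)$. The particle gaps are bounded below uniformly in time: $\inf_{t}\min_{j\ne k}|x_j(t)-x_k(t)|>0$, by conservation of the energy $\frac12\sum_j\dot x_j^2+4\sum_{j<k}(x_j-x_k)^{-2}$. Known fact (G\'erard--Lenzmann): the function $q^\varepsilon$ in (5) is a rational multisoliton solution in $C(\mathbb{R};H^1_+(\mathbb{R}))$ of $i\partial_tq+\partial_x^2q-2iq\,\partial_x\Pi_+(|q|^2)=0$ ($\Pi_+$ the projection onto non-negative frequencies, $H^1_+=H^1\cap\Pi_+L^2$),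 its poles are the eigenvalues of $\mathcal M_\varepsilon(t)$, and when these eigenvalues $\alpha_j(t)-i\beta_j(t)$ are simple with $\beta_j(t)>0$ one has $|q^\varepsilon(t,x)|^2=\sum_{j=1}^N\frac{2\beta_j(t)}{(x-\alpha_j(t))^2+\beta_j(t)^2}$. For finite Borel measures $\mu,\nu$ on $\mathbb{R}$, $d_{\mathrm{BL}}(\mu,\nu)=\sup\{\int_{\mathbb{R}}\varphi\,d(\mu-\nu):\|\varphi\|_{L^\infty}\le1,\ \mathrm{Lip}(\varphi)\le1\}$. *)

theory Defs
  imports "HOL-Analysis.Analysis" "HOL-Computational_Algebra.Polynomial"
begin

section \<open>Complex matrices\<close>

text \<open>
  The index set \<open>{1, \<dots>, N}\<close> is a finite linearly ordered type \<open>'n\<close> with \<open>N = CARD('n)\<close>.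
\<close>

definition conj_transpose :: "complex^'n^'m \<Rightarrow> complex^'m^'n" where
  "conj_transpose A = map_matrix cnj (transpose A)"

definition unitary_matrix :: "complex^'n^'n \<Rightarrow> bool" where
  "unitary_matrix U \<longleftrightarrow> conj_transpose U ** U = mat 1 \<and> U ** conj_transpose U = mat 1"

definition diag_matrix :: "('n \<Rightarrow> real) \<Rightarrow> complex^'n^'n" where
  "diag_matrix d = (\<chi> j k. if j = k then complex_of_real (d j) else 0)"

definition basis_proj :: "'n \<Rightarrow> complex^'n^'n" where
  "basis_proj m = (\<chi> j k. axis m 1 $ j * cnj (axis m 1 $ k))"

definition eigenvalue :: "complex^'n^'n \<Rightarrow> complex \<Rightarrow> bool" where
  "eigenvalue A w \<longleftrightarrow> (\<exists>v. v \<noteq> 0 \<and> A *v v = w *s v)"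

definition charpoly :: "complex^'n^'n \<Rightarrow> complex poly" where
  "charpoly A = det (\<chi> j k. (if j = k then [:0, 1:] else 0) - [:A $ j $ k:])"

definition simple_eigenvalue :: "complex^'n^'n \<Rightarrow> complex \<Rightarrow> bool" where
  "simple_eigenvalue A w \<longleftrightarrow> eigenvalue A w \<and> order w (charpoly A) = 1"

text \<open>
  Only used for Hermitian \<open>A\<close>, whose spectral projections are the orthogonal projections onto
  the eigenspaces; an orthogonal projection is determined by its range.
\<close>

definition spectral_proj :: "complex^'n^'n \<Rightarrow> complex \<Rightarrow> complex^'n^'n" where
  "spectral_proj A w =
     (THE P. P ** P = P \<and> conj_transpose P = P \<and>
             range (\<lambda>v. P *v v) = {v. A *v v = w *s v})"

section \<open>The Calogero--Moser system and its Moser data\<close>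

definition calogero_moser_solution :: "('n::{finite,linorder} \<Rightarrow> real \<Rightarrow> real) \<Rightarrow> bool" where
  "calogero_moser_solution x \<longleftrightarrow>
     (\<forall>t. strict_mono (\<lambda>j. x j t)) \<and>
     (\<forall>j t. x j differentiable (at t)) \<and>
     (\<forall>j t. (deriv (x j) has_real_derivative
               (\<Sum>k\<in>UNIV - {j}. 8 / (x j t - x k t) ^ 3)) (at t))"

definition moser_L :: "('n \<Rightarrow> real) \<Rightarrow> ('n \<Rightarrow> real) \<Rightarrow> complex^'n^'n" where
  "moser_L x0 v0 = (\<chi> j k. if j = k then complex_of_real (v0 j)
                           else - (2 * \<i> / complex_of_real (x0 j - x0 k)))"

definition moser_H :: "('n \<Rightarrow> real) \<Rightarrow> ('n \<Rightarrow> real) \<Rightarrow> real \<Rightarrow> complex^'n^'n" where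
  "moser_H c \<gamma> t = (\<chi> j k. if j = k then complex_of_real (\<gamma> j + c j * t)
                           else 2 * \<i> / complex_of_real (c j - c k))"

text \<open>
  The eigenvalues of \<open>moser_L x0 v0\<close> may be listed in any order in \<open>c\<close>.
\<close>

definition moser_data ::
    "('n \<Rightarrow> real) \<Rightarrow> ('n \<Rightarrow> real) \<Rightarrow> ('n \<Rightarrow> real) \<Rightarrow> ('n::finite \<Rightarrow> real) \<Rightarrow> bool" where
  "moser_data x0 v0 c \<gamma> \<longleftrightarrow> inj c \<and>
     (\<exists>U. unitary_matrix U \<and>
          conj_transpose U ** moser_L x0 v0 ** U = diag_matrix c \<and>
          (\<forall>t. conj_transpose U ** (diag_matrix x0 + t *\<^sub>R moser_L x0 v0) ** U = moser_H c \<gamma> t))"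

definition moser_M ::
    "('n \<Rightarrow> real) \<Rightarrow> ('n \<Rightarrow> real) \<Rightarrow> 'n \<Rightarrow> real \<Rightarrow> real \<Rightarrow> complex^'n^'n" where
  "moser_M c \<gamma> m \<epsilon> t =
     moser_H c \<gamma> t - mat (complex_of_real (c m * t)) - mat (\<i> * complex_of_real \<epsilon>) ** basis_proj m"

definition multisoliton ::
    "('n::finite \<Rightarrow> real) \<Rightarrow> ('n \<Rightarrow> real) \<Rightarrow> 'n \<Rightarrow> real \<Rightarrow> real \<Rightarrow> real \<Rightarrow> real \<Rightarrow> complex" where
  "multisoliton c \<gamma> m \<phi> \<epsilon> t s =
     complex_of_real (sqrt (2 * \<epsilon>)) * exp (\<i> * complex_of_real \<phi>) *
       (matrix_inv (moser_M c \<gamma> m \<epsilon> t - mat (complex_of_real s)) *v (\<chi> j. 1)) $ m"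

section \<open>Measures on the line\<close>

definition d_BL :: "real measure \<Rightarrow> real measure \<Rightarrow> real" where
  \<comment> \<open>meaningful for finite Borel measures, for which the set of values is bounded\<close>
  "d_BL \<mu> \<nu> = (SUP f\<in>{f. (\<forall>s. \<bar>f s\<bar> \<le> 1) \<and> lipschitz_on 1 UNIV f}.
                 (\<integral>s. f s \<partial>\<mu>) - (\<integral>s. f s \<partial>\<nu>))"

definition dirac_sum :: "('n::finite \<Rightarrow> real) \<Rightarrow> real measure" where
  \<comment> \<open>\<open>\<Sum>\<^sub>j \<delta>\<close> at \<open>p j\<close>, as the push-forward of counting measure\<close>
  "dirac_sum p = distr (count_space UNIV) borel p"

lemma emeasure_dirac_sum:
  "A \<in> sets borel \<Longrightarrow> emeasure (dirac_sum p) A = (\<Sum>j\<in>UNIV. indicator A (p j))"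
  unfolding dirac_sum_def
  by (subst emeasure_distr)
     (auto simp: emeasure_count_space_finite sum.If_cases indicator_def vimage_def)

end

theory Submission
  imports Defs
begin

text \<open>
  For fixed \<open>T\<close> the matrix \<open>X(s) + (T - s) L(s)\<close> evolves by a Lax equation, so its determinants
  \<open>det (w - \<dots>)\<close> do not depend on \<open>s\<close>; comparing \<open>s = 0\<close> and \<open>s = T\<close> shows that the \<open>x\<^sub>j(T)\<close> are the
  eigenvalues of \<open>H(T)\<close>. Energy conservation bounds velocities, eigenvalues \<open>c\<^sub>j\<close> and inverse gaps by a
  single constant.

  As \<open>\<i> \<epsilon> P\<^sub>m\<close> has rank one, the eigenvalues of \<open>M\<^sub>\<epsilon>(t)\<close> are the roots of the secular equation
  \<open>\<Sum>\<^sub>k a\<^sub>k / (z - y\<^sub>k) = \<i> / \<epsilon>\<close>, where \<open>a\<^sub>k > 0\<close> because of \<open>[diag c, H] = 2\<i> (1 1\<^sup>T - I)\<close>. Since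
  \<open>\<Sum>\<^sub>k a\<^sub>k = 1\<close>, every root is within \<open>\<epsilon>\<close> of some \<open>y\<^sub>k\<close>, and near each \<open>y\<^sub>k\<close> the equation is a contractive
  fixed point problem, whose solution is expanded together with its time derivative. The same
  commutator gives \<open>|q\<^sup>\<epsilon>|\<^sup>2\<close> as the logarithmic derivative of the secular function, that is, as a sum of
  Lorentzians, and each Lorentzian is compared with a point mass by an explicit integral.
\<close>

section \<open>The Lax pair\<close>

text \<open>The constant is fixed before the solution, its Moser data and \<open>m\<close> are
  given, so nothing can be argued by compactness in time: every estimate must be explicit in N and
  the initial energy. Time derivatives are the second obstacle. The eigenvectors are merely chosen
  for each \<open>t\<close>, with phases that may jump, and the perturbed eigenvalues are known only
  as fixed points. Regularity is therefore extracted from exact difference identities between two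
  times, for the phase-invariant entries of the spectral projections (\<open>e_diff\<close>) and for
  the fixed points (\<open>W_diff\<close>). Each identity first gives continuity by crude bounds and
  then, in the limit, the derivative with its bound; this takes the place of analytic perturbation
  theory and of the implicit function theorem. The gaps are bounded below but no upper bound for
  them is at hand, so only reciprocals and ratios of gaps are ever estimated.\<close>

lemma matrix_add_rdistrib: "(A + B) ** C = A ** C + B ** (C :: 'a::semiring_1^'n^'m)"
  by (vector matrix_matrix_mult_def sum.distrib[symmetric] distrib_right)

lemma matrix_diff_ldistrib: "A ** (B - C) = A ** B - A ** (C :: 'a::ring_1^'n^'m)"
  by (vector matrix_matrix_mult_def sum_subtractf[symmetric] right_diff_distrib)

lemma matrix_diff_rdistrib: "(A - B) ** C = A ** C - B ** (C :: 'a::ring_1^'n^'m)"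
  by (vector matrix_matrix_mult_def sum_subtractf[symmetric] left_diff_distrib)

lemma mat_mult_left: "mat w ** A = (\<chi> i j. w * A $ i $ j)"
  by (simp add: matrix_matrix_mult_def mat_def vec_eq_iff if_distrib[where f="\<lambda>z. z * _"] cong: if_cong)

lemma mat_mult_right: "A ** mat w = (\<chi> i j. A $ i $ j * w)"
  by (simp add: matrix_matrix_mult_def mat_def vec_eq_iff if_distrib[where f="\<lambda>z. _ * z"] cong: if_cong)

lemma commutator_shift:
  fixes A B :: "complex^'n^'n"
  shows "B ** (mat w - A) - (mat w - A) ** B = A ** B - B ** A"
  by (simp add: matrix_diff_ldistrib matrix_diff_rdistrib mat_mult_left mat_mult_right mult.commute)

section \<open>Derivatives of determinants along commutators\<close>

definition det_deriv :: "complex^'n^'n \<Rightarrow> complex^'n^'n \<Rightarrow> complex" where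
  "det_deriv A V = (\<Sum>p\<in>{p. p permutes UNIV}. of_int (sign p) *
     (\<Sum>i\<in>UNIV. V $ i $ p i * (\<Prod>k\<in>UNIV - {i}. A $ k $ p k)))"

lemma has_vector_derivative_det:
  fixes A :: "real \<Rightarrow> complex^'n^'n"
  assumes "\<And>i j. ((\<lambda>s. A s $ i $ j) has_vector_derivative V $ i $ j) (at s)"
  shows "((\<lambda>s. det (A s)) has_vector_derivative det_deriv (A s) V) (at s)"
proof -
  have "((\<lambda>s. \<Prod>i\<in>UNIV. A s $ i $ p i) has_vector_derivative
         (\<Sum>i\<in>UNIV. V $ i $ p i * (\<Prod>k\<in>UNIV - {i}. A s $ k $ p k))) (at s)" for p
  proof -
    have "((\<lambda>s. \<Prod>i\<in>UNIV. A s $ i $ p i) has_derivative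
         (\<lambda>h. \<Sum>i\<in>UNIV. (h *\<^sub>R V $ i $ p i) * (\<Prod>k\<in>UNIV - {i}. A s $ k $ p k))) (at s)"
      by (rule has_derivative_prod) (use assms in \<open>simp add: has_vector_derivative_def\<close>)
    then show ?thesis
      by (simp add: has_vector_derivative_def scaleR_sum_right)
  qed
  then show ?thesis
    unfolding det_def det_deriv_def
    by (intro has_vector_derivative_sum has_vector_derivative_mult_right) auto
qed

lemma det_deriv_diff: "det_deriv A (V - W) = det_deriv A V - det_deriv A W"
  by (simp add: det_deriv_def algebra_simps sum_subtractf)

text \<open>Jacobi's formula without cofactors: the determinant of
  \<open>(mat 1 + s *\<^sub>R B) ** A\<close> is differentiated at 0 both directly and as a product.
  This covers singular \<open>A\<close>, the case in which the result is used. The number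
  \<open>det_deriv (mat 1) B\<close> is the trace of \<open>B\<close>; what matters is that
  \<open>det_deriv_mult_right\<close> yields the same one.\<close>

lemma det_deriv_mult_left: "det_deriv A (B ** A) = det_deriv (mat 1) B * det A"
proof -
  let ?M = "\<lambda>s::real. mat 1 + s *\<^sub>R B"
  have M: "((\<lambda>s. det (?M s)) has_vector_derivative det_deriv (?M 0) B) (at 0)"
    by (rule has_vector_derivative_det) (auto intro!: derivative_eq_intros)
  have "((\<lambda>s. det (?M s ** A)) has_vector_derivative det_deriv (?M 0 ** A) (B ** A)) (at 0)"
  proof (rule has_vector_derivative_det)
    fix i j
    have "(?M s ** A) $ i $ j = A $ i $ j + s *\<^sub>R (B ** A) $ i $ j" for s
      by (simp add: matrix_add_rdistrib flip: scalar_matrix_assoc)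
    then show "((\<lambda>s. (?M s ** A) $ i $ j) has_vector_derivative (B ** A) $ i $ j) (at 0)"
      by (auto intro!: derivative_eq_intros)
  qed
  moreover have "((\<lambda>s. det (?M s ** A)) has_vector_derivative det_deriv (?M 0) B * det A) (at 0)"
    unfolding det_mul by (rule has_vector_derivative_mult_left[OF M])
  ultimately show ?thesis
    using vector_derivative_unique_at by fastforce
qed

lemma det_deriv_mult_right: "det_deriv A (A ** B) = det_deriv (mat 1) B * det A"
proof -
  let ?M = "\<lambda>s::real. mat 1 + s *\<^sub>R B"
  have M: "((\<lambda>s. det (?M s)) has_vector_derivative det_deriv (?M 0) B) (at 0)"
    by (rule has_vector_derivative_det) (auto intro!: derivative_eq_intros)
  have "((\<lambda>s. det (A ** ?M s)) has_vector_derivative det_deriv (A ** ?M 0) (A ** B)) (at 0)"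
  proof (rule has_vector_derivative_det)
    fix i j
    have "(A ** ?M s) $ i $ j = A $ i $ j + s *\<^sub>R (A ** B) $ i $ j" for s
      by (simp add: matrix_add_ldistrib matrix_scalar_ac flip: scalar_matrix_assoc)
    then show "((\<lambda>s. (A ** ?M s) $ i $ j) has_vector_derivative (A ** B) $ i $ j) (at 0)"
      by (auto intro!: derivative_eq_intros)
  qed
  moreover have "((\<lambda>s. det (A ** ?M s)) has_vector_derivative det A * det_deriv (?M 0) B) (at 0)"
    unfolding det_mul by (rule has_vector_derivative_mult_right[OF M])
  ultimately show ?thesis
    using vector_derivative_unique_at by fastforce
qed

text \<open>The derivative of the determinant is (tr B - tr B) det A.\<close>

lemma det_constant_of_Lax:
  fixes A :: "real \<Rightarrow> complex^'n^'n"
  assumes "\<And>s i j. ((\<lambda>s. A s $ i $ j) has_vector_derivative (B s ** A s - A s ** B s) $ i $ j) (at s)"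
  shows "det (A s) = det (A t)"
proof -
  have "((\<lambda>s. det (A s)) has_vector_derivative 0) (at s)" for s
    using has_vector_derivative_det[OF assms, of s]
    by (simp add: det_deriv_diff det_deriv_mult_left det_deriv_mult_right)
  then obtain c where "\<And>s. det (A s) = c"
    using has_vector_derivative_zero_constant[of UNIV "\<lambda>s. det (A s)"] by auto
  then show ?thesis by simp
qed

section \<open>Moser's Lax pair\<close>

lemma calogero_moser_derivs:
  assumes "calogero_moser_solution x"
  shows "strict_mono (\<lambda>j. x j t)" "(x j has_real_derivative deriv (x j) t) (at t)"
    "(deriv (x j) has_real_derivative (\<Sum>k\<in>UNIV - {j}. 8 / (x j t - x k t) ^ 3)) (at t)"
  using assms DERIV_deriv_iff_real_differentiable
  unfolding calogero_moser_solution_def by blast+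

lemma calogero_moser_neq:
  assumes "calogero_moser_solution x" "j \<noteq> k"
  shows "x j t - x k t \<noteq> 0"
  using calogero_moser_derivs(1)[OF assms(1), of t] assms(2)
  by (metis eq_iff_diff_eq_0 strict_mono_eq)

text \<open>Moser's second Lax matrix, with signs such that X' = [B, X] + L and L' = [B, L] along
  solutions. The diagonal of B commutes with X, so only the second equation sees it; there it
  cancels the three-particle terms.\<close>

definition lax_B :: "('n \<Rightarrow> real) \<Rightarrow> complex^'n^'n" where
  "lax_B x = (\<chi> j k. if j = k then 2 * \<i> * (\<Sum>l\<in>UNIV - {j}. 1 / complex_of_real (x j - x l) ^ 2)
      else - 2 * \<i> / complex_of_real (x j - x k) ^ 2)"

lemma lax_pair_X:
  fixes x :: "'n::finite \<Rightarrow> real"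
  assumes "inj x"
  shows "lax_B x ** diag_matrix x - diag_matrix x ** lax_B x + moser_L x v = diag_matrix v"
proof -
  have "(lax_B x ** diag_matrix x) $ j $ k = lax_B x $ j $ k * x k" for j k
    by (simp add: matrix_matrix_mult_def diag_matrix_def if_distrib cong: if_cong)
  moreover have "(diag_matrix x ** lax_B x) $ j $ k = x j * lax_B x $ j $ k" for j k
    by (simp add: matrix_matrix_mult_def diag_matrix_def mult_delta_left)
  moreover have "complex_of_real (x j) - x k \<noteq> 0" if "j \<noteq> k" for j k
    using that assms by (simp add: inj_eq)
  ultimately show ?thesis
    by (auto simp: vec_eq_iff lax_B_def moser_L_def diag_matrix_def divide_simps)
       (simp add: power2_eq_square algebra_simps)
qed

text \<open>Here \<open>p\<close> is x_j - x_l and \<open>q\<close> is x_l - x_k. The contribution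
  of a third particle l to the entry (j, k) of [B, L] cancels for each l separately.\<close>

lemma lax_off_diagonal_cancel:
  fixes p q :: complex
  assumes "p \<noteq> 0" "q \<noteq> 0" "p + q \<noteq> 0"
  shows "(-2*\<i>/p\<^sup>2) * -(2*\<i>/q) - (-(2*\<i>/p)) * (-2*\<i>/q\<^sup>2)
       + (2*\<i>/p\<^sup>2 - 2*\<i>/q\<^sup>2) * -(2*\<i>/(p+q)) = 0"
proof -
  have "(-2*\<i>/p\<^sup>2) * -(2*\<i>/q) - (-(2*\<i>/p)) * (-2*\<i>/q\<^sup>2) = 4 * (p - q) / (p\<^sup>2 * q\<^sup>2)"
    using assms by (simp add: divide_simps) (simp add: algebra_simps power2_eq_square)
  moreover have "(2*\<i>/p\<^sup>2 - 2*\<i>/q\<^sup>2) * -(2*\<i>/(p+q)) = 4 * (q - p) * (p + q) / (p\<^sup>2 * q\<^sup>2 * (p + q))"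
    using assms by (simp add: divide_simps) (simp add: algebra_simps power2_eq_square)
  moreover have "4 * (q - p) * (p + q) / (p\<^sup>2 * q\<^sup>2 * (p + q)) = - (4 * (p - q) / (p\<^sup>2 * q\<^sup>2))"
    using assms by (simp add: divide_simps)
  ultimately show ?thesis by simp
qed

text \<open>The diagonal is the Calogero-Moser force, the off-diagonal part is the time derivative
  of \<open>- (2 * \<i> / (x j - x k))\<close>; together they say that L' = [B, L].\<close>

lemma lax_pair_L:
  fixes x v :: "'n::finite \<Rightarrow> real"
  assumes "inj x"
  shows "(lax_B x ** moser_L x v - moser_L x v ** lax_B x) $ j $ k =
    (if j = k then complex_of_real (\<Sum>l\<in>UNIV - {j}. 8 / (x j - x l) ^ 3)
     else complex_of_real (2 * (v j - v k) / (x j - x k)\<^sup>2) * \<i>)"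
proof -
  let ?B = "lax_B x" and ?L = "moser_L x v"
  have nz: "complex_of_real (x j) - x k \<noteq> 0" if "j \<noteq> k" for j k
    using that assms by (simp add: inj_eq)
  have eq: "(?B ** ?L - ?L ** ?B) $ j $ k = (\<Sum>l\<in>UNIV. ?B $ j $ l * ?L $ l $ k - ?L $ j $ l * ?B $ l $ k)"
    by (simp add: matrix_matrix_mult_def sum_subtractf)
  show ?thesis
  proof (cases "j = k")
    case True
    have "(\<Sum>l\<in>UNIV. ?B $ j $ l * ?L $ l $ j - ?L $ j $ l * ?B $ l $ j) =
      (\<Sum>l\<in>UNIV - {j}. ?B $ j $ l * ?L $ l $ j - ?L $ j $ l * ?B $ l $ j)"
      by (subst sum.remove[of UNIV j]) auto
    also have "\<dots> = (\<Sum>l\<in>UNIV - {j}. 8 / (complex_of_real (x j) - x l) ^ 3)"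
    proof (rule sum.cong)
      fix l assume "l \<in> UNIV - {j}"
      then have "j \<noteq> l" by auto
      have "(-2*\<i>/p\<^sup>2) * -(2*\<i>/-p) - (-(2*\<i>/p)) * (-2*\<i>/(-p)\<^sup>2) = 8/p^3" if "p \<noteq> 0" for p :: complex
        using that by (simp add: field_simps power2_eq_square power3_eq_cube)
      from this[OF nz[OF \<open>j \<noteq> l\<close>]] \<open>j \<noteq> l\<close>
      show "?B $ j $ l * ?L $ l $ j - ?L $ j $ l * ?B $ l $ j = 8 / (complex_of_real (x j) - x l) ^ 3"
        by (simp add: lax_B_def moser_L_def)
    qed simp
    finally show ?thesis
      using eq True by simp
  next
    case False
    let ?S = "UNIV - {j} - {k}"
    let ?f = "\<lambda>j l. 2 * \<i> / (complex_of_real (x j) - x l)\<^sup>2"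
    have Bj: "?B $ j $ j = ?f j k + (\<Sum>l\<in>?S. ?f j l)"
    proof -
      have "?B $ j $ j = (\<Sum>l\<in>UNIV - {j}. ?f j l)"
        by (simp add: lax_B_def sum_distrib_left)
      also have "\<dots> = ?f j k + (\<Sum>l\<in>?S. ?f j l)"
        using False by (subst sum.remove[of _ k]) auto
      finally show ?thesis .
    qed
    have Bk: "?B $ k $ k = ?f k j + (\<Sum>l\<in>?S. ?f k l)"
    proof -
      have "?B $ k $ k = (\<Sum>l\<in>UNIV - {k}. ?f k l)"
        by (simp add: lax_B_def sum_distrib_left)
      also have "\<dots> = ?f k j + (\<Sum>l\<in>UNIV - {k} - {j}. ?f k l)"
        using False by (subst sum.remove[of _ j]) auto
      also have "UNIV - {k} - {j} = ?S" by auto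
      finally show ?thesis .
    qed
    \<comment> \<open>The mutual term of \<open>j\<close> and \<open>k\<close> is symmetric and
      drops out of the difference of the two diagonal entries, which leaves only third
      particles.\<close>
    have "?f j k = ?f k j" by (simp add: power2_commute)
    have "(\<Sum>l\<in>UNIV. ?B $ j $ l * ?L $ l $ k - ?L $ j $ l * ?B $ l $ k) =
      (?B $ j $ j * ?L $ j $ k - ?L $ j $ j * ?B $ j $ k) +
      (?B $ j $ k * ?L $ k $ k - ?L $ j $ k * ?B $ k $ k) +
      (\<Sum>l\<in>?S. ?B $ j $ l * ?L $ l $ k - ?L $ j $ l * ?B $ l $ k)"
      using False by (subst sum.remove[of _ j], simp, simp, subst sum.remove[of _ k]) auto
    also have "\<dots> = ?B $ j $ k * (v k - v j) + (?B $ j $ j - ?B $ k $ k) * ?L $ j $ k +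
      (\<Sum>l\<in>?S. ?B $ j $ l * ?L $ l $ k - ?L $ j $ l * ?B $ l $ k)"
      by (simp add: moser_L_def algebra_simps)
    also have "(?B $ j $ j - ?B $ k $ k) * ?L $ j $ k = (\<Sum>l\<in>?S. (?f j l - ?f k l) * ?L $ j $ k)"
      unfolding Bj Bk \<open>?f j k = ?f k j\<close> by (simp add: sum_subtractf flip: sum_distrib_right)
    also have "?B $ j $ k * (v k - v j) + (\<Sum>l\<in>?S. (?f j l - ?f k l) * ?L $ j $ k) +
      (\<Sum>l\<in>?S. ?B $ j $ l * ?L $ l $ k - ?L $ j $ l * ?B $ l $ k) =
      ?B $ j $ k * (v k - v j) + (\<Sum>l\<in>?S. ?B $ j $ l * ?L $ l $ k - ?L $ j $ l * ?B $ l $ k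
         + (?f j l - ?f k l) * ?L $ j $ k)"
      by (simp add: sum.distrib)
    also have "(\<Sum>l\<in>?S. ?B $ j $ l * ?L $ l $ k - ?L $ j $ l * ?B $ l $ k
         + (?f j l - ?f k l) * ?L $ j $ k) = 0"
    proof (rule sum.neutral, rule ballI)
      fix l assume "l \<in> ?S"
      then have l: "l \<noteq> j" "l \<noteq> k" by auto
      have s: "complex_of_real (x j) - x l + (complex_of_real (x l) - x k) = complex_of_real (x j) - x k"
        by simp
      show "?B $ j $ l * ?L $ l $ k - ?L $ j $ l * ?B $ l $ k + (?f j l - ?f k l) * ?L $ j $ k = 0"
        using lax_off_diagonal_cancel[of "complex_of_real (x j) - x l" "complex_of_real (x l) - x k"] l False
          nz[of j l] nz[of l k] nz[of j k]
        unfolding s by (simp add: lax_B_def moser_L_def power2_commute[of "complex_of_real (x k)"])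
    qed
    finally show ?thesis
      unfolding eq using False nz[OF False] by (simp add: lax_B_def divide_simps) (simp add: algebra_simps)
  qed
qed

text \<open>\<open>X(s) + (T - s) L(s)\<close> is isospectral, which avoids integrating the Lax pair.\<close>

lemma moser_det:
  fixes x :: "'n::{finite,linorder} \<Rightarrow> real \<Rightarrow> real"
  assumes cm: "calogero_moser_solution x"
  shows "det (mat w - diag_matrix (\<lambda>j. x j T)) =
    det (mat w - (diag_matrix (\<lambda>j. x j 0) + T *\<^sub>R moser_L (\<lambda>j. x j 0) (\<lambda>j. deriv (x j) 0)))"
proof -
  let ?X = "\<lambda>s. diag_matrix (\<lambda>j. x j s)"
  let ?v = "\<lambda>s j. deriv (x j) s"
  let ?L = "\<lambda>s. moser_L (\<lambda>j. x j s) (?v s)"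
  let ?B = "\<lambda>s. lax_B (\<lambda>j. x j s)"
  let ?G = "\<lambda>s. mat w - (?X s + (T - s) *\<^sub>R ?L s)"
  have inj: "inj (\<lambda>j. x j s)" for s
    using calogero_moser_derivs(1)[OF cm] by (rule strict_mono_imp_inj_on)
  have nz: "x j s - x k s \<noteq> 0" if "j \<noteq> k" for j k s
    using calogero_moser_neq[OF cm that] .
  have dX: "((\<lambda>s. ?X s $ i $ j) has_vector_derivative (?B s ** ?X s - ?X s ** ?B s + ?L s) $ i $ j) (at s)" for s i j
    unfolding lax_pair_X[OF inj]
    using has_vector_derivative_of_real[where 'a=complex, OF calogero_moser_derivs(2)[OF cm]]
    by (cases "i = j") (simp_all add: diag_matrix_def)
  have dL: "((\<lambda>s. ?L s $ i $ j) has_vector_derivative (?B s ** ?L s - ?L s ** ?B s) $ i $ j) (at s)" for s i j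
  proof (cases "i = j")
    case True
    then show ?thesis unfolding lax_pair_L[OF inj]
      using has_vector_derivative_of_real[where 'a=complex, OF calogero_moser_derivs(3)[OF cm, of j s]]
      by (simp add: moser_L_def)
  next
    case False
    have "((\<lambda>s. - 2 / g s) has_real_derivative 2 * D / (g s)\<^sup>2) (at s)"
      if "(g has_real_derivative D) (at s)" "g s \<noteq> 0" for g D and s :: real
      using that by (auto intro!: derivative_eq_intros simp: power2_eq_square)
    from this[OF DERIV_diff[OF calogero_moser_derivs(2)[OF cm] calogero_moser_derivs(2)[OF cm]] nz[OF False]]
    have "((\<lambda>s. - 2 / (x i s - x j s)) has_real_derivative (2 * (?v s i - ?v s j) / (x i s - x j s)\<^sup>2)) (at s)" .
    then have "((\<lambda>s. complex_of_real (- 2 / (x i s - x j s)) * \<i>) has_vector_derivative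
        complex_of_real (2 * (?v s i - ?v s j) / (x i s - x j s)\<^sup>2) * \<i>) (at s)"
      by (intro has_vector_derivative_mult_left has_vector_derivative_of_real)
    then show ?thesis unfolding lax_pair_L[OF inj]
      using False by (simp add: moser_L_def mult.commute)
  qed
  have "det (?G T) = det (?G 0)"
  proof (rule det_constant_of_Lax[where B = ?B])
    fix s i j
    let ?b = "?B s" and ?l = "?L s" and ?m = "?X s"
    \<comment> \<open>Differentiating the factor \<open>T - s\<close> produces -L, which cancels the
      +L in X' = [B, X] + L; what remains is a pure commutator.\<close>
    have "((\<lambda>s. ?G s $ i $ j) has_vector_derivative
       - ((?b ** ?m - ?m ** ?b + ?l) $ i $ j + ((T - s) *\<^sub>R (?b ** ?l - ?l ** ?b) $ i $ j + (-1) *\<^sub>R ?l $ i $ j))) (at s)"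
      unfolding vector_minus_component vector_add_component vector_scaleR_component
      by (rule derivative_eq_intros dX dL | simp)+
    moreover have "?b ** ?G s - ?G s ** ?b = - ((?b ** ?m - ?m ** ?b + ?l) + ((T - s) *\<^sub>R (?b ** ?l - ?l ** ?b) - ?l))"
      unfolding commutator_shift
      by (simp add: matrix_add_ldistrib matrix_add_rdistrib matrix_diff_ldistrib matrix_diff_rdistrib
          matrix_scalar_ac algebra_simps
          flip: scalar_matrix_assoc)
    ultimately show "((\<lambda>s. ?G s $ i $ j) has_vector_derivative (?b ** ?G s - ?G s ** ?b) $ i $ j) (at s)"
      by simp
  qed
  then show ?thesis by simp
qed

lemma eigenvalue_iff_det: "eigenvalue A w \<longleftrightarrow> det (mat w - A) = 0"
proof -
  have eq: "(mat w - A) *v v = w *s v - A *v v" for v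
    by (simp add: vec_eq_iff matrix_vector_mult_def mat_def left_diff_distrib sum_subtractf
        if_distrib[where f="\<lambda>z. z * _"] cong: if_cong)
  have "det (mat w - A) \<noteq> 0 \<longleftrightarrow> (\<forall>v. (mat w - A) *v v = 0 \<longrightarrow> v = 0)"
    by (metis invertible_det_nz invertible_left_inverse matrix_left_invertible_ker)
  then show ?thesis
    unfolding eigenvalue_def eq by auto
qed

text \<open>Unitary conjugation preserves determinants, so by \<open>moser_det\<close> the
  characteristic determinant of H(t) is that of the diagonal matrix of positions, which has a zero
  row at \<open>w = x j t\<close>.\<close>

lemma eigenvalue_moser_H:
  fixes x :: "'n::{finite,linorder} \<Rightarrow> real \<Rightarrow> real"
  assumes cm: "calogero_moser_solution x"
    and data: "moser_data (\<lambda>j. x j 0) (\<lambda>j. deriv (x j) 0) c \<gamma>"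
  shows "eigenvalue (moser_H c \<gamma> t) (complex_of_real (x j t))"
proof -
  let ?w = "complex_of_real (x j t)"
  obtain U where U: "unitary_matrix U"
    "conj_transpose U ** (diag_matrix (\<lambda>j. x j 0) + t *\<^sub>R moser_L (\<lambda>j. x j 0) (\<lambda>j. deriv (x j) 0)) ** U
      = moser_H c \<gamma> t"
    using data unfolding moser_data_def by blast
  let ?A = "diag_matrix (\<lambda>j. x j 0) + t *\<^sub>R moser_L (\<lambda>j. x j 0) (\<lambda>j. deriv (x j) 0)"
  have "conj_transpose U ** mat ?w ** U = mat ?w ** (conj_transpose U ** U)"
    by (simp add: mat_mult_left mat_mult_right mult.commute flip: matrix_mul_assoc)
       (simp add: matrix_matrix_mult_def vec_eq_iff sum_distrib_left mult_ac)
  also have "\<dots> = mat ?w"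
    using U(1) by (simp add: unitary_matrix_def)
  finally have "mat ?w - moser_H c \<gamma> t = conj_transpose U ** (mat ?w - ?A) ** U"
    unfolding U(2)[symmetric] by (simp add: matrix_diff_ldistrib matrix_diff_rdistrib)
  moreover have "det (mat ?w - diag_matrix (\<lambda>j. x j t)) = 0"
    by (rule det_zero_row(1)[of j])
      (auto simp: row_def mat_def diag_matrix_def vec_eq_iff)
  ultimately show ?thesis
    unfolding eigenvalue_iff_det by (simp add: det_mul moser_det[OF cm, symmetric])
qed

section \<open>Conserved energy and the bounds it provides\<close>

definition energy :: "('n::finite \<Rightarrow> real) \<Rightarrow> ('n \<Rightarrow> real) \<Rightarrow> real" where
  \<comment> \<open>twice the energy; the terms with \<open>j = k\<close> vanish because \<open>4 / 0 = 0\<close>\<close>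
  "energy x v = (\<Sum>j\<in>UNIV. (v j)\<^sup>2) + (\<Sum>j\<in>UNIV. \<Sum>k\<in>UNIV. 4 / (x j - x k)\<^sup>2)"

text \<open>With S the double sum of v_j / (x_j - x_k)^3, the kinetic part contributes 16 S and the
  potential part -16 S, because exchanging the indices changes the sign of the cube.\<close>

lemma energy_conserved:
  fixes x :: "'n::{finite,linorder} \<Rightarrow> real \<Rightarrow> real"
  assumes cm: "calogero_moser_solution x"
  shows "energy (\<lambda>j. x j t) (\<lambda>j. deriv (x j) t) = energy (\<lambda>j. x j 0) (\<lambda>j. deriv (x j) 0)"
proof -
  let ?v = "\<lambda>j. deriv (x j)"
  \<comment> \<open>The term \<open>k = j\<close> can be included since \<open>8 / 0 = 0\<close>;
    sums over the full square can then be swapped.\<close>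
  have acc: "(?v j has_real_derivative (\<Sum>k\<in>UNIV. 8 / (x j t - x k t) ^ 3)) (at t)" for j t
    using calogero_moser_derivs(3)[OF cm, of j t] by (subst sum.remove[of _ j]) auto
  have d: "((\<lambda>t. 4 / (x j t - x k t)\<^sup>2) has_real_derivative - 8 * (?v j t - ?v k t) / (x j t - x k t) ^ 3) (at t)" for j k t
  proof (cases "j = k")
    case False
    have "((\<lambda>t. 4 / (g t)\<^sup>2) has_real_derivative - 8 * D / g t ^ 3) (at t)"
      if "(g has_real_derivative D) (at t)" "g t \<noteq> 0" for g D and t :: real
      using that by (auto intro!: derivative_eq_intros simp: field_simps eval_nat_numeral)
    from this[OF DERIV_diff[OF calogero_moser_derivs(2)[OF cm] calogero_moser_derivs(2)[OF cm]] calogero_moser_neq[OF cm False]]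
    show ?thesis .
  qed simp
  let ?D = "\<lambda>t. (\<Sum>j\<in>UNIV. 2 * (?v j t * (\<Sum>k\<in>UNIV. 8 / (x j t - x k t) ^ 3))) +
      (\<Sum>j\<in>UNIV. \<Sum>k\<in>UNIV. - 8 * (?v j t - ?v k t) / (x j t - x k t) ^ 3)"
  have "((\<lambda>t. energy (\<lambda>j. x j t) (\<lambda>j. deriv (x j) t)) has_real_derivative ?D t) (at t)" for t
    unfolding energy_def
    by (rule derivative_eq_intros acc d refl | simp add: mult_ac)+
  moreover have "?D t = 0" for t
  proof -
    let ?S = "\<Sum>j\<in>UNIV. \<Sum>k\<in>UNIV. ?v j t / (x j t - x k t) ^ 3"
    have "(\<Sum>j\<in>UNIV. \<Sum>k\<in>UNIV. ?v k t / (x j t - x k t) ^ 3) = (\<Sum>k\<in>UNIV. \<Sum>j\<in>UNIV. ?v k t / (x j t - x k t) ^ 3)"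
      by (rule sum.swap)
    also have "\<dots> = (\<Sum>k\<in>UNIV. \<Sum>j\<in>UNIV. - (?v k t / (x k t - x j t) ^ 3))"
    proof (intro sum.cong refl)
      fix j k
      have "(x j t - x k t) ^ 3 = - ((x k t - x j t) ^ 3)"
        by (simp add: power3_eq_cube algebra_simps)
      then show "?v k t / (x j t - x k t) ^ 3 = - (?v k t / (x k t - x j t) ^ 3)" by simp
    qed
    also have "\<dots> = - ?S" by (simp add: sum_negf)
    finally have sw: "(\<Sum>j\<in>UNIV. \<Sum>k\<in>UNIV. ?v k t / (x j t - x k t) ^ 3) = - ?S" .
    have "(\<Sum>j\<in>UNIV. \<Sum>k\<in>UNIV. - 8 * (?v j t - ?v k t) / (x j t - x k t) ^ 3)
       = 8 * (\<Sum>j\<in>UNIV. \<Sum>k\<in>UNIV. ?v k t / (x j t - x k t) ^ 3) - 8 * ?S"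
      by (simp add: sum_distrib_left flip: sum_subtractf) (simp add: algebra_simps diff_divide_distrib)
    moreover have "(\<Sum>j\<in>UNIV. 2 * (?v j t * (\<Sum>k\<in>UNIV. 8 / (x j t - x k t) ^ 3))) = 16 * ?S"
      by (simp add: sum_distrib_left mult_ac)
    ultimately show ?thesis using sw by simp
  qed
  ultimately show ?thesis
    using DERIV_isconst_all[of "\<lambda>t. energy (\<lambda>j. x j t) (\<lambda>j. deriv (x j) t)"] by simp
qed

lemma velocity_sq_le_energy: "(v j)\<^sup>2 \<le> energy x v"
proof -
  have "(v j)\<^sup>2 \<le> (\<Sum>j\<in>UNIV. (v j)\<^sup>2)"
    by (rule member_le_sum) auto
  moreover have "0 \<le> (\<Sum>j\<in>UNIV. \<Sum>k\<in>UNIV. 4 / (x j - x k)\<^sup>2)"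
    by (intro sum_nonneg) auto
  ultimately show ?thesis by (simp add: energy_def)
qed

text \<open>A single pair term is at most the whole energy, which keeps any two particles at
  distance at least 2 / sqrt(energy).\<close>

lemma gap_le_energy:
  shows "4 / (x j - x k)\<^sup>2 \<le> energy x v"
proof -
  have "4 / (x j - x k)\<^sup>2 \<le> (\<Sum>k\<in>UNIV. 4 / (x j - x k)\<^sup>2)"
    by (rule member_le_sum) auto
  also have "\<dots> \<le> (\<Sum>j\<in>UNIV. \<Sum>k\<in>UNIV. 4 / (x j - x k)\<^sup>2)"
    by (rule member_le_sum[of j UNIV "\<lambda>j. \<Sum>k\<in>UNIV. 4 / (x j - x k)\<^sup>2"]) (auto intro!: sum_nonneg)
  also have "\<dots> \<le> energy x v"
    by (simp add: energy_def sum_nonneg)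
  finally show ?thesis .
qed

text \<open>Both sides are the trace of L^2, which unitary conjugation preserves; each off-diagonal
  pair product is 4 / (x_j - x_k)^2, and this explains the normalisation of \<open>energy\<close>.
  The lemma bounds the \<open>c j\<close> by the same constant as the velocities.\<close>

lemma sum_sq_moser_data:
  assumes "moser_data x v c \<gamma>"
  shows "(\<Sum>j\<in>UNIV. (c j)\<^sup>2) = energy x v"
proof -
  let ?L = "moser_L x v"
  obtain U where U: "unitary_matrix U" "conj_transpose U ** ?L ** U = diag_matrix c"
    using assms unfolding moser_data_def by blast
  have "diag_matrix c ** diag_matrix c = conj_transpose U ** (?L ** (U ** conj_transpose U) ** ?L ** U)"
    unfolding U(2)[symmetric] by (simp add: matrix_mul_assoc)
  also have "\<dots> = conj_transpose U ** (?L ** ?L ** U)"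
    using U(1) by (simp add: unitary_matrix_def)
  finally have "trace (diag_matrix c ** diag_matrix c) = trace (?L ** ?L ** (U ** conj_transpose U))"
    using trace_mul_sym[of "conj_transpose U" "?L ** ?L ** U"] by (simp add: matrix_mul_assoc)
  also have "\<dots> = trace (?L ** ?L)"
    using U(1) by (simp add: unitary_matrix_def)
  also have "\<dots> = (\<Sum>j\<in>UNIV. \<Sum>k\<in>UNIV. (if j = k then complex_of_real ((v j)\<^sup>2) else 0)
      + complex_of_real (4 / (x j - x k)\<^sup>2))"
  proof -
    have "?L $ j $ k * ?L $ k $ j = (if j = k then complex_of_real ((v j)\<^sup>2) else 0)
      + complex_of_real (4 / (x j - x k)\<^sup>2)" for j k
    proof -
      have "(2 * \<i> / complex_of_real d) * (2 * \<i> / complex_of_real (- d)) = complex_of_real (4 / d\<^sup>2)" for d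
        by (simp add: power2_eq_square)
      from this[of "x j - x k"] show ?thesis
        by (simp add: moser_L_def power2_eq_square)
    qed
    then show ?thesis by (simp add: trace_def matrix_matrix_mult_def)
  qed
  also have "\<dots> = complex_of_real (energy x v)"
    by (simp add: energy_def sum.distrib)
  also have "trace (diag_matrix c ** diag_matrix c) = complex_of_real (\<Sum>j\<in>UNIV. (c j)\<^sup>2)"
    by (simp add: trace_def matrix_matrix_mult_def diag_matrix_def power2_eq_square
        if_distrib[where f="\<lambda>z. z * _"] cong: if_cong)
  finally show ?thesis
    using of_real_eq_iff by blast
qed

section \<open>Spectral resolution of Hermitian matrices\<close>

definition cinner :: "complex^'n \<Rightarrow> complex^'n \<Rightarrow> complex" where
  "cinner u v = (\<Sum>k\<in>UNIV. cnj (u $ k) * v $ k)"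

lemma cinner_simps [simp]:
  "cinner (u + v) w = cinner u w + cinner v w" "cinner u (v + w) = cinner u v + cinner u w"
  "cinner (a *s u) w = cnj a * cinner u w" "cinner u (a *s w) = a * cinner u w"
  "cinner (u - v) w = cinner u w - cinner v w" "cinner u (v - w) = cinner u v - cinner u w"
  by (simp_all add: cinner_def algebra_simps sum.distrib sum_subtractf sum_distrib_left)

lemma cinner_sum_right: "cinner u (\<Sum>i\<in>I. f i) = (\<Sum>i\<in>I. cinner u (f i))"
  by (induction I rule: infinite_finite_induct) (simp_all, simp_all add: cinner_def)

lemma cinner_commute: "cinner v u = cnj (cinner u v)"
  by (simp add: cinner_def mult.commute)

lemma cinner_self: "cinner u u = complex_of_real (\<Sum>k\<in>UNIV. (cmod (u $ k))\<^sup>2)"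
  by (simp add: cinner_def complex_norm_square mult.commute del: of_real_power)

lemma cinner_self_eq_0: "cinner u u = 0 \<longleftrightarrow> u = 0"
  unfolding cinner_self of_real_eq_0_iff by (subst sum_nonneg_eq_0_iff) (auto simp: vec_eq_iff)

lemma cinner_hermitian:
  assumes "conj_transpose A = A"
  shows "cinner (A *v u) v = cinner u (A *v v)"
proof -
  have "cnj (A $ j $ k) = A $ k $ j" for j k
    using arg_cong[OF assms, of "\<lambda>B. B $ k $ j"] by (simp add: conj_transpose_def map_matrix_def transpose_def)
  then have "cinner (A *v u) v = (\<Sum>j\<in>UNIV. \<Sum>k\<in>UNIV. cnj (u $ k) * A $ k $ j * v $ j)"
    by (simp add: cinner_def matrix_vector_mult_def sum_distrib_left sum_distrib_right mult_ac)
  also have "\<dots> = (\<Sum>k\<in>UNIV. \<Sum>j\<in>UNIV. cnj (u $ k) * A $ k $ j * v $ j)"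
    by (rule sum.swap)
  also have "\<dots> = cinner u (A *v v)"
    by (simp add: cinner_def matrix_vector_mult_def sum_distrib_left mult_ac)
  finally show ?thesis .
qed

locale eigenbasis =
  fixes A :: "complex^'n^'n" and x :: "'n \<Rightarrow> real" and u :: "'n \<Rightarrow> complex^'n"
  assumes hermitian: "conj_transpose A = A"
    and inj: "inj x"
    and eigen: "\<And>j. A *v u j = complex_of_real (x j) *s u j"
    and ortho: "\<And>j k. cinner (u j) (u k) = (if j = k then 1 else 0)"
    and complete: "\<And>p q. (\<Sum>j\<in>UNIV. u j $ p * cnj (u j $ q)) = (if p = q then 1 else 0)"

text \<open>Distinct eigenvalues make normalised eigenvectors orthogonal. There are N of them, so
  the square matrix \<open>V\<close> of eigenvectors has a left inverse, which is then also a right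
  inverse: this is completeness.\<close>

lemma hermitian_eigenbasis:
  fixes A :: "complex^'n^'n" and x :: "'n \<Rightarrow> real"
  assumes A: "conj_transpose A = A" and inj: "inj x"
    and ev: "\<And>j. eigenvalue A (complex_of_real (x j))"
  shows "\<exists>u. eigenbasis A x u"
proof -
  have "\<exists>w. A *v w = complex_of_real (x j) *s w \<and> cinner w w = 1" for j
  proof -
    obtain v where v: "v \<noteq> 0" "A *v v = complex_of_real (x j) *s v"
      using ev[of j] unfolding eigenvalue_def by blast
    define n where "n = (\<Sum>k\<in>UNIV. (cmod (v $ k))\<^sup>2)"
    have n: "cinner v v = complex_of_real n" "n > 0"
    proof -
      show eq: "cinner v v = complex_of_real n" unfolding n_def by (rule cinner_self)
      have "n \<noteq> 0" using eq v(1) cinner_self_eq_0[of v] by auto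
      moreover have "n \<ge> 0" unfolding n_def by (intro sum_nonneg) auto
      ultimately show "n > 0" by simp
    qed
    define b where "b = complex_of_real (1 / sqrt n)"
    have "A *v (b *s v) = complex_of_real (x j) *s (b *s v)"
      unfolding vector_scalar_commute v(2) by (simp add: vec_eq_iff)
    moreover have "cinner (b *s v) (b *s v) = complex_of_real (1 / sqrt n * (1 / sqrt n) * n)"
      unfolding cinner_simps n(1) b_def complex_cnj_complex_of_real of_real_mult by simp
    moreover have "1 / sqrt n * (1 / sqrt n) * n = 1"
      using n(2) by (simp add: real_sqrt_mult_self)
    ultimately show ?thesis by (metis of_real_1)
  qed
  then obtain u where u: "\<And>j. A *v u j = complex_of_real (x j) *s u j" "\<And>j. cinner (u j) (u j) = 1"
    by metis
  have on: "cinner (u j) (u k) = (if j = k then 1 else 0)" for j k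
  proof (cases "j = k")
    case False
    have "complex_of_real (x j) * cinner (u j) (u k) = complex_of_real (x k) * cinner (u j) (u k)"
      using cinner_hermitian[OF A, of "u j" "u k"] by (simp add: u)
    then show ?thesis using False inj by (auto dest: injD)
  qed (simp add: u)
  define V :: "complex^'n^'n" where "V = (\<chi> p j. u j $ p)"
  have "conj_transpose V ** V = mat 1"
    using on by (simp add: vec_eq_iff matrix_matrix_mult_def conj_transpose_def map_matrix_def transpose_def
        V_def mat_def cinner_def)
  then have "V ** conj_transpose V = mat 1"
    using matrix_left_right_inverse by blast
  then have "(\<Sum>j\<in>UNIV. u j $ p * cnj (u j $ q)) = (if p = q then 1 else 0)" for p q
    by (auto simp: vec_eq_iff matrix_matrix_mult_def conj_transpose_def map_matrix_def transpose_def
        V_def mat_def)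
  with u(1) on show ?thesis
    by (intro exI[of _ u] eigenbasis.intro A inj)
qed

context eigenbasis
begin

lemma expansion: "f = (\<Sum>j\<in>UNIV. cinner (u j) f *s u j)"
proof -
  have "(\<Sum>j\<in>UNIV. cinner (u j) f *s u j) $ p = f $ p" for p
  proof -
    have "(\<Sum>j\<in>UNIV. cinner (u j) f *s u j) $ p = (\<Sum>j\<in>UNIV. \<Sum>q\<in>UNIV. f $ q * (u j $ p * cnj (u j $ q)))"
      by (simp add: cinner_def sum_distrib_left mult_ac)
    also have "\<dots> = (\<Sum>q\<in>UNIV. f $ q * (\<Sum>j\<in>UNIV. u j $ p * cnj (u j $ q)))"
      by (subst sum.swap) (simp add: sum_distrib_left)
    also have "\<dots> = f $ p"
      by (simp add: complete if_distrib[where f="\<lambda>z. _ * z"] cong: if_cong)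
    finally show ?thesis .
  qed
  then show ?thesis by (simp add: vec_eq_iff)
qed

lemma eqI: "(\<And>j. cinner (u j) f = cinner (u j) g) \<Longrightarrow> f = g"
  using expansion[of f] expansion[of g] by simp

lemma cinner_A: "cinner (u j) (A *v f) = complex_of_real (x j) * cinner (u j) f"
  using cinner_hermitian[OF hermitian, of "u j" f] by (simp add: eigen)

lemma norm_expansion: "cinner f f = complex_of_real (\<Sum>j\<in>UNIV. (cmod (cinner (u j) f))\<^sup>2)"
proof -
  have "cinner f f = cinner f (\<Sum>j\<in>UNIV. cinner (u j) f *s u j)"
    using expansion[of f] by simp
  also have "\<dots> = (\<Sum>j\<in>UNIV. cinner (u j) f * cnj (cinner (u j) f))"
    unfolding cinner_sum_right cinner_simps by (subst cinner_commute[of f]) simp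
  finally show ?thesis by (simp add: complex_norm_square del: of_real_power)
qed

text \<open>The definite description also requires uniqueness. If the orthogonal projections P and E
  have the same range, then PE = E and EP = P, and taking adjoints gives P = E.\<close>

lemma spectral_proj: "spectral_proj A (complex_of_real (x j)) = (\<chi> p q. u j $ p * cnj (u j $ q))"
proof -
  let ?E = "(\<chi> p q. u j $ p * cnj (u j $ q)) :: complex^'n^'n"
  let ?Q = "\<lambda>P :: complex^'n^'n. P ** P = P \<and> conj_transpose P = P \<and>
     range (\<lambda>v. P *v v) = {v. A *v v = complex_of_real (x j) *s v}"
  have E: "?E *v v = cinner (u j) v *s u j" for v
    by (simp add: vec_eq_iff matrix_vector_mult_def cinner_def sum_distrib_left mult_ac)
  have "?Q ?E"
  proof (intro conjI)
    show "?E ** ?E = ?E"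
      unfolding matrix_eq matrix_vector_mul_assoc[symmetric] E by (simp add: ortho)
    show "conj_transpose ?E = ?E"
      by (simp add: vec_eq_iff conj_transpose_def map_matrix_def transpose_def mult.commute)
    show "range (\<lambda>v. ?E *v v) = {v. A *v v = complex_of_real (x j) *s v}"
    proof safe
      show "A *v (?E *v v) = complex_of_real (x j) *s (?E *v v)" for v
        unfolding E vector_scalar_commute eigen by (simp add: vec_eq_iff)
      fix v assume v: "A *v v = complex_of_real (x j) *s v"
      have "v = ?E *v v" unfolding E
      proof (rule eqI)
        fix k
        have "complex_of_real (x k) * cinner (u k) v = complex_of_real (x j) * cinner (u k) v"
          using cinner_A[of k v] by (simp only: v cinner_simps)
        then have "cinner (u k) v = 0 \<or> k = j"
          using injD[OF inj, of j k] by auto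
        then show "cinner (u k) v = cinner (u k) (cinner (u j) v *s u j)"
          by (auto simp: ortho)
      qed
      then show "v \<in> range (\<lambda>v. ?E *v v)" by (rule range_eqI)
    qed
  qed
  moreover have "P = ?E" if P: "?Q P" for P
  proof -
    have fix1: "P *v (?E *v v) = ?E *v v" for v
    proof -
      have "?E *v v \<in> range (\<lambda>v. P *v v)"
        using P \<open>?Q ?E\<close> by (metis (no_types, lifting) rangeI)
      then obtain w where "?E *v v = P *v w" by blast
      then show ?thesis using P by (simp add: matrix_vector_mul_assoc)
    qed
    have fix2: "?E *v (P *v v) = P *v v" for v
    proof -
      have "P *v v \<in> range (\<lambda>v. ?E *v v)"
        using P \<open>?Q ?E\<close> by (metis (no_types, lifting) rangeI)
      then obtain w where "P *v v = ?E *v w" by blast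
      then show ?thesis using \<open>?Q ?E\<close> by (simp add: matrix_vector_mul_assoc)
    qed
    have "P *v v = ?E *v v" for v
    proof (rule eqI)
      fix k
      have hP: "conj_transpose P = P" and hE: "conj_transpose ?E = ?E"
        using P \<open>?Q ?E\<close> by blast+
      have "cinner (u k) (P *v v) = cinner (u k) (?E *v (P *v v))" by (simp add: fix2)
      also have "\<dots> = cinner (P *v (?E *v u k)) v"
        by (simp add: cinner_hermitian[OF hP] cinner_hermitian[OF hE])
      also have "\<dots> = cinner (u k) (?E *v v)"
        by (simp add: fix1 cinner_hermitian[OF hE])
      finally show "cinner (u k) (P *v v) = cinner (u k) (?E *v v)" .
    qed
    then show ?thesis by (simp add: matrix_eq)
  qed
  ultimately show ?thesis
    unfolding spectral_proj_def by (rule the_equality)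
qed

lemma trace_spectral_proj:
  "trace (basis_proj m ** spectral_proj A (complex_of_real (x j))) = complex_of_real ((cmod (u j $ m))\<^sup>2)"
proof -
  have "(basis_proj m :: complex^'n^'n) $ p $ q = (if p = m then if q = m then 1 else 0 else 0)" for p q
    by (simp add: basis_proj_def axis_def)
  then have "trace (basis_proj m ** spectral_proj A (complex_of_real (x j)))
      = (\<Sum>p\<in>UNIV. \<Sum>q\<in>UNIV. (if p = m then if q = m then u j $ m * cnj (u j $ m) else 0 else 0))"
    unfolding spectral_proj trace_def matrix_matrix_mult_def
    by (auto intro!: sum.cong)
  also have "\<dots> = u j $ m * cnj (u j $ m)"
  proof -
    have "(\<Sum>q\<in>UNIV. (if p = m then if q = m then b else 0 else 0)) = (if p = m then b else 0)"
      for p and b :: complex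
      by (cases "p = m") auto
    then show ?thesis by simp
  qed
  finally show ?thesis
    by (simp add: complex_norm_square del: of_real_power)
qed

lemma sum_weights: "(\<Sum>j\<in>UNIV. (cmod (u j $ m))\<^sup>2) = 1"
proof -
  have "complex_of_real (\<Sum>j\<in>UNIV. (cmod (u j $ m))\<^sup>2) = 1"
    using complete[of m m] by (simp add: complex_norm_square del: of_real_power)
  then show ?thesis using of_real_eq_1_iff by blast
qed

end

section \<open>Weights of the Moser matrix\<close>

lemma hermitian_moser_H: "conj_transpose (moser_H c \<gamma> t) = moser_H c \<gamma> t"
  by (auto simp: vec_eq_iff conj_transpose_def map_matrix_def transpose_def moser_H_def)
     (metis minus_diff_eq minus_divide_right minus_minus)

text \<open>Multiplication by \<open>c j - c k\<close> turns every off-diagonal entry of H into the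
  constant 2 \<i>, and the diagonal, hence all dependence on \<open>t\<close> and
  \<open>\<gamma>\<close>, disappears. Both the positivity of the weights and the density formula
  rest on this identity.\<close>

lemma moser_H_commutator:
  assumes "inj c"
  shows "c j * (moser_H c \<gamma> t *v f) $ j - (moser_H c \<gamma> t *v (\<chi> k. c k * f $ k)) $ j
    = 2 * \<i> * ((\<Sum>k\<in>UNIV. f $ k) - f $ j)"
proof -
  have "c j * (moser_H c \<gamma> t *v f) $ j - (moser_H c \<gamma> t *v (\<chi> k. c k * f $ k)) $ j
    = (\<Sum>k\<in>UNIV. (c j - c k) * moser_H c \<gamma> t $ j $ k * f $ k)"
    by (simp add: matrix_vector_mult_def sum_distrib_left algebra_simps flip: sum_subtractf)
  also have "\<dots> = (\<Sum>k\<in>UNIV. 2 * \<i> * f $ k - (if k = j then 2 * \<i> * f $ k else 0))"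
    using assms by (auto intro!: sum.cong simp: moser_H_def dest: injD)
  also have "\<dots> = 2 * \<i> * ((\<Sum>k\<in>UNIV. f $ k) - f $ j)"
    by (simp add: sum_subtractf sum_distrib_left algebra_simps)
  finally show ?thesis .
qed

text \<open>Let C be the diagonal matrix of the \<open>c k\<close>. If \<open>u $ m = 0\<close>,
  then u = (C - c_m) v for some v whose entries sum to 0, and the commutator gives (C - c_m) w = -2
  \<i> v for w = (H - x) v. As (H - x) u = 0, the vector w is orthogonal to u; but the inner product
  of u and w is -2 \<i> times the squared norm of v. Hence v = 0 and u = 0.\<close>

lemma moser_H_eigenvector_nz:
  fixes u :: "complex^'n"
  assumes c: "inj c" and u: "moser_H c \<gamma> t *v u = complex_of_real x *s u" "u \<noteq> 0"
  shows "u $ m \<noteq> 0"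
proof
  assume um: "u $ m = 0"
  define H where "H = moser_H c \<gamma> t"
  \<comment> \<open>At \<open>k = m\<close> the quotient is \<open>0 / 0 = 0\<close>, consistent
    with \<open>u $ m = 0\<close>.\<close>
  define v :: "complex^'n" where "v = (\<chi> k. u $ k / (c k - c m))"
  have uv: "u $ k = (c k - c m) * v $ k" for k
    using c um by (cases "k = m") (auto simp: v_def dest: injD)
  have sv: "(\<Sum>k\<in>UNIV. v $ k) = 0"
  proof -
    \<comment> \<open>Row \<open>m\<close> of the eigenvalue equation, whose right side vanishes, is
      up to a factor the sum of the entries of \<open>v\<close>.\<close>
    have "H $ m $ k * u $ k = - 2 * \<i> * v $ k" for k
    proof (cases "k = m")
      case False
      have "H $ m $ k * u $ k = 2 * \<i> * u $ k / - complex_of_real (c k - c m)"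
        using False by (simp add: H_def moser_H_def)
      then show ?thesis unfolding minus_divide_right[symmetric] by (simp add: v_def)
    qed (simp add: um v_def)
    then have "(H *v u) $ m = - 2 * \<i> * (\<Sum>k\<in>UNIV. v $ k)"
      by (simp add: matrix_vector_mult_def sum_distrib_left)
    moreover have "(H *v u) $ m = 0" using u um by (simp add: H_def)
    ultimately show ?thesis by simp
  qed
  define w where "w = H *v v - complex_of_real x *s v"
  have Cv: "(\<chi> k. c k * v $ k) = u + complex_of_real (c m) *s v"
    by (simp add: vec_eq_iff uv algebra_simps)
  have w: "(c k - c m) * w $ k = - 2 * \<i> * v $ k" for k
  proof -
    have "c k * (H *v v) $ k - (H *v u + c m *s (H *v v)) $ k = - 2 * \<i> * v $ k"
      using moser_H_commutator[OF c, of k \<gamma> t v] sv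
      unfolding Cv H_def[symmetric] by (simp add: matrix_vector_right_distrib vector_scalar_commute)
    then show ?thesis
      using uv[of k] u(1) by (simp add: w_def H_def algebra_simps)
  qed
  have "cinner u w = 0"
    using cinner_hermitian[OF hermitian_moser_H[of c \<gamma> t], of u v]
    by (simp add: w_def H_def u)
  moreover have "cinner u w = - 2 * \<i> * cinner v v"
  proof -
    have "cnj (u $ k) * w $ k = - 2 * \<i> * (cnj (v $ k) * v $ k)" for k
    proof -
      have "cnj (u $ k) * w $ k = cnj (v $ k) * ((c k - c m) * w $ k)" by (simp add: uv)
      then show ?thesis unfolding w by simp
    qed
    then show ?thesis unfolding cinner_def sum_distrib_left by simp
  qed
  ultimately have "cinner v v = 0" by simp
  then have "v = 0" by (simp only: cinner_self_eq_0)
  then have "u = 0" using uv by (simp add: vec_eq_iff)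
  then show False using u by simp
qed

section \<open>Time dependence of the spectral projections\<close>

locale spectral_flow =
  fixes c \<gamma> :: "'n::finite \<Rightarrow> real" and x v :: "'n \<Rightarrow> real \<Rightarrow> real"
    and u :: "real \<Rightarrow> 'n \<Rightarrow> complex^'n" and K :: real
  assumes basis: "\<And>t. eigenbasis (moser_H c \<gamma> t) (\<lambda>j. x j t) (u t)"
    and inj_c: "inj c"
    and x_deriv: "\<And>j t. (x j has_real_derivative v j t) (at t)"
    and v_le: "\<And>j t. \<bar>v j t\<bar> \<le> K" and c_le: "\<And>j. \<bar>c j\<bar> \<le> K" and K_pos: "K > 0"
    and gap: "\<And>j k t. j \<noteq> k \<Longrightarrow> 2 / K \<le> \<bar>x j t - x k t\<bar>"
begin

text \<open>Entries of the spectral projection of \<open>x j t\<close>. Unlike \<open>u t j\<close>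
  they do not depend on the arbitrary phase of the eigenvector, so they can be expected to vary
  smoothly with \<open>t\<close>.\<close>

definition e :: "'n \<Rightarrow> real \<Rightarrow> 'n \<Rightarrow> 'n \<Rightarrow> complex" where
  "e j t p q = u t j $ p * cnj (u t j $ q)"

text \<open>An entry of E_k(s) diag(c) E_j(t). Since H(t) - H(s) = (t - s) diag(c), this is the
  numerator of first-order perturbation theory, taken between two times.\<close>

definition T :: "'n \<Rightarrow> 'n \<Rightarrow> real \<Rightarrow> real \<Rightarrow> 'n \<Rightarrow> 'n \<Rightarrow> complex" where
  "T k j s t p q = (\<Sum>l\<in>UNIV. e k s p l * c l * e j t l q)"

definition weight :: "'n \<Rightarrow> 'n \<Rightarrow> real \<Rightarrow> real" where
  "weight m j t = (cmod (u t j $ m))\<^sup>2"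

lemma weight_pos: "weight m j t > 0"
proof -
  interpret eigenbasis "moser_H c \<gamma> t" "\<lambda>j. x j t" "u t" by (rule basis)
  have "u t j \<noteq> 0" using ortho[of j j] by (auto simp: cinner_def)
  then show ?thesis
    using moser_H_eigenvector_nz[OF inj_c eigen] by (simp add: weight_def)
qed

lemma sum_weight: "(\<Sum>j\<in>UNIV. weight m j t) = 1"
  using eigenbasis.sum_weights[OF basis] by (simp add: weight_def)

lemma weight_le_1: "weight m j t \<le> 1"
  using member_le_sum[of j UNIV "\<lambda>j. weight m j t"] weight_pos[of m _ t] sum_weight[of m t]
  by (auto simp: less_imp_le)

lemma norm_e: "cmod (e j t p q) \<le> 1"
proof -
  have "cmod (u t j $ p) \<le> 1" for p
    using weight_le_1[of p j t] by (simp add: weight_def power2_le_iff_abs_le[of 1, simplified] abs_square_le_1)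
  then show ?thesis unfolding e_def norm_mult by (simp add: mult_le_one)
qed

lemma norm_T: "cmod (T k j s t p q) \<le> CARD('n) * K"
proof -
  have "cmod (e k s p l * c l * e j t l q) \<le> K" for l
  proof -
    have "cmod (e k s p l * c l * e j t l q) = \<bar>c l\<bar> * (cmod (e k s p l) * cmod (e j t l q))"
      by (simp add: norm_mult)
    also have "\<dots> \<le> \<bar>c l\<bar> * 1"
      by (intro mult_left_mono mult_le_one norm_e) auto
    finally show ?thesis using c_le[of l] by simp
  qed
  then show ?thesis unfolding T_def
    using sum_norm_bound[of UNIV "\<lambda>l. e k s p l * c l * e j t l q" K] by simp
qed

lemma T_eq: "T k j s t p q = u s k $ p * cinner (u s k) (\<chi> l. c l * u t j $ l) * cnj (u t j $ q)"
  by (simp add: T_def e_def cinner_def sum_distrib_left sum_distrib_right mult_ac)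

text \<open>H is affine in time with slope diag(c), so pairing the eigenvalue equation at time
  \<open>t\<close> with an eigenvector at time \<open>s\<close> gives an identity without
  remainder.\<close>

lemma overlap:
  "complex_of_real (x j t - x k s) * cinner (u s k) (u t j) = complex_of_real (t - s) * cinner (u s k) (\<chi> l. c l * u t j $ l)"
proof -
  interpret t: eigenbasis "moser_H c \<gamma> t" "\<lambda>j. x j t" "u t" by (rule basis)
  interpret s: eigenbasis "moser_H c \<gamma> s" "\<lambda>j. x j s" "u s" by (rule basis)
  have "moser_H c \<gamma> t *v f = moser_H c \<gamma> s *v f + complex_of_real (t - s) *s (\<chi> l. c l * f $ l)" for f
  proof -
    have "moser_H c \<gamma> t $ i $ l = moser_H c \<gamma> s $ i $ l + (if i = l then complex_of_real ((t - s) * c l) else 0)" for i l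
      by (simp add: moser_H_def algebra_simps)
    then show ?thesis
      by (simp add: vec_eq_iff matrix_vector_mult_def distrib_right sum.distrib mult.assoc
          if_distrib[where f="\<lambda>z. z * _"] left_diff_distrib cong: if_cong)
  qed
  from this[of "u t j"] have "complex_of_real (x j t) *s u t j =
      moser_H c \<gamma> s *v u t j + complex_of_real (t - s) *s (\<chi> l. c l * u t j $ l)"
    by (simp add: t.eigen)
  from arg_cong[OF this, of "cinner (u s k)"] show ?thesis
    by (simp add: s.cinner_A algebra_simps)
qed

text \<open>An exact difference formula for the spectral projections; it yields their Lipschitz bound
  and their derivative together.\<close>

lemma e_diff:
  assumes "\<And>k. k \<noteq> j \<Longrightarrow> x j t \<noteq> x k s \<and> x k t \<noteq> x j s"
  shows "e j t p q - e j s p q = complex_of_real (t - s) *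
    (\<Sum>k\<in>UNIV - {j}. T k j s t p q / complex_of_real (x j t - x k s) - T j k s t p q / complex_of_real (x k t - x j s))"
proof -
  interpret t: eigenbasis "moser_H c \<gamma> t" "\<lambda>j. x j t" "u t" by (rule basis)
  interpret s: eigenbasis "moser_H c \<gamma> s" "\<lambda>j. x j s" "u s" by (rule basis)
  let ?o = "\<lambda>k j. cinner (u s k) (u t j)"
  \<comment> \<open>The left factor of the projection at \<open>t\<close> is expanded in the basis
    at \<open>s\<close>, and the right factor of the projection at \<open>s\<close> in the basis at
    \<open>t\<close>. The terms \<open>k = j\<close> of the two expansions coincide and cancel, so
    only overlaps between different indices remain.\<close>
  have 1: "u t j $ p = (\<Sum>k\<in>UNIV. u s k $ p * ?o k j)"
    using arg_cong[OF s.expansion[of "u t j"], of "\<lambda>f. f $ p"] by (simp add: mult.commute)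
  have "u s j $ q = (\<Sum>k\<in>UNIV. cinner (u t k) (u s j) * u t k $ q)"
    using arg_cong[OF t.expansion[of "u s j"], of "\<lambda>f. f $ q"] by simp
  then have 2: "cnj (u s j $ q) = (\<Sum>k\<in>UNIV. ?o j k * cnj (u t k $ q))"
    by (subst cinner_commute) simp
  have "e j t p q - e j s p q = (\<Sum>k\<in>UNIV. u s k $ p * ?o k j * cnj (u t j $ q) - u s j $ p * ?o j k * cnj (u t k $ q))"
    unfolding e_def 1 2 by (simp add: sum_distrib_left sum_distrib_right sum_subtractf mult_ac)
  also have "\<dots> = (\<Sum>k\<in>UNIV - {j}. u s k $ p * ?o k j * cnj (u t j $ q) - u s j $ p * ?o j k * cnj (u t k $ q))"
    by (subst sum.remove[of _ j]) auto
  also have "\<dots> = (\<Sum>k\<in>UNIV - {j}. complex_of_real (t - s) * (T k j s t p q / complex_of_real (x j t - x k s) - T j k s t p q / complex_of_real (x k t - x j s)))"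
  proof (rule sum.cong)
    fix k assume "k \<in> UNIV - {j}"
    then have n: "complex_of_real (x j t - x k s) \<noteq> 0" "complex_of_real (x k t - x j s) \<noteq> 0"
      using assms[of k] by auto
    have o: "?o k j = complex_of_real (t - s) * cinner (u s k) (\<chi> l. c l * u t j $ l) / complex_of_real (x j t - x k s)"
      "?o j k = complex_of_real (t - s) * cinner (u s j) (\<chi> l. c l * u t k $ l) / complex_of_real (x k t - x j s)"
      using overlap[of j t k s] overlap[of k t j s] n by (simp_all add: eq_divide_eq mult.commute del: of_real_diff)
    show "u s k $ p * ?o k j * cnj (u t j $ q) - u s j $ p * ?o j k * cnj (u t k $ q)
      = complex_of_real (t - s) * (T k j s t p q / complex_of_real (x j t - x k s) - T j k s t p q / complex_of_real (x k t - x j s))"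
      unfolding o T_eq by (simp add: right_diff_distrib mult_ac del: of_real_diff)
  qed simp
  finally show ?thesis by (simp only: sum_distrib_left)
qed

lemma x_tendsto: "(x j \<longlongrightarrow> x j s) (at s)"
  using DERIV_isCont[OF x_deriv] by (simp add: isCont_def)

text \<open>Half of the uniform gap survives when only one of the two particles is moved in
  time.\<close>

lemma eventually_gap:
  assumes "j \<noteq> k"
  shows "\<forall>\<^sub>F t in at s. 1 / K < \<bar>x j t - x k s\<bar>"
proof (rule order_tendstoD(1))
  show "((\<lambda>t. \<bar>x j t - x k s\<bar>) \<longlongrightarrow> \<bar>x j s - x k s\<bar>) (at s)"
    by (intro tendsto_intros x_tendsto)
  have "1 / K < 2 / K" using K_pos by (simp add: divide_strict_right_mono)
  then show "1 / K < \<bar>x j s - x k s\<bar>" using gap[OF assms, of s] by simp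
qed

lemma eventually_gaps:
  "\<forall>\<^sub>F t in at s. \<forall>k. k \<noteq> j \<longrightarrow> 1 / K < \<bar>x j t - x k s\<bar> \<and> 1 / K < \<bar>x k t - x j s\<bar>"
proof (rule eventually_all_finite)
  fix k
  show "\<forall>\<^sub>F t in at s. k \<noteq> j \<longrightarrow> 1 / K < \<bar>x j t - x k s\<bar> \<and> 1 / K < \<bar>x k t - x j s\<bar>"
    using eventually_gap[of j k s] eventually_gap[of k j s]
    by (cases "k = j") (auto elim: eventually_elim2)
qed

text \<open>The quotient in \<open>e_diff\<close> still contains projections at the moving time, so
  its limit cannot be taken yet. Their entries are at most 1 in modulus, which gives a Lipschitz
  bound near \<open>s\<close> first.\<close>

lemma e_tendsto: "((\<lambda>t. e j t p q) \<longlongrightarrow> e j s p q) (at s)"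
proof -
  let ?R = "\<lambda>t. (\<Sum>k\<in>UNIV - {j}. T k j s t p q / complex_of_real (x j t - x k s) - T j k s t p q / complex_of_real (x k t - x j s))"
  have "\<forall>\<^sub>F t in at s. cmod (e j t p q - e j s p q) \<le> \<bar>t - s\<bar> * (CARD('n) * (2 * (CARD('n) * K * K)))"
    using eventually_gaps[of j s]
  proof eventually_elim
    case (elim t)
    have "0 < 1 / K" using K_pos by simp
    have d: "cmod (T k' j' s t p q / complex_of_real (y1 - y2)) \<le> CARD('n) * K * K" if "1 / K < \<bar>y1 - y2\<bar>" for k' j' and y1 y2 :: real
    proof -
      have "0 < \<bar>y1 - y2\<bar>" using that \<open>0 < 1 / K\<close> by linarith
      have "1 / \<bar>y1 - y2\<bar> \<le> K"
        using that K_pos \<open>0 < \<bar>y1 - y2\<bar>\<close> by (simp add: field_simps)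
      then have "cmod (T k' j' s t p q) * (1 / \<bar>y1 - y2\<bar>) \<le> (CARD('n) * K) * K"
        using K_pos by (intro mult_mono norm_T) auto
      moreover have "cmod (complex_of_real y1 - complex_of_real y2) = \<bar>y1 - y2\<bar>"
        by (metis norm_of_real of_real_diff)
      ultimately show ?thesis by (simp add: norm_divide)
    qed
    have "cmod (?R t) \<le> (\<Sum>k\<in>UNIV - {j}. CARD('n) * K * K + CARD('n) * K * K)"
      by (rule sum_norm_le, rule order_trans[OF norm_triangle_ineq4], rule add_mono; rule d) (use elim in auto)
    also have "\<dots> \<le> CARD('n) * (2 * (CARD('n) * K * K))"
      using K_pos by (simp add: mult_right_mono)
    finally have "cmod (?R t) \<le> CARD('n) * (2 * (CARD('n) * K * K))" .
    moreover have "e j t p q - e j s p q = complex_of_real (t - s) * ?R t"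
      using elim \<open>0 < 1 / K\<close> by (intro e_diff) fastforce
    moreover have "cmod (complex_of_real t - complex_of_real s) = \<bar>t - s\<bar>"
      by (metis norm_of_real of_real_diff)
    ultimately show ?case by (simp add: norm_mult mult_left_mono)
  qed
  moreover have "((\<lambda>t. \<bar>t - s\<bar> * (CARD('n) * (2 * (CARD('n) * K * K)))) \<longlongrightarrow> 0) (at s)"
  proof -
    have "((\<lambda>t. \<bar>t - s\<bar>) \<longlongrightarrow> \<bar>s - s\<bar>) (at s)"
      by (intro tendsto_intros)
    then show ?thesis
      by (intro tendsto_mult_left_zero) simp
  qed
  ultimately have "((\<lambda>t. e j t p q - e j s p q) \<longlongrightarrow> 0) (at s)"
    by (rule Lim_null_comparison)
  then show ?thesis by (rule Lim_null[THEN iffD2])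
qed

text \<open>The quotient of \<open>e_diff\<close> at \<open>t = s\<close>: the first-order
  perturbation formula for a diagonal entry of the projection.\<close>

definition weight_deriv :: "'n \<Rightarrow> 'n \<Rightarrow> real \<Rightarrow> real" where
  "weight_deriv m j s =
     Re (\<Sum>k\<in>UNIV - {j}. T k j s s m m / complex_of_real (x j s - x k s) - T j k s s m m / complex_of_real (x k s - x j s))"

lemma has_derivative_weight: "(weight m j has_real_derivative weight_deriv m j s) (at s)"
proof -
  let ?R = "\<lambda>t. (\<Sum>k\<in>UNIV - {j}. T k j s t m m / complex_of_real (x j t - x k s) - T j k s t m m / complex_of_real (x k t - x j s))"
  have nz: "complex_of_real (x j s - x k s) \<noteq> 0" if "j \<noteq> k" for j k
  proof -
    have "0 < 2 / K" using K_pos by simp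
    then have "x j s \<noteq> x k s" using gap[OF that, of s] by auto
    then show ?thesis by simp
  qed
  have T: "((\<lambda>t. T k j s t m m) \<longlongrightarrow> T k j s s m m) (at s)" for j k
    unfolding T_def by (intro tendsto_intros e_tendsto)
  have "(?R \<longlongrightarrow> ?R s) (at s)"
    by (intro tendsto_intros T x_tendsto) (use nz in auto)
  then have "((\<lambda>t. Re (?R t)) \<longlongrightarrow> weight_deriv m j s) (at s)"
    unfolding weight_deriv_def by (rule tendsto_Re)
  moreover have "\<forall>\<^sub>F t in at s. Re (?R t) = (weight m j t - weight m j s) / (t - s)"
    using eventually_gaps[of j s] eventually_neq_at_within[of s s UNIV]
  proof eventually_elim
    case (elim t)
    have "0 < 1 / K" using K_pos by simp
    have w: "weight m j t = Re (e j t m m)" for t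
      unfolding weight_def e_def complex_norm_square[symmetric] by simp
    have "e j t m m - e j s m m = complex_of_real (t - s) * ?R t"
      using elim(1) \<open>0 < 1 / K\<close> by (subst e_diff) fastforce+
    then have "weight m j t - weight m j s = (t - s) * Re (?R t)"
      unfolding w minus_complex.sel[symmetric] by (simp only: Re_complex_of_real Im_complex_of_real times_complex.sel)
    then show ?case using elim by simp
  qed
  ultimately show ?thesis
    unfolding has_field_derivative_iff by (rule Lim_transform_eventually)
qed

lemma weight_deriv_le: "\<bar>weight_deriv m j s\<bar> \<le> CARD('n) * (CARD('n) * K * K)"
proof -
  \<comment> \<open>At equal times the full gap \<open>2 / K\<close> is available, so each of the
    two terms for an index \<open>k\<close> gives half of \<open>CARD('n) * K * K\<close>.\<close>
  have d: "cmod (T k' j' s s m m / complex_of_real (x k s - x l s)) \<le> CARD('n) * K * K / 2" if "k \<noteq> l" for k' j' k l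
  proof -
    have "0 < 2 / K" using K_pos by simp
    then have "0 < \<bar>x k s - x l s\<bar>" using gap[OF that, of s] by linarith
    then have "1 / \<bar>x k s - x l s\<bar> \<le> K / 2"
      using gap[OF that, of s] K_pos by (simp add: field_simps)
    then have "cmod (T k' j' s s m m) * (1 / \<bar>x k s - x l s\<bar>) \<le> (CARD('n) * K) * (K / 2)"
      using K_pos by (intro mult_mono norm_T) auto
    moreover have "cmod (complex_of_real (x k s) - complex_of_real (x l s)) = \<bar>x k s - x l s\<bar>"
      by (metis norm_of_real of_real_diff)
    ultimately show ?thesis by (simp add: norm_divide)
  qed
  have "\<bar>weight_deriv m j s\<bar> \<le> cmod (\<Sum>k\<in>UNIV - {j}. T k j s s m m / complex_of_real (x j s - x k s) - T j k s s m m / complex_of_real (x k s - x j s))"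
    unfolding weight_deriv_def by (rule abs_Re_le_cmod)
  also have "\<dots> \<le> (\<Sum>k\<in>UNIV - {j}. CARD('n) * K * K / 2 + CARD('n) * K * K / 2)"
    by (rule sum_norm_le, rule order_trans[OF norm_triangle_ineq4], rule add_mono; rule d) auto
  also have "\<dots> \<le> CARD('n) * (CARD('n) * K * K)"
    using K_pos by (simp add: mult_right_mono)
  finally show ?thesis .
qed

end

section \<open>The perturbed Moser matrix\<close>

lemma poly_charpoly: "poly (charpoly A) w = det (mat w - A)"
  unfolding charpoly_def det_def
  by (simp add: poly_sum poly_prod mat_def if_distrib[where f = "\<lambda>p. poly p _"] cong: if_cong)

lemma degree_charpoly: "degree (charpoly (A :: complex^'n^'n)) \<le> CARD('n)"
  unfolding charpoly_def det_def
proof (rule degree_sum_le)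
  let ?e = "\<lambda>i j. ((\<chi> j k. (if j = k then [:0, 1:] else 0) - [:A $ j $ k:]) :: complex poly^'n^'n) $ i $ j"
  fix p assume "p \<in> {p. p permutes (UNIV :: 'n set)}"
  have "degree (prod (\<lambda>i. ?e i (p i)) UNIV) \<le> sum (degree \<circ> (\<lambda>i. ?e i (p i))) UNIV"
    by (rule degree_prod_sum_le) simp
  also have "\<dots> \<le> (\<Sum>i\<in>(UNIV :: 'n set). 1)"
    by (rule sum_mono) (auto intro!: degree_diff_le)
  finally have "degree (prod (\<lambda>i. ?e i (p i)) UNIV) \<le> CARD('n)" by simp
  then show "degree (of_int (sign p) * prod (\<lambda>i. ?e i (p i)) UNIV) \<le> CARD('n)"
    using degree_mult_le[of "of_int (sign p)" "prod (\<lambda>i. ?e i (p i)) UNIV"] by simp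
qed (simp add: finite_permutations)

text \<open>The orders are at least 1 and add up to at most the degree of the characteristic
  polynomial, hence to at most N; with N roots each order must be 1.\<close>

lemma simple_eigenvalue_if_card:
  fixes A :: "complex^'n^'n"
  assumes card: "card {w. eigenvalue A w} = CARD('n)" and w: "eigenvalue A w"
  shows "simple_eigenvalue A w"
proof -
  let ?p = "charpoly A"
  have roots: "{w. poly ?p w = 0} = {w. eigenvalue A w}"
    by (simp add: poly_charpoly eigenvalue_iff_det)
  have fin: "finite {w. eigenvalue A w}"
    using card by (metis card.infinite zero_less_card_finite less_irrefl)
  have nz: "?p \<noteq> 0"
  proof
    assume "?p = 0"
    then have "{w. eigenvalue A w} = UNIV" using roots by simp
    then show False using fin infinite_UNIV_char_0 by metis
  qed
  have ge: "1 \<le> order r ?p" if "eigenvalue A r" for r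
  proof -
    have "poly ?p r = 0" using that roots by blast
    then have "order r ?p \<noteq> 0" using nz order_root by blast
    then show ?thesis by simp
  qed
  have "order w ?p + card ({w. eigenvalue A w} - {w}) \<le> order w ?p + (\<Sum>r\<in>{w. eigenvalue A w} - {w}. order r ?p)"
    using sum_mono[of "{w. eigenvalue A w} - {w}" "\<lambda>_. 1" "\<lambda>r. order r ?p"] ge by simp
  also have "\<dots> = (\<Sum>r | poly ?p r = 0. order r ?p)"
    unfolding roots using fin w by (subst sum.remove[of _ w]) auto
  also have "\<dots> \<le> CARD('n)"
    using sum_order_le_degree[OF nz] degree_charpoly[of A] by linarith
  also have "CARD('n) = 1 + card ({w. eigenvalue A w} - {w})"
    using card fin w by (metis (no_types) One_nat_def card_Suc_Diff1 mem_Collect_eq plus_1_eq_Suc)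
  finally have "order w ?p \<le> 1" by simp
  then show ?thesis
    using ge[OF w] w by (simp add: simple_eigenvalue_def)
qed

lemma moser_M_entry: "moser_M c \<gamma> m \<epsilon> t $ j $ k = moser_H c \<gamma> t $ j $ k
    - (if j = k then complex_of_real (c m * t) else 0) - (if j = m \<and> k = m then \<i> * \<epsilon> else 0)"
  unfolding moser_M_def mat_mult_left by (simp add: mat_def basis_proj_def axis_def)

lemma moser_M_mult: "moser_M c \<gamma> m \<epsilon> t *v f = moser_H c \<gamma> t *v f
    - complex_of_real (c m * t) *s f - (\<i> * \<epsilon> * f $ m) *s axis m 1"
proof -
  have "(\<Sum>k\<in>UNIV. (if j = m \<and> k = m then \<i> * \<epsilon> else 0) * f $ k) = (if j = m then \<i> * \<epsilon> * f $ m else 0)" for j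
    by (cases "j = m") (simp_all add: if_distrib[where f = "\<lambda>z. z * _"] cong: if_cong)
  then show ?thesis
    by (simp add: vec_eq_iff matrix_vector_mult_def moser_M_entry left_diff_distrib sum_subtractf axis_def
        if_distrib[where f = "\<lambda>z. z * _"] cong: if_cong)
qed

lemma cinner_axis: "cinner u (axis m 1) = cnj (u $ m)" "cinner (axis m 1) u = u $ m"
  by (simp_all add: cinner_def axis_def if_distrib[where f = "\<lambda>z. z * _"] if_distrib[where f = "\<lambda>z. _ * z"]
      if_distrib[where f = cnj] cong: if_cong)

locale moser_eigenbasis = eigenbasis "moser_H c \<gamma> t" x u
  for c \<gamma> :: "'n::finite \<Rightarrow> real" and t :: real and x u +
  fixes m :: 'n
  assumes inj_c: "inj c"
begin

definition y :: "'n \<Rightarrow> real" where "y j = x j - c m * t"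
definition a :: "'n \<Rightarrow> real" where "a j = (cmod (u j $ m))\<^sup>2"

lemma u_nz: "u j $ m \<noteq> 0"
proof -
  have "u j \<noteq> 0" using ortho[of j j] by (auto simp: cinner_def)
  then show ?thesis using moser_H_eigenvector_nz[OF inj_c eigen] by blast
qed

lemma a_eq: "complex_of_real (a j) = u j $ m * cnj (u j $ m)"
  by (simp add: a_def complex_norm_square del: of_real_power)

lemma component_m: "f $ m = (\<Sum>j\<in>UNIV. cinner (u j) f * u j $ m)"
  using arg_cong[OF expansion[of f], of "\<lambda>f. f $ m"] by simp

lemma y_eq: "complex_of_real (y j) = complex_of_real (x j) - complex_of_real (c m * t)"
  by (simp add: y_def)

lemma cinner_M: "cinner (u j) (moser_M c \<gamma> m \<epsilon> t *v f) = y j * cinner (u j) f - \<i> * \<epsilon> * f $ m * cnj (u j $ m)"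
  unfolding moser_M_mult cinner_simps cinner_A cinner_axis y_eq by (simp add: algebra_simps)

text \<open>In the eigenbasis of H the rank-one term couples the coordinates of an eigenvector f
  only through \<open>f $ m\<close>. If that entry were 0, f would be a multiple of a single
  \<open>u j\<close>, contrary to \<open>u_nz\<close>. So no \<open>y k\<close> is an eigenvalue,
  the coordinates can be solved for, and summing them back to \<open>f $ m\<close> gives the secular
  equation.\<close>

lemma eigenvalue_moser_M:
  fixes w :: complex
  assumes \<epsilon>: "\<epsilon> > 0"
  shows "eigenvalue (moser_M c \<gamma> m \<epsilon> t) w \<longleftrightarrow>
    (\<forall>k. w \<noteq> y k) \<and> (\<Sum>k\<in>UNIV. a k / (w - y k)) = \<i> / \<epsilon>"
proof
  assume "eigenvalue (moser_M c \<gamma> m \<epsilon> t) w"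
  then obtain f where f: "f \<noteq> 0" "moser_M c \<gamma> m \<epsilon> t *v f = w *s f"
    unfolding eigenvalue_def by blast
  have coeff: "(y j - w) * cinner (u j) f = \<i> * \<epsilon> * f $ m * cnj (u j $ m)" for j
    using cinner_M[of j \<epsilon> f] by (simp add: f algebra_simps)
  have fm: "f $ m \<noteq> 0"
  proof
    assume "f $ m = 0"
    then have c0: "w = y j \<or> cinner (u j) f = 0" for j using coeff[of j] by auto
    obtain j where j: "cinner (u j) f \<noteq> 0"
      using f(1) eqI[of f 0] by (auto simp: cinner_def)
    have others: "cinner (u k) f = 0" if "k \<noteq> j" for k
    proof -
      have "complex_of_real (y k) \<noteq> y j" using that inj by (auto simp: y_def dest: injD)
      then show ?thesis using c0[of j] c0[of k] j by auto
    qed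
    have "f $ m = cinner (u j) f * u j $ m"
      unfolding component_m[of f] by (subst sum.remove[of _ j]) (auto simp: others)
    then show False using j u_nz[of j] \<open>f $ m = 0\<close> by simp
  qed
  have ne: "w \<noteq> y k" for k
    using coeff[of k] fm u_nz[of k] \<epsilon> by auto
  have cu: "cinner (u j) f * u j $ m = - (\<i> * \<epsilon> * f $ m) * (a j / (w - y j))" for j
  proof -
    have "cinner (u j) f = - (\<i> * \<epsilon> * f $ m * cnj (u j $ m)) / (w - y j)"
      using coeff[of j] ne[of j] by (simp add: field_simps)
    then show ?thesis unfolding a_eq by simp
  qed
  have "f $ m = (\<Sum>j\<in>UNIV. cinner (u j) f * u j $ m)" by (rule component_m)
  also have "\<dots> = - (\<i> * \<epsilon> * f $ m) * (\<Sum>j\<in>UNIV. a j / (w - y j))"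
    unfolding cu sum_distrib_left ..
  finally have "f $ m - - (\<i> * \<epsilon> * f $ m) * (\<Sum>j\<in>UNIV. a j / (w - y j)) = 0"
    by (simp only: right_minus_eq)
  then have "f $ m * (1 + \<i> * \<epsilon> * (\<Sum>j\<in>UNIV. a j / (w - y j))) = 0"
    by (simp add: algebra_simps)
  then have "1 + \<i> * \<epsilon> * (\<Sum>j\<in>UNIV. a j / (w - y j)) = 0" using fm by simp
  then have "\<i> * (1 + \<i> * \<epsilon> * (\<Sum>j\<in>UNIV. a j / (w - y j))) = 0" by simp
  then have "\<epsilon> * (\<Sum>j\<in>UNIV. a j / (w - y j)) = \<i>" by (simp add: algebra_simps)
  then have "(\<Sum>j\<in>UNIV. a j / (w - y j)) = \<i> / \<epsilon>" using \<epsilon> by (simp add: field_simps)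
  with ne show "(\<forall>k. w \<noteq> y k) \<and> (\<Sum>k\<in>UNIV. a k / (w - y k)) = \<i> / \<epsilon>" by blast
next
  assume w: "(\<forall>k. w \<noteq> y k) \<and> (\<Sum>k\<in>UNIV. a k / (w - y k)) = \<i> / \<epsilon>"
  \<comment> \<open>The unperturbed resolvent applied to the basis vector e_m. The secular equation
    says precisely that \<open>\<i> * \<epsilon> * f $ m = -1\<close>, which is what the
    perturbation has to supply.\<close>
  define f where "f = (\<Sum>j\<in>UNIV. (cnj (u j $ m) / (w - y j)) *s u j)"
  have fj: "cinner (u j) f = cnj (u j $ m) / (w - y j)" for j
    by (simp add: f_def cinner_sum_right ortho if_distrib[where f = "\<lambda>z. _ * z"] cong: if_cong)
  have fm: "f $ m = \<i> / \<epsilon>"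
    using w unfolding component_m[of f] fj a_eq by (simp add: mult.commute)
  have "moser_M c \<gamma> m \<epsilon> t *v f = w *s f"
  proof (rule eqI)
    fix j
    have "\<i> * \<epsilon> * f $ m = -1" using \<epsilon> by (simp add: fm)
    then show "cinner (u j) (moser_M c \<gamma> m \<epsilon> t *v f) = cinner (u j) (w *s f)"
      using w unfolding cinner_M cinner_simps fj by (simp add: field_simps)
  qed
  moreover have "f \<noteq> 0" using fm \<epsilon> by auto
  ultimately show "eigenvalue (moser_M c \<gamma> m \<epsilon> t) w"
    unfolding eigenvalue_def by blast
qed

text \<open>The commutator identity turns the sum of the entries of a row of the resolvent into the
  norm of that row.\<close>

lemma norm_sum_eq_norm:
  assumes g: "moser_H c \<gamma> t *v g = complex_of_real r *s g + \<kappa> *s axis m 1"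
    and gm: "g $ m = \<kappa> * complex_of_real G"
  shows "complex_of_real ((cmod (\<Sum>k\<in>UNIV. g $ k))\<^sup>2) = cinner g g"
proof -
  let ?C = "\<lambda>f :: complex^'n. (\<chi> k. c k * f $ k)"
  have C: "cinner f (?C h) = cinner (?C f) h" for f h
    by (simp add: cinner_def mult_ac)
  have "?C (moser_H c \<gamma> t *v g) - moser_H c \<gamma> t *v ?C g = (2 * \<i>) *s ((\<chi> k. \<Sum>l\<in>UNIV. g $ l) - g)"
    using moser_H_commutator[OF inj_c, of _ \<gamma> t g] by (simp add: vec_eq_iff right_diff_distrib)
  from arg_cong[OF this, of "cinner g"]
  have "cinner (?C g) (moser_H c \<gamma> t *v g) - cinner (moser_H c \<gamma> t *v g) (?C g)
      = 2 * \<i> * (cinner g (\<chi> k. \<Sum>l\<in>UNIV. g $ l) - cinner g g)"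
    unfolding cinner_simps C[of g "moser_H c \<gamma> t *v g"] cinner_hermitian[OF hermitian, of g "?C g"] .
  \<comment> \<open>With \<open>r\<close> and \<open>G\<close> real, both inner products receive the
    same real contributions: one proportional to \<open>r\<close>, the other being c_m G times the
    squared modulus of \<open>\<kappa>\<close>.\<close>
  moreover have "cinner (?C g) (moser_H c \<gamma> t *v g) - cinner (moser_H c \<gamma> t *v g) (?C g) = 0"
    unfolding g cinner_simps cinner_axis C[symmetric] using gm by (simp add: C)
  moreover have "cinner g (\<chi> k. \<Sum>l\<in>UNIV. g $ l) = complex_of_real ((cmod (\<Sum>k\<in>UNIV. g $ k))\<^sup>2)"
    by (simp add: cinner_def complex_norm_square mult.commute del: of_real_power flip: sum_distrib_right)
  ultimately show ?thesis by simp
qed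

text \<open>The soliton is the sum of the entries of row \<open>m\<close> of the resolvent. The
  squared modulus of that sum equals the squared norm of the row, which is explicit in the
  eigenbasis of H. The points \<open>y k\<close> are excluded because both sums have poles
  there.\<close>

lemma multisoliton_density:
  assumes \<epsilon>: "\<epsilon> > 0" and s: "\<And>k. s \<noteq> y k"
  shows "(cmod (multisoliton c \<gamma> m \<phi> \<epsilon> t s))\<^sup>2 =
    2 * \<epsilon> * (\<Sum>k\<in>UNIV. a k / (s - y k)\<^sup>2) / (1 + (\<epsilon> * (\<Sum>k\<in>UNIV. a k / (s - y k)))\<^sup>2)"
proof -
  let ?M = "moser_M c \<gamma> m \<epsilon> t" and ?s = "complex_of_real s"
  define G where "G = (\<Sum>k\<in>UNIV. a k / (s - y k))"
  have "(\<Sum>k\<in>UNIV. a k / (?s - y k)) = complex_of_real G" by (simp add: G_def)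
  moreover have "complex_of_real G \<noteq> \<i> / \<epsilon>"
  proof
    assume "complex_of_real G = \<i> / \<epsilon>"
    from arg_cong[OF this, of Im] show False using \<epsilon> by simp
  qed
  ultimately have "\<not> eigenvalue ?M ?s"
    unfolding eigenvalue_moser_M[OF \<epsilon>] by simp
  then have "det (mat ?s - ?M) \<noteq> 0" by (simp add: eigenvalue_iff_det)
  then have "invertible (mat ?s - ?M)" by (simp add: invertible_det_nz)
  then obtain B where B: "(mat ?s - ?M) ** B = mat 1" "B ** (mat ?s - ?M) = mat 1"
    unfolding invertible_def by blast
  have neg: "(- P) ** Q = - (P ** Q)" "P ** (- Q) = - (P ** Q)" for P Q :: "complex^'n^'n"
    by (simp_all add: matrix_matrix_mult_def vec_eq_iff sum_negf)
  have "(?M - mat ?s) ** (- B) = mat 1" "(- B) ** (?M - mat ?s) = mat 1"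
    using B neg(1)[of B "?M - mat ?s"] neg(2)[of B "mat ?s - ?M"] neg(1)[of "mat ?s - ?M" B] neg(2)[of "?M - mat ?s" B]
    by simp_all
  then have "invertible (?M - mat ?s)" unfolding invertible_def by blast
  then have R: "matrix_inv (?M - mat ?s) ** (?M - mat ?s) = mat 1"
    unfolding invertible_def matrix_inv_def by (rule someI2_ex) blast
  define R where "R = matrix_inv (?M - mat ?s)"
  \<comment> \<open>The conjugated row solves the adjoint equation: the adjoint of M - s maps
    \<open>g\<close> to e_m. Moving the rank-one term to the right gives an equation for H with the
    scalar \<open>\<kappa>\<close>.\<close>
  define g :: "complex^'n" where "g = (\<chi> k. cnj (R $ m $ k))"
  define \<kappa> where "\<kappa> = 1 - \<i> * \<epsilon> * g $ m"
  have H_cnj: "cnj (moser_H c \<gamma> t $ k $ j) = moser_H c \<gamma> t $ j $ k" for j k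
    using arg_cong[OF hermitian, of "\<lambda>B. B $ j $ k"] by (simp add: conj_transpose_def map_matrix_def transpose_def)
  have Hg: "moser_H c \<gamma> t *v g = complex_of_real (c m * t + s) *s g + \<kappa> *s axis m 1"
  proof -
    have eq: "(moser_H c \<gamma> t *v g) $ j - complex_of_real (c m * t + s) * g $ j + (if j = m then \<i> * \<epsilon> * g $ m else 0)
        = (if j = m then 1 else 0)" for j
    proof -
      have "(\<Sum>k\<in>UNIV. R $ m $ k * (?M - mat ?s) $ k $ j) = (if j = m then 1 else 0)"
        using arg_cong[OF R, of "\<lambda>B. B $ m $ j"] by (auto simp: R_def matrix_matrix_mult_def mat_def)
      from arg_cong[OF this, of cnj]
      have "(\<Sum>k\<in>UNIV. g $ k * cnj ((?M - mat ?s) $ k $ j)) = (if j = m then 1 else 0)"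
        by (simp add: g_def)
      moreover have "cnj ((?M - mat ?s) $ k $ j) = moser_H c \<gamma> t $ j $ k
          - (if j = k then complex_of_real (c m * t + s) else 0) + (if k = m then if j = m then \<i> * \<epsilon> else 0 else 0)" for k
        by (auto simp: moser_M_entry H_cnj mat_def)
      ultimately have "(\<Sum>k\<in>UNIV. g $ k * (moser_H c \<gamma> t $ j $ k
          - (if j = k then complex_of_real (c m * t + s) else 0) + (if k = m then if j = m then \<i> * \<epsilon> else 0 else 0))) = (if j = m then 1 else 0)"
        by simp
      then show ?thesis
        by (simp add: distrib_left right_diff_distrib sum.distrib sum_subtractf matrix_vector_mult_def
            if_distrib[where f = "\<lambda>z. _ * z"] mult.commute cong: if_cong)
    qed
    show ?thesis unfolding vec_eq_iff
    proof
      fix j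
      show "(moser_H c \<gamma> t *v g) $ j = (complex_of_real (c m * t + s) *s g + \<kappa> *s axis m 1) $ j"
        using eq[of j] by (cases "j = m") (simp_all add: axis_def \<kappa>_def algebra_simps)
    qed
  qed
  have gj: "cinner (u j) g = - \<kappa> * cnj (u j $ m) / (?s - y j)" for j
  proof -
    have "complex_of_real (x j) * cinner (u j) g = complex_of_real (c m * t + s) * cinner (u j) g + \<kappa> * cnj (u j $ m)"
      using arg_cong[OF Hg, of "cinner (u j)"] unfolding cinner_A cinner_simps cinner_axis .
    then have "(?s - y j) * cinner (u j) g = - \<kappa> * cnj (u j $ m)"
      unfolding y_eq by (simp add: algebra_simps)
    moreover have "?s - y j \<noteq> 0" using s[of j] by simp
    ultimately show ?thesis by (metis nonzero_mult_div_cancel_left)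
  qed
  have gm: "g $ m = \<kappa> * complex_of_real (- G)"
    unfolding component_m[of g] gj G_def of_real_minus of_real_sum of_real_divide a_eq of_real_diff
    by (simp add: sum_distrib_left sum_negf mult_ac)
  \<comment> \<open>Inserting \<open>gm\<close> into the definition of \<open>\<kappa>\<close>
    determines it as 1 / (1 - \<i> \<epsilon> G); its squared modulus is the origin of the
    denominator.\<close>
  have "1 = \<kappa> + \<i> * \<epsilon> * (\<kappa> * complex_of_real (- G))"
    unfolding gm[symmetric] by (simp add: \<kappa>_def)
  also have "\<dots> = \<kappa> * (1 - \<i> * \<epsilon> * G)" by (simp add: algebra_simps)
  finally have "\<kappa> * (1 - \<i> * \<epsilon> * G) = 1" by (rule sym)
  then have "(cmod \<kappa> * cmod (1 - \<i> * \<epsilon> * G))\<^sup>2 = 1"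
    by (metis norm_mult norm_one one_power2)
  moreover have "(cmod (1 - \<i> * \<epsilon> * G))\<^sup>2 = 1 + (\<epsilon> * G)\<^sup>2"
    by (simp add: cmod_power2)
  ultimately have k2: "(cmod \<kappa>)\<^sup>2 * (1 + (\<epsilon> * G)\<^sup>2) = 1"
    by (simp add: power_mult_distrib)
  have "complex_of_real ((cmod (\<Sum>k\<in>UNIV. g $ k))\<^sup>2) = cinner g g"
    by (rule norm_sum_eq_norm[OF Hg gm])
  also have "\<dots> = complex_of_real (\<Sum>j\<in>UNIV. (cmod (cinner (u j) g))\<^sup>2)"
    by (rule norm_expansion)
  finally have "(cmod (\<Sum>k\<in>UNIV. g $ k))\<^sup>2 = (\<Sum>j\<in>UNIV. (cmod (cinner (u j) g))\<^sup>2)"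
    using of_real_eq_iff by blast
  also have "\<dots> = (cmod \<kappa>)\<^sup>2 * (\<Sum>k\<in>UNIV. a k / (s - y k)\<^sup>2)"
  proof -
    have "(cmod (cinner (u j) g))\<^sup>2 = (cmod \<kappa>)\<^sup>2 * (a j / (s - y j)\<^sup>2)" for j
    proof -
      have "cmod (?s - y j) = \<bar>s - y j\<bar>" by (metis norm_of_real of_real_diff)
      then show ?thesis unfolding gj a_def by (simp add: norm_mult norm_divide power_divide power_mult_distrib)
    qed
    then show ?thesis by (simp add: sum_distrib_left)
  qed
  finally have row: "(cmod (\<Sum>k\<in>UNIV. g $ k))\<^sup>2 = (cmod \<kappa>)\<^sup>2 * (\<Sum>k\<in>UNIV. a k / (s - y k)\<^sup>2)" .
  have "multisoliton c \<gamma> m \<phi> \<epsilon> t s = complex_of_real (sqrt (2 * \<epsilon>)) * exp (\<i> * complex_of_real \<phi>) * cnj (\<Sum>k\<in>UNIV. g $ k)"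
    by (simp add: multisoliton_def matrix_vector_mult_def g_def R_def)
  then have "(cmod (multisoliton c \<gamma> m \<phi> \<epsilon> t s))\<^sup>2 = 2 * \<epsilon> * (cmod (\<Sum>k\<in>UNIV. g $ k))\<^sup>2"
    using \<epsilon> by (simp add: norm_mult power_mult_distrib del: cnj_sum)
  also have "\<dots> = 2 * \<epsilon> * (\<Sum>k\<in>UNIV. a k / (s - y k)\<^sup>2) / (1 + (\<epsilon> * G)\<^sup>2)"
  proof -
    have "1 + (\<epsilon> * G)\<^sup>2 \<noteq> 0" by (metis k2 mult_zero_right zero_neq_one)
    then have "(cmod \<kappa>)\<^sup>2 = 1 / (1 + (\<epsilon> * G)\<^sup>2)" using k2 by (simp add: eq_divide_eq)
    then show ?thesis unfolding row by simp
  qed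
  finally show ?thesis unfolding G_def .
qed

end

section \<open>The secular equation\<close>

lemma has_vector_derivative_quotient:
  fixes f :: "real \<Rightarrow> complex"
  assumes "((\<lambda>t. (f t - f s) / complex_of_real (t - s)) \<longlongrightarrow> D) (at s)"
  shows "(f has_vector_derivative D) (at s)"
proof -
  have "((\<lambda>t. (f t - f s) / complex_of_real (t - s) - D) \<longlongrightarrow> 0) (at s)"
    using assms by (rule Lim_null[THEN iffD1])
  then have "((\<lambda>t. norm ((f t - f s) / complex_of_real (t - s) - D)) \<longlongrightarrow> 0) (at s)"
    by (rule tendsto_norm_zero)
  moreover have "\<forall>\<^sub>F t in at s. norm ((f t - f s) / complex_of_real (t - s) - D)
      = norm ((f t - f s) - (t - s) *\<^sub>R D) / norm (t - s)"
    using eventually_neq_at_within[of s s UNIV]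
  proof eventually_elim
    case (elim t)
    then have nz: "complex_of_real (t - s) \<noteq> 0" by simp
    have "((f t - f s) - (t - s) *\<^sub>R D) / complex_of_real (t - s) = (f t - f s) / complex_of_real (t - s) - D"
      using nz by (simp add: diff_divide_distrib scaleR_conv_of_real del: of_real_diff)
    then have "norm ((f t - f s) / complex_of_real (t - s) - D)
        = norm (((f t - f s) - (t - s) *\<^sub>R D) / complex_of_real (t - s))" by simp
    also have "\<dots> = norm ((f t - f s) - (t - s) *\<^sub>R D) / norm (t - s)"
      unfolding norm_divide norm_of_real by simp
    finally show ?case .
  qed
  ultimately have "((\<lambda>t. norm ((f t - f s) - (t - s) *\<^sub>R D) / norm (t - s)) \<longlongrightarrow> 0) (at s)"
    by (rule Lim_transform_eventually)
  then show ?thesis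
    unfolding has_vector_derivative_def has_derivative_iff_norm by (simp add: bounded_linear_scaleR_left)
qed

text \<open>One bound for the function and its derivative, uniform in time. The rules below
  propagate it through sums, products and reciprocals, so that a remainder and its time derivative
  are estimated in one pass.\<close>

definition C1_le :: "(real \<Rightarrow> complex) \<Rightarrow> real \<Rightarrow> bool" where
  "C1_le f B \<longleftrightarrow> (\<forall>t. cmod (f t) \<le> B \<and> (\<exists>D. (f has_vector_derivative D) (at t) \<and> cmod D \<le> B))"

lemma C1_leI:
  assumes "\<And>t. cmod (f t) \<le> B" "\<And>t. (f has_vector_derivative f' t) (at t)" "\<And>t. cmod (f' t) \<le> B"
  shows "C1_le f B"
  using assms unfolding C1_le_def by blast

lemma C1_le_nonneg: "C1_le f B \<Longrightarrow> 0 \<le> B"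
  unfolding C1_le_def by (meson norm_ge_zero order_trans)

lemma C1_leD:
  assumes "C1_le f B"
  shows "cmod (f t) \<le> B" "f differentiable (at t)" "cmod (vector_derivative f (at t)) \<le> B"
    "(f has_vector_derivative vector_derivative f (at t)) (at t)"
proof -
  obtain D where D: "(f has_vector_derivative D) (at t)" "cmod D \<le> B" and "cmod (f t) \<le> B"
    using assms unfolding C1_le_def by blast
  moreover have "vector_derivative f (at t) = D" using D(1) by (rule vector_derivative_at)
  ultimately show "cmod (f t) \<le> B" "f differentiable (at t)" "cmod (vector_derivative f (at t)) \<le> B"
    "(f has_vector_derivative vector_derivative f (at t)) (at t)"
    by (auto intro: differentiableI_vector)
qed

lemma C1_le_add:
  assumes "C1_le f A" "C1_le g B"
  shows "C1_le (\<lambda>t. f t + g t) (A + B)"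
  by (rule C1_leI[where f' = "\<lambda>t. vector_derivative f (at t) + vector_derivative g (at t)"])
    (intro norm_triangle_mono has_vector_derivative_add C1_leD[OF assms(1)] C1_leD[OF assms(2)])+

lemma C1_le_cmult:
  assumes "C1_le f A"
  shows "C1_le (\<lambda>t. w * f t) (cmod w * A)"
  by (rule C1_leI[where f' = "\<lambda>t. w * vector_derivative f (at t)"])
    (auto intro!: mult_left_mono has_vector_derivative_mult_right C1_leD[OF assms] simp: norm_mult)

lemma C1_le_diff:
  assumes "C1_le f A" "C1_le g B"
  shows "C1_le (\<lambda>t. f t - g t) (A + B)"
  using C1_le_add[OF assms(1) C1_le_cmult[OF assms(2), of "-1"]] by simp

text \<open>The factor 2 accounts for the two terms of the product rule.\<close>

lemma C1_le_mult:
  assumes "C1_le f A" "C1_le g B"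
  shows "C1_le (\<lambda>t. f t * g t) (2 * (A * B))"
proof (rule C1_leI)
  let ?f' = "\<lambda>t. vector_derivative f (at t)" and ?g' = "\<lambda>t. vector_derivative g (at t)"
  have nn: "0 \<le> A" "0 \<le> B" using assms C1_le_nonneg by auto
  fix t
  show "((\<lambda>t. f t * g t) has_vector_derivative f t * ?g' t + ?f' t * g t) (at t)"
    by (intro has_vector_derivative_mult C1_leD[OF assms(1)] C1_leD[OF assms(2)])
  have "cmod (f t) * cmod (g t) \<le> A * B"
    by (intro mult_mono C1_leD[OF assms(1)] C1_leD[OF assms(2)]) (use nn in auto)
  moreover have "0 \<le> A * B" using nn by simp
  ultimately show "cmod (f t * g t) \<le> 2 * (A * B)"
    by (simp add: norm_mult)
  have "cmod (f t * ?g' t + ?f' t * g t) \<le> A * B + A * B"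
    unfolding norm_mult[symmetric]
    by (intro norm_triangle_mono; simp add: norm_mult;
        intro mult_mono C1_leD[OF assms(1)] C1_leD[OF assms(2)]) (use nn in auto)
  then show "cmod (f t * ?g' t + ?f' t * g t) \<le> 2 * (A * B)" by simp
qed

lemma C1_le_sum:
  assumes "\<And>i. i \<in> I \<Longrightarrow> C1_le (f i) B" "0 \<le> B" "real (card I) \<le> n"
  shows "C1_le (\<lambda>t. \<Sum>i\<in>I. f i t) (n * B)"
proof (rule C1_leI[where f' = "\<lambda>t. \<Sum>i\<in>I. vector_derivative (f i) (at t)"])
  have le: "real (card I) * B \<le> n * B" using assms by (simp add: mult_right_mono)
  fix t
  show "cmod (\<Sum>i\<in>I. f i t) \<le> n * B"
    using sum_norm_bound[of I "\<lambda>i. f i t" B] C1_leD(1)[OF assms(1)] le by force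
  show "cmod (\<Sum>i\<in>I. vector_derivative (f i) (at t)) \<le> n * B"
    using sum_norm_bound[of I "\<lambda>i. vector_derivative (f i) (at t)" B] C1_leD(3)[OF assms(1)] le by force
  show "((\<lambda>t. \<Sum>i\<in>I. f i t) has_vector_derivative (\<Sum>i\<in>I. vector_derivative (f i) (at t))) (at t)"
    by (intro has_vector_derivative_sum C1_leD(4)[OF assms(1)])
qed

lemma C1_le_inverse:
  assumes d: "\<And>t. d \<le> cmod (f t)" "d > 0"
    and f: "\<And>t. (f has_vector_derivative f' t) (at t)" "\<And>t. cmod (f' t) \<le> B"
  shows "C1_le (\<lambda>t. 1 / f t) (1 / d + B / d\<^sup>2)"
proof (rule C1_leI)
  have B: "0 \<le> B" using f(2) norm_ge_zero order_trans by blast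
  fix t
  have nz: "f t \<noteq> 0" using d(1)[of t] d(2) by auto
  have "((\<lambda>z. 1 / z) has_field_derivative - (1 / (f t)\<^sup>2)) (at (f t))"
    using nz by (auto intro!: derivative_eq_intros simp: power2_eq_square)
  from field_vector_diff_chain_at[OF f(1) this]
  show "((\<lambda>t. 1 / f t) has_vector_derivative f' t * - (1 / (f t)\<^sup>2)) (at t)"
    by (simp add: o_def)
  have "1 / cmod (f t) \<le> 1 / d" using d by (simp add: frac_le)
  then show "cmod (1 / f t) \<le> 1 / d + B / d\<^sup>2"
    using B by (simp add: norm_divide add_increasing2)
  have "cmod (f' t * - (1 / (f t)\<^sup>2)) = cmod (f' t) / (cmod (f t))\<^sup>2"
    by (simp add: norm_mult norm_divide norm_power)
  also have "\<dots> \<le> B / d\<^sup>2"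
    using d f(2)[of t] B by (intro frac_le power_mono) (auto simp: less_imp_le)
  finally show "cmod (f' t * - (1 / (f t)\<^sup>2)) \<le> 1 / d + B / d\<^sup>2"
    using d(2) by (simp add: add_increasing)
qed

section \<open>The fixed point problem near one unperturbed eigenvalue\<close>

locale secular =
  fixes y dy a da :: "'n::finite \<Rightarrow> real \<Rightarrow> real" and \<delta> D \<epsilon> :: real
  assumes y_deriv: "\<And>j t. (y j has_real_derivative dy j t) (at t)"
    and dy_le: "\<And>j t. \<bar>dy j t\<bar> \<le> D"
    and a_deriv: "\<And>j t. (a j has_real_derivative da j t) (at t)"
    and da_le: "\<And>j t. \<bar>da j t\<bar> \<le> D"
    and a_pos: "\<And>j t. 0 < a j t" and sum_a: "\<And>t. (\<Sum>j\<in>UNIV. a j t) = 1"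
    and gap: "\<And>j k t. j \<noteq> k \<Longrightarrow> \<delta> \<le> \<bar>y j t - y k t\<bar>"
    and \<delta>_pos: "0 < \<delta>" and \<epsilon>_pos: "0 < \<epsilon>" and \<epsilon>_le: "8 * \<epsilon> \<le> \<delta>" and \<epsilon>_le_1: "\<epsilon> \<le> 1"
begin

lemma sum_others: "(\<Sum>k\<in>UNIV - {j}. a k t) = 1 - a j t"
  using sum_a[of t] by (subst (asm) sum.remove[of _ j]) auto

lemma a_le_1: "a j t \<le> 1"
  using sum_others[of t j] sum_nonneg[of "UNIV - {j}" "\<lambda>k. a k t"] a_pos[of _ t] by (simp add: less_imp_le)

lemma D_nonneg: "0 \<le> D"
  using dy_le[of undefined 0] by linarith

definition gp :: "'n \<Rightarrow> 'n \<Rightarrow> real \<Rightarrow> complex" where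
  "gp j k t = complex_of_real (y j t - y k t)"

lemma norm_gp: "j \<noteq> k \<Longrightarrow> \<delta> \<le> cmod (gp j k t)"
  unfolding gp_def norm_of_real by (rule gap)

text \<open>Since \<open>8 * \<epsilon> \<le> \<delta>\<close>, points of the disc of radius
  \<open>\<epsilon>\<close> about one \<open>y j\<close> stay at distance
  \<open>\<delta> / 2\<close> from the others. The same smallness later gives the contraction factor
  \<open>4 * \<epsilon> / \<delta> \<le> 1/2\<close>.\<close>

lemma shift_ge:
  assumes "j \<noteq> k" "cmod w \<le> \<epsilon>"
  shows "\<delta> / 2 \<le> cmod (w + gp j k t)"
proof -
  have "cmod (gp j k t) \<le> cmod (w + gp j k t) + cmod w"
    using norm_triangle_ineq4[of "w + gp j k t" w] by simp
  then show ?thesis using norm_gp[OF assms(1), of t] assms(2) \<epsilon>_le \<epsilon>_pos by linarith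
qed

lemma shift_nz: "j \<noteq> k \<Longrightarrow> cmod w \<le> \<epsilon> \<Longrightarrow> w + gp j k t \<noteq> 0"
  using shift_ge[of j k w t] \<delta>_pos by auto

lemma ratio_le:
  assumes "j \<noteq> k" "cmod w \<le> \<epsilon>"
  shows "cmod (w / (w + gp j k t)) \<le> 1"
  using shift_ge[OF assms, of t] assms \<epsilon>_le \<epsilon>_pos by (simp add: norm_divide divide_le_eq_1)

text \<open>The gap in the numerator has no upper bound, so it is paired with the denominator of its
  own time: that ratio is 1 minus a quantity of modulus at most 1.\<close>

lemma ratio2_le:
  assumes "j \<noteq> k" "cmod w \<le> \<epsilon>" "cmod w' \<le> \<epsilon>"
  shows "cmod (gp j k s / ((w + gp j k t) * (w' + gp j k s))) \<le> 4 / \<delta>"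
proof -
  have "gp j k s / (w' + gp j k s) = 1 - w' / (w' + gp j k s)"
    using shift_nz[OF assms(1,3), of s] by (simp add: field_simps)
  then have "cmod (gp j k s / (w' + gp j k s)) \<le> 1 + 1"
    using norm_triangle_ineq4[of 1 "w' / (w' + gp j k s)"] ratio_le[OF assms(1,3), of s] by simp
  moreover have "cmod (1 / (w + gp j k t)) \<le> 2 / \<delta>"
    using shift_ge[OF assms(1,2), of t] \<delta>_pos by (simp add: norm_divide divide_le_eq field_simps)
  ultimately have "cmod (1 / (w + gp j k t)) * cmod (gp j k s / (w' + gp j k s)) \<le> 2 / \<delta> * (1 + 1)"
    using \<delta>_pos by (intro mult_mono) auto
  then show ?thesis by (simp add: norm_divide norm_mult)
qed

definition S :: "'n \<Rightarrow> real \<Rightarrow> complex \<Rightarrow> complex" where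
  "S j t w = (\<Sum>k\<in>UNIV - {j}. a k t / (w + gp j k t))"

text \<open>The factor \<open>1 - a j t\<close> is kept because it complements the leading term
  \<open>a j t\<close> of \<open>step\<close> to exactly 1.\<close>

lemma weighted_sum_le:
  fixes f :: "'n \<Rightarrow> complex"
  assumes "\<And>k. k \<noteq> j \<Longrightarrow> cmod (f k) \<le> B"
  shows "cmod (\<Sum>k\<in>UNIV - {j}. a k t * f k) \<le> (1 - a j t) * B"
proof -
  have "cmod (\<Sum>k\<in>UNIV - {j}. a k t * f k) \<le> (\<Sum>k\<in>UNIV - {j}. a k t * B)"
    by (rule sum_norm_le) (use assms a_pos in \<open>auto simp: norm_mult less_imp_le\<close>)
  then show ?thesis by (simp add: sum_others flip: sum_distrib_right)
qed

lemma weighted_sum_le':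
  fixes f :: "'n \<Rightarrow> complex"
  assumes "\<And>k. k \<noteq> j \<Longrightarrow> cmod (f k) \<le> B" "0 \<le> B"
  shows "cmod (\<Sum>k\<in>UNIV - {j}. a k t * f k) \<le> B"
proof -
  have "(1 - a j t) * B \<le> 1 * B" using assms(2) a_pos[of j t] by (intro mult_right_mono) auto
  then show ?thesis using weighted_sum_le[of j f B t, OF assms(1)] by simp
qed

text \<open>Near \<open>y j t\<close> the secular equation \<open>\<Sum>\<^sub>k a\<^sub>k / (z - y\<^sub>k) = \<i> / \<epsilon>\<close> is, for \<open>w = z - y\<^sub>j\<close>,
  the fixed point equation of the following contraction.\<close>

definition step :: "'n \<Rightarrow> real \<Rightarrow> complex \<Rightarrow> complex" where
  "step j t w = - \<i> * \<epsilon> * (a j t + w * S j t w)"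

text \<open>The weights form a probability vector, so \<open>step\<close> averages numbers of
  modulus at most 1 before multiplying by \<open>\<epsilon>\<close>; the disc of radius exactly
  \<open>\<epsilon>\<close> is mapped into itself.\<close>

lemma step_bound:
  assumes "cmod w \<le> \<epsilon>"
  shows "cmod (step j t w) \<le> \<epsilon>"
proof -
  have "w * S j t w = (\<Sum>k\<in>UNIV - {j}. a k t * (w / (w + gp j k t)))"
    by (simp add: S_def sum_distrib_left mult_ac)
  then have "cmod (w * S j t w) \<le> (1 - a j t) * 1"
    using weighted_sum_le[of j "\<lambda>k. w / (w + gp j k t)" 1 t] ratio_le[OF _ assms] by force
  then have "cmod (a j t + w * S j t w) \<le> 1"
    using norm_triangle_ineq[of "complex_of_real (a j t)" "w * S j t w"] a_pos[of j t] by simp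
  then show ?thesis using \<epsilon>_pos by (simp add: step_def norm_mult)
qed

text \<open>An exact difference in both the point and the time. At \<open>t = s\<close> only the
  multiple of \<open>w - w'\<close> survives and yields the contraction; for fixed points at two
  times the other terms carry the differences of the weights and gaps.\<close>

lemma S_diff:
  assumes "cmod w \<le> \<epsilon>" "cmod w' \<le> \<epsilon>"
  shows "w * S j t w - w' * S j s w' =
    (w - w') * (\<Sum>k\<in>UNIV - {j}. a k s * (gp j k s / ((w + gp j k t) * (w' + gp j k s))))
    + ((\<Sum>k\<in>UNIV - {j}. (complex_of_real (a k t) - a k s) * (w / (w + gp j k t)))
       - (\<Sum>k\<in>UNIV - {j}. a k s * (w' * (gp j k t - gp j k s) / ((w + gp j k t) * (w' + gp j k s)))))"
proof -
  have "w * (a k t / (w + gp j k t)) - w' * (a k s / (w' + gp j k s)) =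
     (w - w') * (a k s * (gp j k s / ((w + gp j k t) * (w' + gp j k s))))
     + ((complex_of_real (a k t) - a k s) * (w / (w + gp j k t))
     - a k s * (w' * (gp j k t - gp j k s) / ((w + gp j k t) * (w' + gp j k s))))"
    if "k \<in> UNIV - {j}" for k
  proof -
    have aux: "w * (A / (w + d)) - w' * (B / (w' + d')) =
       (w - w') * (B * (d' / ((w + d) * (w' + d')))) + ((A - B) * (w / (w + d))
        - B * (w' * (d - d') / ((w + d) * (w' + d'))))"
      if "w + d \<noteq> 0" "w' + d' \<noteq> 0" for A B d d'
    proof -
      have "w / (w + d) - w' / (w' + d') = (w - w') * (d' / ((w + d) * (w' + d')))
          - w' * (d - d') / ((w + d) * (w' + d'))"
        using that by (simp add: divide_simps) (simp add: algebra_simps)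
      then have "B * (w / (w + d)) - B * (w' / (w' + d')) =
          B * ((w - w') * (d' / ((w + d) * (w' + d')))) - B * (w' * (d - d') / ((w + d) * (w' + d')))"
        unfolding right_diff_distrib[symmetric] by simp
      moreover have "w * (A / (w + d)) = (A - B) * (w / (w + d)) + B * (w / (w + d))"
        by (simp add: left_diff_distrib right_diff_distrib diff_divide_distrib mult.commute)
      moreover have "w' * (B / (w' + d')) = B * (w' / (w' + d'))" by simp
      ultimately show ?thesis by (simp only: mult.left_commute[of "w - w'"]) simp
    qed
    show ?thesis
      by (rule aux) (use that assms shift_nz[of j k] in auto)
  qed
  then show ?thesis
    unfolding S_def sum_distrib_left sum_subtractf[symmetric] sum.distrib[symmetric]
    by (intro sum.cong) auto
qed

lemma step_contraction:
  assumes "cmod w \<le> \<epsilon>" "cmod w' \<le> \<epsilon>"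
  shows "cmod (step j t w - step j t w') \<le> 1/2 * cmod (w - w')"
proof -
  let ?Q = "\<Sum>k\<in>UNIV - {j}. a k t * (gp j k t / ((w + gp j k t) * (w' + gp j k t)))"
  have "step j t w - step j t w' = - \<i> * \<epsilon> * (w * S j t w - w' * S j t w')"
    by (simp add: step_def algebra_simps)
  also have "w * S j t w - w' * S j t w' = (w - w') * ?Q"
    unfolding S_diff[OF assms] by simp
  finally have "cmod (step j t w - step j t w') = \<epsilon> * (cmod (w - w') * cmod ?Q)"
    using \<epsilon>_pos by (simp add: norm_mult)
  also have "\<dots> \<le> \<epsilon> * (cmod (w - w') * (4 / \<delta>))"
    using ratio2_le[OF _ assms] \<delta>_pos \<epsilon>_pos
    by (intro mult_left_mono weighted_sum_le') auto
  also have "\<dots> = (4 * \<epsilon> / \<delta>) * cmod (w - w')" by simp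
  also have "\<dots> \<le> 1/2 * cmod (w - w')"
    using \<epsilon>_le \<delta>_pos by (intro mult_right_mono) (auto simp: field_simps)
  finally show ?thesis .
qed

lemma step_fixpoint: "\<exists>!w. w \<in> cball 0 \<epsilon> \<and> step j t w = w"
  by (rule Banach_fix[where c = "1/2"])
    (use \<epsilon>_pos step_bound step_contraction in \<open>auto simp: complete_eq_closed dist_norm\<close>)

definition W :: "'n \<Rightarrow> real \<Rightarrow> complex" where
  "W j t = (THE w. w \<in> cball 0 \<epsilon> \<and> step j t w = w)"

lemma W: "cmod (W j t) \<le> \<epsilon>" "step j t (W j t) = W j t"
  using theI'[OF step_fixpoint, of j t] unfolding W_def[symmetric] by auto

lemma W_unique: "cmod w \<le> \<epsilon> \<Longrightarrow> step j t w = w \<Longrightarrow> w = W j t"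
  using step_fixpoint[of j t] W[of j t] by auto

text \<open>Subtracting the fixed point equations at two times gives a linear equation for the
  increment of \<open>W\<close>, and its coefficient \<open>Q\<close> differs from 1 by at most 1/2.
  This is the quantitative substitute for the implicit function theorem.\<close>

lemma W_diff:
  fixes j s t
  defines "Q \<equiv> 1 + \<i> * \<epsilon> * (\<Sum>k\<in>UNIV - {j}. a k s * (gp j k s / ((W j t + gp j k t) * (W j s + gp j k s))))"
    and "R \<equiv> complex_of_real (a j t - a j s)
      + ((\<Sum>k\<in>UNIV - {j}. (complex_of_real (a k t) - a k s) * (W j t / (W j t + gp j k t)))
       - (\<Sum>k\<in>UNIV - {j}. a k s * (W j s * (gp j k t - gp j k s) / ((W j t + gp j k t) * (W j s + gp j k s)))))"
  shows "W j t - W j s = - \<i> * \<epsilon> * R / Q" "1/2 \<le> cmod Q"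
proof -
  let ?q = "\<Sum>k\<in>UNIV - {j}. a k s * (gp j k s / ((W j t + gp j k t) * (W j s + gp j k s)))"
  have "cmod ?q \<le> 4 / \<delta>"
    using ratio2_le[OF _ W(1) W(1)] \<delta>_pos by (intro weighted_sum_le') auto
  then have "cmod (\<i> * \<epsilon> * ?q) \<le> \<epsilon> * (4 / \<delta>)"
    using \<epsilon>_pos by (simp add: norm_mult mult_left_mono del: times_divide_eq_right)
  also have "\<dots> \<le> 1/2" using \<epsilon>_le \<delta>_pos by (simp add: field_simps)
  finally show Q: "1/2 \<le> cmod Q"
    unfolding Q_def using norm_triangle_ineq2[of 1 "- (\<i> * \<epsilon> * ?q)"] by simp
  have "W j t - W j s = step j t (W j t) - step j s (W j s)" by (simp add: W)
  also have "\<dots> = - \<i> * \<epsilon> * (complex_of_real (a j t - a j s) + (W j t * S j t (W j t) - W j s * S j s (W j s)))"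
    by (simp add: step_def algebra_simps)
  also have "\<dots> = - \<i> * \<epsilon> * (R + (W j t - W j s) * ?q)"
    unfolding S_diff[OF W(1) W(1)] R_def by (simp only: ac_simps)
  finally have "(W j t - W j s) * Q = - \<i> * \<epsilon> * R"
    unfolding Q_def by (simp add: algebra_simps)
  moreover have "Q \<noteq> 0" using Q by auto
  ultimately show "W j t - W j s = - \<i> * \<epsilon> * R / Q"
    by (metis nonzero_mult_div_cancel_right)
qed

lemma a_quotient:
  "((\<lambda>t. (complex_of_real (a k t) - a k s) / complex_of_real (t - s)) \<longlongrightarrow> da k s) (at s)"
  using tendsto_of_real[OF a_deriv[of k s, unfolded has_field_derivative_iff], where 'a = complex] by simp

lemma gp_quotient:
  "((\<lambda>t. (gp j k t - gp j k s) / complex_of_real (t - s)) \<longlongrightarrow> complex_of_real (dy j s - dy k s)) (at s)"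
proof -
  have "((\<lambda>t. y j t - y k t) has_real_derivative (dy j s - dy k s)) (at s)"
    by (intro derivative_intros y_deriv)
  from tendsto_of_real[OF this[unfolded has_field_derivative_iff], where 'a = complex]
  show ?thesis by (simp add: gp_def)
qed

lemma a_tendsto: "((\<lambda>t. complex_of_real (a k t)) \<longlongrightarrow> a k s) (at s)"
  using DERIV_isCont[OF a_deriv] by (auto simp: isCont_def intro!: tendsto_of_real)

lemma gp_tendsto: "((\<lambda>t. gp j k t) \<longlongrightarrow> gp j k s) (at s)"
  unfolding gp_def using DERIV_isCont[OF y_deriv] by (auto simp: isCont_def intro!: tendsto_intros)

text \<open>\<open>W\<close> at the moving time still occurs in the formula of
  \<open>W_diff\<close>, but only inside bounded factors, so continuity can be established before
  differentiability.\<close>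

lemma W_tendsto: "(W j \<longlongrightarrow> W j s) (at s)"
proof -
  define B where "B t = 2 * \<epsilon> * (cmod (complex_of_real (a j t) - a j s)
      + ((\<Sum>k\<in>UNIV - {j}. cmod (complex_of_real (a k t) - a k s))
       + (\<Sum>k\<in>UNIV - {j}. cmod (gp j k t - gp j k s) * (2 / \<delta>))))" for t
  have "cmod (W j t - W j s) \<le> B t" for t
  proof -
    define R where "R = complex_of_real (a j t - a j s)
      + ((\<Sum>k\<in>UNIV - {j}. (complex_of_real (a k t) - a k s) * (W j t / (W j t + gp j k t)))
       - (\<Sum>k\<in>UNIV - {j}. a k s * (W j s * (gp j k t - gp j k s) / ((W j t + gp j k t) * (W j s + gp j k s)))))"
    define Q where "Q = 1 + \<i> * \<epsilon> * (\<Sum>k\<in>UNIV - {j}. a k s * (gp j k s / ((W j t + gp j k t) * (W j s + gp j k s))))"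
    have 1: "cmod ((complex_of_real (a k t) - a k s) * (W j t / (W j t + gp j k t))) \<le> cmod (complex_of_real (a k t) - a k s)"
      if "k \<in> UNIV - {j}" for k
      unfolding norm_mult using ratio_le[of j k "W j t" t] W(1) that by (intro mult_left_le) auto
    have 2: "cmod (a k s * (W j s * (gp j k t - gp j k s) / ((W j t + gp j k t) * (W j s + gp j k s))))
       \<le> cmod (gp j k t - gp j k s) * (2 / \<delta>)" if "k \<in> UNIV - {j}" for k
    proof -
      have "cmod (1 / (W j t + gp j k t)) \<le> 2 / \<delta>"
        using shift_ge[of j k "W j t" t] W(1) \<delta>_pos that by (simp add: norm_divide divide_le_eq field_simps)
      moreover have "cmod (W j s / (W j s + gp j k s)) \<le> 1"
        using ratio_le[of j k "W j s" s] W(1) that by simp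
      moreover have "cmod (complex_of_real (a k s)) \<le> 1"
        using a_le_1[of k s] a_pos[of k s] by simp
      ultimately have "cmod (complex_of_real (a k s)) * (cmod (gp j k t - gp j k s) * (cmod (W j s / (W j s + gp j k s)) * cmod (1 / (W j t + gp j k t))))
         \<le> 1 * (cmod (gp j k t - gp j k s) * (1 * (2 / \<delta>)))"
        using \<delta>_pos by (intro mult_mono) auto
      then show ?thesis by (simp add: norm_mult norm_divide mult_ac)
    qed
    have "cmod R \<le> cmod (complex_of_real (a j t - a j s))
      + ((\<Sum>k\<in>UNIV - {j}. cmod (complex_of_real (a k t) - a k s))
       + (\<Sum>k\<in>UNIV - {j}. cmod (gp j k t - gp j k s) * (2 / \<delta>)))"
      unfolding R_def
      by (intro norm_triangle_mono order_refl order_trans[OF norm_triangle_ineq4] add_mono sum_norm_le 1 2)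
    also have "\<dots> = B t / (2 * \<epsilon>)"
      unfolding B_def using \<epsilon>_pos by simp
    finally have "cmod R \<le> B t / (2 * \<epsilon>)" .
    moreover have "cmod (W j t - W j s) = \<epsilon> * (cmod R / cmod Q)"
      using W_diff(1)[where j = j and s = s and t = t] \<epsilon>_pos unfolding R_def Q_def by (simp add: norm_mult norm_divide)
    moreover have "cmod R / cmod Q \<le> cmod R / (1/2)"
      using W_diff(2)[where j = j and s = s and t = t] unfolding Q_def by (intro divide_left_mono) auto
    moreover from this have "\<epsilon> * (cmod R / cmod Q) \<le> \<epsilon> * (cmod R / (1/2))"
      using \<epsilon>_pos by (intro mult_left_mono) auto
    ultimately show ?thesis using \<epsilon>_pos by (simp add: field_simps)
  qed
  moreover have "(B \<longlongrightarrow> 0) (at s)"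
  proof -
    have "(B \<longlongrightarrow> 2 * \<epsilon> * (cmod (complex_of_real (a j s) - a j s)
      + ((\<Sum>k\<in>UNIV - {j}. cmod (complex_of_real (a k s) - a k s))
       + (\<Sum>k\<in>UNIV - {j}. cmod (gp j k s - gp j k s) * (2 / \<delta>))))) (at s)"
      unfolding B_def by (intro tendsto_intros a_tendsto gp_tendsto)
    then show ?thesis by simp
  qed
  ultimately have "((\<lambda>t. W j t - W j s) \<longlongrightarrow> 0) (at s)"
    by (intro Lim_null_comparison[of "\<lambda>t. W j t - W j s" B] always_eventually allI)
  then show ?thesis by (rule Lim_null[THEN iffD2])
qed

text \<open>Bounds \<open>W\<close> and its derivative after division by \<open>\<epsilon>\<close>.
  The 1 covers \<open>W\<close> itself, the 2 bounds 1 / |Q|, and the bracket bounds the derivatives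
  of the weights and gaps collected in \<open>R\<close>.\<close>

definition wc :: real where
  "wc = 1 + 2 * (D + (CARD('n) * D + 4 * D / \<delta>))"

lemma wc_ge: "1 \<le> wc"
  using D_nonneg \<delta>_pos by (simp add: wc_def)

lemma C1_W: "C1_le (W j) (\<epsilon> * wc)"
proof -
  define R where "R s = da j s + ((\<Sum>k\<in>UNIV - {j}. da k s * (W j s / (W j s + gp j k s)))
       - (\<Sum>k\<in>UNIV - {j}. a k s * (W j s * complex_of_real (dy j s - dy k s) / ((W j s + gp j k s) * (W j s + gp j k s)))))" for s
  define Q where "Q s t = 1 + \<i> * \<epsilon> * (\<Sum>k\<in>UNIV - {j}. a k s * (gp j k s / ((W j t + gp j k t) * (W j s + gp j k s))))" for s t
  have Q: "1/2 \<le> cmod (Q s t)" for s t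
    using W_diff(2)[where j = j and s = s and t = t] by (simp add: Q_def)
  have "(W j has_vector_derivative - \<i> * \<epsilon> * R s / Q s s) (at s)" for s
  proof (rule has_vector_derivative_quotient)
    let ?q = "\<lambda>f t. (f t - f s) / complex_of_real (t - s)"
    \<comment> \<open>The numerator of \<open>W_diff\<close> divided by \<open>t - s\<close>, with
      the division distributed over the differences so that each term has a limit.\<close>
    define R1 where "R1 t = ?q (\<lambda>t. complex_of_real (a j t)) t + ((\<Sum>k\<in>UNIV - {j}. ?q (\<lambda>t. complex_of_real (a k t)) t * (W j t / (W j t + gp j k t)))
       - (\<Sum>k\<in>UNIV - {j}. a k s * (W j s * ?q (gp j k) t / ((W j t + gp j k t) * (W j s + gp j k s)))))" for t
    have nz: "W j s + gp j k s \<noteq> 0" if "k \<in> UNIV - {j}" for k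
      using shift_nz[of j k "W j s" s] W(1) that by auto
    have "(R1 \<longlongrightarrow> R s) (at s)"
      unfolding R1_def R_def
      by (intro tendsto_intros a_quotient gp_quotient W_tendsto gp_tendsto nz) (use nz in auto)
    moreover have "(Q s \<longlongrightarrow> Q s s) (at s)"
      unfolding Q_def
      by (intro tendsto_intros W_tendsto gp_tendsto) (use nz in auto)
    moreover have "Q s s \<noteq> 0" using Q[of s s] by auto
    ultimately have "((\<lambda>t. - \<i> * \<epsilon> * R1 t / Q s t) \<longlongrightarrow> - \<i> * \<epsilon> * R s / Q s s) (at s)"
      by (intro tendsto_intros)
    moreover have "\<forall>\<^sub>F t in at s. - \<i> * \<epsilon> * R1 t / Q s t = ?q (W j) t"
      using eventually_neq_at_within[of s s UNIV]
    proof eventually_elim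
      case (elim t)
      have "W j t - W j s = - \<i> * \<epsilon> * (complex_of_real (t - s) * R1 t) / Q s t"
      proof -
        have nz: "complex_of_real (t - s) \<noteq> 0" using elim by simp
        have "complex_of_real (t - s) * R1 t = complex_of_real (a j t - a j s)
          + ((\<Sum>k\<in>UNIV - {j}. (complex_of_real (a k t) - a k s) * (W j t / (W j t + gp j k t)))
          - (\<Sum>k\<in>UNIV - {j}. a k s * (W j s * (gp j k t - gp j k s) / ((W j t + gp j k t) * (W j s + gp j k s)))))"
        proof -
          have "b * (p / b) = p" "b * ((p / b) * q) = p * q" "b * (A * (w * (p / b) / q)) = A * (w * p / q)" if "b \<noteq> 0" for b p q A w :: complex
            using that by simp_all
          note eqs = this[OF nz]
          show ?thesis
            unfolding R1_def distrib_left[of "complex_of_real (t - s)"] right_diff_distrib[of "complex_of_real (t - s)"]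
              sum_distrib_left eqs by simp
        qed
        then show ?thesis using W_diff(1)[where j = j and s = s and t = t] by (simp add: Q_def)
      qed
      then show ?case using elim by (simp del: of_real_diff)
    qed
    ultimately show "((\<lambda>t. ?q (W j) t) \<longlongrightarrow> - \<i> * \<epsilon> * R s / Q s s) (at s)"
      by (rule Lim_transform_eventually)
  qed
  moreover have "cmod (- \<i> * \<epsilon> * R s / Q s s) \<le> \<epsilon> * wc" for s
  proof -
    have 1: "cmod (da k s * (W j s / (W j s + gp j k s))) \<le> D" if "k \<in> UNIV - {j}" for k
    proof -
      have "cmod (complex_of_real (da k s)) * cmod (W j s / (W j s + gp j k s)) \<le> D * 1"
        using ratio_le[of j k "W j s" s] W(1) that da_le[of k s] D_nonneg by (intro mult_mono) auto
      then show ?thesis by (simp only: norm_mult)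
    qed
    have 2: "cmod (W j s * complex_of_real (dy j s - dy k s) / ((W j s + gp j k s) * (W j s + gp j k s))) \<le> 4 * D / \<delta>"
      if "k \<noteq> j" for k
    proof -
      have "cmod (1 / (W j s + gp j k s)) \<le> 2 / \<delta>"
        using shift_ge[of j k "W j s" s] W(1) \<delta>_pos that by (simp add: norm_divide divide_le_eq field_simps)
      moreover have "cmod (W j s / (W j s + gp j k s)) \<le> 1"
        using ratio_le[of j k "W j s" s] W(1) that by simp
      moreover have "cmod (complex_of_real (dy j s - dy k s)) \<le> 2 * D"
        unfolding norm_of_real using dy_le[of j s] dy_le[of k s] by linarith
      ultimately have "cmod (W j s / (W j s + gp j k s)) * (cmod (complex_of_real (dy j s - dy k s)) * cmod (1 / (W j s + gp j k s)))
         \<le> 1 * (2 * D * (2 / \<delta>))"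
        using \<delta>_pos D_nonneg by (intro mult_mono) auto
      then show ?thesis by (simp add: norm_mult norm_divide mult_ac del: of_real_diff)
    qed
    have "cmod (\<Sum>k\<in>UNIV - {j}. da k s * (W j s / (W j s + gp j k s))) \<le> card (UNIV - {j}) * D"
      by (rule sum_norm_bound) (rule 1)
    also have "\<dots> \<le> CARD('n) * D"
      using D_nonneg by (intro mult_right_mono) (auto intro: card_mono)
    finally have 3: "cmod (\<Sum>k\<in>UNIV - {j}. da k s * (W j s / (W j s + gp j k s))) \<le> CARD('n) * D" .
    have "cmod (R s) \<le> D + (CARD('n) * D + 4 * D / \<delta>)"
      unfolding R_def
      by (intro norm_triangle_mono order_trans[OF norm_triangle_ineq4] add_mono 3 weighted_sum_le' 2)
         (use da_le[of j s] D_nonneg \<delta>_pos in auto)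
    then have "cmod (R s) / cmod (Q s s) \<le> (D + (CARD('n) * D + 4 * D / \<delta>)) / (1/2)"
      using Q[of s s] by (intro frac_le) (use D_nonneg \<delta>_pos in auto)
    then have "\<epsilon> * (cmod (R s) / cmod (Q s s)) \<le> \<epsilon> * wc"
      using \<epsilon>_pos by (intro mult_left_mono) (auto simp: wc_def)
    then show ?thesis using \<epsilon>_pos by (simp add: norm_mult norm_divide)
  qed
  moreover have "cmod (W j t) \<le> \<epsilon> * wc" for t
    using W(1)[of j t] wc_ge \<epsilon>_pos by (smt (verit) mult_le_cancel_left1)
  ultimately show ?thesis by (intro C1_leI)
qed

section \<open>Third-order expansion of the perturbed eigenvalues\<close>

definition z :: "'n \<Rightarrow> real \<Rightarrow> complex" where
  "z j t = complex_of_real (y j t) + W j t"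

definition S0 :: "'n \<Rightarrow> real \<Rightarrow> complex" where
  "S0 j t = (\<Sum>k\<in>UNIV - {j}. a k t * (1 / gp j k t))"

definition S1 :: "'n \<Rightarrow> real \<Rightarrow> complex" where
  "S1 j t = (\<Sum>k\<in>UNIV - {j}. a k t * (1 / (W j t + gp j k t)))"

text \<open>The divided difference linking the sum in the claimed expansion to the sum in the fixed
  point equation: S1 = S0 - W S2.\<close>

definition S2 :: "'n \<Rightarrow> real \<Rightarrow> complex" where
  "S2 j t = (\<Sum>k\<in>UNIV - {j}. a k t * (1 / (W j t + gp j k t)) * (1 / gp j k t))"

text \<open>Defined as whatever makes the expansion exact; all content lies in its bound.\<close>

definition rem :: "'n \<Rightarrow> real \<Rightarrow> complex" where
  "rem j t = W j t + \<i> * complex_of_real (\<epsilon> * a j t) + complex_of_real (\<epsilon>\<^sup>2) * (a j t * S0 j t)"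

lemma gp_nz: "j \<noteq> k \<Longrightarrow> gp j k t \<noteq> 0"
  using norm_gp[of j k t] \<delta>_pos by auto

lemma W_eq: "W j t = - \<i> * \<epsilon> * (a j t + W j t * S1 j t)"
  using W(2)[of j t] by (simp add: step_def S_def S1_def)

lemma S1_eq: "S1 j t = S0 j t - W j t * S2 j t"
proof -
  have "a k t * (1 / (W j t + gp j k t)) = a k t * (1 / gp j k t) - W j t * (a k t * (1 / (W j t + gp j k t)) * (1 / gp j k t))"
    if "k \<in> UNIV - {j}" for k
    using shift_nz[of j k "W j t" t] gp_nz[of j k t] W(1) that by (simp add: divide_simps) (simp add: algebra_simps)
  then show ?thesis
    unfolding S0_def S1_def S2_def sum_distrib_left sum_subtractf[symmetric] by (rule sum.cong[OF refl])
qed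

text \<open>Substituting the fixed point equation into itself exhibits the remainder as \<open>\<epsilon>\<^sup>3\<close> times a
  function whose \<open>C\<^sup>1\<close> norm is bounded uniformly.\<close>

lemma rem_eq:
  "rem j t = complex_of_real (\<epsilon> ^ 3) * (\<i> * ((1 / \<epsilon> * W j t) * (1 / \<epsilon> * W j t) * S2 j t)
     - (1 / \<epsilon> * W j t) * S1 j t * S0 j t)"
proof -
  have e: "complex_of_real \<epsilon> \<noteq> 0" using \<epsilon>_pos by simp
  \<comment> \<open>The fixed point equation is used to eliminate the weight from the second-order
    term. The first-order parts then cancel, and each surviving term is cubic once \<open>W\<close>
    is counted as of order \<open>\<epsilon>\<close>.\<close>
  have a: "complex_of_real (a j t) = \<i> * W j t / \<epsilon> - W j t * S1 j t"
  proof -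
    have "\<i> * W j t = \<epsilon> * (a j t + W j t * S1 j t)"
      by (subst W_eq) (simp add: algebra_simps)
    then show ?thesis using e by (simp add: field_simps)
  qed
  have "rem j t = W j t + \<i> * \<epsilon> * a j t + \<epsilon>\<^sup>2 * (a j t * S0 j t)"
    by (simp add: rem_def)
  also have "W j t + \<i> * \<epsilon> * a j t = - \<i> * \<epsilon> * W j t * S1 j t"
    by (subst (1) W_eq) (simp add: algebra_simps)
  also have "\<dots> = - \<i> * \<epsilon> * W j t * (S0 j t - W j t * S2 j t)"
    by (subst S1_eq) simp
  also have "\<epsilon>\<^sup>2 * (a j t * S0 j t) = \<i> * \<epsilon> * W j t * S0 j t - \<epsilon>\<^sup>2 * (W j t * S1 j t * S0 j t)"
    unfolding a using e by (simp add: field_simps power2_eq_square)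
  finally have "rem j t = \<i> * \<epsilon> * (W j t * W j t * S2 j t) - \<epsilon>\<^sup>2 * (W j t * S1 j t * S0 j t)"
    by (simp add: algebra_simps)
  also have "\<dots> = complex_of_real (\<epsilon> ^ 3) * (\<i> * ((1 / \<epsilon> * W j t) * (1 / \<epsilon> * W j t) * S2 j t)
     - (1 / \<epsilon> * W j t) * S1 j t * S0 j t)"
    using e by (simp add: divide_simps power2_eq_square power3_eq_cube) (simp add: algebra_simps)
  finally show ?thesis .
qed

lemma z_expansion:
  "z j t = complex_of_real (y j t) - \<i> * complex_of_real (\<epsilon> * a j t)
     - complex_of_real (\<epsilon>\<^sup>2 * a j t * (\<Sum>k\<in>UNIV - {j}. a k t / (y j t - y k t))) + rem j t"
  by (simp add: z_def rem_def S0_def gp_def)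

text \<open>Bounds for the \<open>C\<^sup>1\<close> norms of the building blocks of \<open>rem\<close>; like \<open>wc\<close> they involve only \<open>N\<close>, \<open>\<delta>\<close>
  and \<open>D\<close>, which makes the final constant independent of \<open>t\<close> and \<open>\<epsilon>\<close>.\<close>

definition ic :: real where "ic = 1 / (\<delta> / 2) + (wc + 2 * D) / (\<delta> / 2)\<^sup>2"
definition sc :: real where "sc = CARD('n) * (2 * ((1 + D) * ic))"
definition s2c :: real where "s2c = CARD('n) * (2 * (2 * ((1 + D) * ic) * ic))"
definition rc :: real where "rc = 2 * (2 * (wc * wc) * s2c) + 2 * (2 * (wc * sc) * sc)"
definition qc :: real where "qc = 2 * ((1 + D) * sc)"

lemma ic_nonneg: "0 \<le> ic"
  using wc_ge D_nonneg \<delta>_pos by (simp add: ic_def)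

lemma C1_a: "C1_le (\<lambda>t. complex_of_real (a k t)) (1 + D)"
  by (rule C1_leI[where f' = "\<lambda>t. complex_of_real (da k t)"])
    (use a_deriv da_le[of k] a_le_1[of k] a_pos[of k] D_nonneg in
      \<open>auto intro!: has_vector_derivative_of_real simp: less_imp_le add_increasing add_increasing2 abs_of_pos\<close>)

lemma gp_deriv: "(gp j k has_vector_derivative complex_of_real (dy j t - dy k t)) (at t)"
  unfolding gp_def by (intro has_vector_derivative_of_real derivative_intros y_deriv)

lemma norm_dgp: "cmod (complex_of_real (dy j t - dy k t)) \<le> 2 * D"
  unfolding norm_of_real using dy_le[of j t] dy_le[of k t] by linarith

lemma C1_inv_gp: "j \<noteq> k \<Longrightarrow> C1_le (\<lambda>t. 1 / gp j k t) ic"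
  unfolding ic_def
proof (rule C1_le_inverse)
  assume "j \<noteq> k"
  then show "\<delta> / 2 \<le> cmod (gp j k t)" for t
    using norm_gp[of j k t] \<delta>_pos by linarith
  show "0 < \<delta> / 2" using \<delta>_pos by simp
  show "(gp j k has_vector_derivative complex_of_real (dy j t - dy k t)) (at t)" for t
    by (rule gp_deriv)
  show "cmod (complex_of_real (dy j t - dy k t)) \<le> wc + 2 * D" for t
    using norm_dgp[of j t k] wc_ge by linarith
qed

lemma C1_inv_shift: "j \<noteq> k \<Longrightarrow> C1_le (\<lambda>t. 1 / (W j t + gp j k t)) ic"
  unfolding ic_def
proof (rule C1_le_inverse)
  let ?W' = "\<lambda>t. vector_derivative (W j) (at t)"
  assume "j \<noteq> k"
  then show "\<delta> / 2 \<le> cmod (W j t + gp j k t)" for t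
    using shift_ge W(1) by blast
  show "0 < \<delta> / 2" using \<delta>_pos by simp
  show "((\<lambda>t. W j t + gp j k t) has_vector_derivative ?W' t + complex_of_real (dy j t - dy k t)) (at t)" for t
    by (intro has_vector_derivative_add gp_deriv C1_leD(4)[OF C1_W])
  have "\<epsilon> * wc \<le> 1 * wc" using \<epsilon>_le_1 wc_ge by (intro mult_right_mono) auto
  then show "cmod (?W' t + complex_of_real (dy j t - dy k t)) \<le> wc + 2 * D" for t
    using C1_leD(3)[OF C1_W, of j t] by (intro norm_triangle_mono norm_dgp) auto
qed

lemma card_others: "real (card (UNIV - {j :: 'n})) \<le> real CARD('n)"
  by (simp add: card_mono)

lemma C1_S0: "C1_le (S0 j) sc"
  unfolding S0_def sc_def
  by (rule C1_le_sum[OF C1_le_mult[OF C1_a C1_inv_gp] _ card_others]) (use ic_nonneg D_nonneg in auto)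

lemma C1_S1: "C1_le (S1 j) sc"
  unfolding S1_def sc_def
  by (rule C1_le_sum[OF C1_le_mult[OF C1_a C1_inv_shift] _ card_others]) (use ic_nonneg D_nonneg in auto)

lemma C1_S2: "C1_le (S2 j) s2c"
  unfolding S2_def s2c_def
  by (rule C1_le_sum[OF C1_le_mult[OF C1_le_mult[OF C1_a C1_inv_shift] C1_inv_gp] _ card_others])
    (use ic_nonneg D_nonneg in auto)

lemma C1_scaled_W: "C1_le (\<lambda>t. 1 / \<epsilon> * W j t) wc"
  using C1_le_cmult[OF C1_W, of "1 / \<epsilon>" j] \<epsilon>_pos by (simp add: norm_divide)

lemma C1_rem: "C1_le (rem j) (\<epsilon> ^ 3 * rc)"
proof -
  have "C1_le (\<lambda>t. \<i> * ((1 / \<epsilon> * W j t) * (1 / \<epsilon> * W j t) * S2 j t)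
     - (1 / \<epsilon> * W j t) * S1 j t * S0 j t) rc"
    using C1_le_diff[OF C1_le_cmult[OF C1_le_mult[OF C1_le_mult[OF C1_scaled_W C1_scaled_W] C1_S2], of \<i>]
      C1_le_mult[OF C1_le_mult[OF C1_scaled_W C1_S1] C1_S0]]
    by (simp add: rc_def)
  from C1_le_cmult[OF this, of "complex_of_real (\<epsilon> ^ 3)"]
  show ?thesis using \<epsilon>_pos unfolding rem_eq[abs_def] by (simp add: norm_power)
qed

lemma C1_aS0: "C1_le (\<lambda>t. a j t * S0 j t) qc"
  unfolding qc_def by (rule C1_le_mult[OF C1_a C1_S0])

lemma rc_nonneg: "0 \<le> rc" and qc_nonneg: "0 \<le> qc"
proof -
  have "0 \<le> \<epsilon> ^ 3 * rc" using C1_le_nonneg[OF C1_rem] .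
  then show "0 \<le> rc" using \<epsilon>_pos by (simp add: zero_le_mult_iff)
qed (rule C1_le_nonneg[OF C1_aS0])

lemma rem_bound: "cmod (rem j t) + cmod (vector_derivative (rem j) (at t)) \<le> 2 * rc * \<epsilon> ^ 3"
  using add_mono[OF C1_leD(1)[OF C1_rem, of j t] C1_leD(3)[OF C1_rem, of j t]] by (simp add: mult_ac)

lemma W_alt: "W j t = (- \<i> * complex_of_real (\<epsilon> * a j t) - complex_of_real (\<epsilon>\<^sup>2) * (a j t * S0 j t)) + rem j t"
  by (simp add: rem_def)

lemma S0_real: "S0 j t = complex_of_real (\<Sum>k\<in>UNIV - {j}. a k t / (y j t - y k t))"
  by (simp add: S0_def gp_def)

text \<open>The first-order term is purely imaginary, so the real part is affected only from second
  order on.\<close>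

lemma Re_z: "\<bar>Re (z j t) - y j t\<bar> \<le> (qc + rc) * \<epsilon>\<^sup>2"
proof -
  have "Re (z j t) - y j t = - (\<epsilon>\<^sup>2) * Re (a j t * S0 j t) + Re (rem j t)"
    unfolding z_def W_alt by (simp add: S0_real)
  also have "\<bar>\<dots>\<bar> \<le> \<epsilon>\<^sup>2 * \<bar>Re (a j t * S0 j t)\<bar> + \<bar>Re (rem j t)\<bar>"
    by (rule order_trans[OF abs_triangle_ineq]) (simp add: abs_mult)
  also have "\<dots> \<le> \<epsilon>\<^sup>2 * qc + \<epsilon> ^ 3 * rc"
    using order_trans[OF abs_Re_le_cmod C1_leD(1)[OF C1_aS0, of j t]]
      order_trans[OF abs_Re_le_cmod C1_leD(1)[OF C1_rem, of j t]]
    by (intro add_mono mult_left_mono) auto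
  also have "\<epsilon> ^ 3 * rc \<le> \<epsilon>\<^sup>2 * rc"
    using \<epsilon>_le_1 \<epsilon>_pos rc_nonneg by (intro mult_right_mono power_decreasing) auto
  finally show ?thesis by (simp add: algebra_simps)
qed

lemma z_deriv: "(z j has_vector_derivative complex_of_real (dy j t) + vector_derivative (W j) (at t)) (at t)"
  unfolding z_def[abs_def]
  by (intro has_vector_derivative_add has_vector_derivative_of_real y_deriv C1_leD(4)[OF C1_W])

lemma z_differentiable: "z j differentiable (at t)"
  using z_deriv by (rule differentiableI_vector)

lemma Re_z_deriv: "\<bar>Re (vector_derivative (z j) (at t)) - dy j t\<bar> \<le> (qc + rc) * \<epsilon>\<^sup>2"
proof -
  obtain A' where A': "((\<lambda>t. a j t * S0 j t) has_vector_derivative A') (at t)" "cmod A' \<le> qc"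
    using C1_aS0 unfolding C1_le_def by blast
  obtain R' where R': "(rem j has_vector_derivative R') (at t)" "cmod R' \<le> \<epsilon> ^ 3 * rc"
    using C1_rem unfolding C1_le_def by blast
  \<comment> \<open>Termwise differentiation of the expansion must give the derivative already known
    to exist; its first-order term \<open>- \<i> * (\<epsilon> * da j t)\<close> is again purely
    imaginary.\<close>
  have "(W j has_vector_derivative (- \<i> * complex_of_real (\<epsilon> * da j t) - complex_of_real (\<epsilon>\<^sup>2) * A') + R') (at t)"
    unfolding W_alt[abs_def]
    by (intro has_vector_derivative_add has_vector_derivative_diff has_vector_derivative_mult_right
        has_vector_derivative_of_real A' R' DERIV_cmult a_deriv)
  from vector_derivative_at[OF this] vector_derivative_at[OF z_deriv, of j t]
  have "Re (vector_derivative (z j) (at t)) - dy j t = - (\<epsilon>\<^sup>2) * Re A' + Re R'"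
    by simp
  also have "\<bar>\<dots>\<bar> \<le> \<epsilon>\<^sup>2 * \<bar>Re A'\<bar> + \<bar>Re R'\<bar>"
    by (rule order_trans[OF abs_triangle_ineq]) (simp add: abs_mult)
  also have "\<dots> \<le> \<epsilon>\<^sup>2 * qc + \<epsilon> ^ 3 * rc"
    using order_trans[OF abs_Re_le_cmod A'(2)] order_trans[OF abs_Re_le_cmod R'(2)]
    by (intro add_mono mult_left_mono) auto
  also have "\<epsilon> ^ 3 * rc \<le> \<epsilon>\<^sup>2 * rc"
    using \<epsilon>_le_1 \<epsilon>_pos rc_nonneg by (intro mult_right_mono power_decreasing) auto
  finally show ?thesis by (simp add: algebra_simps)
qed

text \<open>The second-order term is real, so the error in the imaginary part is of third
  order.\<close>

lemma Im_z: "\<bar>- Im (z j t) - \<epsilon> * a j t\<bar> \<le> rc * \<epsilon> ^ 3"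
proof -
  have "- Im (z j t) - \<epsilon> * a j t = - Im (rem j t)"
    unfolding z_def W_alt by (simp add: S0_real)
  then show ?thesis
    using order_trans[OF abs_Im_le_cmod C1_leD(1)[OF C1_rem, of j t]] by (simp add: mult.commute)
qed

end

section \<open>The polynomial with roots at the perturbed eigenvalues\<close>

lemma
  fixes f :: "'n::finite \<Rightarrow> complex"
  shows degree_prod_linear: "degree (\<Prod>k\<in>UNIV. [:- f k, 1:]) = CARD('n)"
    and lead_coeff_prod_linear: "coeff (\<Prod>k\<in>UNIV. [:- f k, 1:]) CARD('n) = 1"
    and subleading_coeff_prod_linear: "coeff (\<Prod>k\<in>UNIV. [:- f k, 1:]) (CARD('n) - 1) = - (\<Sum>k\<in>UNIV. f k)"
proof -
  have *: "degree (\<Prod>k\<in>I. [:- f k, 1:]) = card I" "coeff (\<Prod>k\<in>I. [:- f k, 1:]) (card I) = 1"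
    if "finite I" for I
  proof -
    show d: "degree (\<Prod>k\<in>I. [:- f k, 1:]) = card I"
      by (subst degree_prod_sum_eq) auto
    show "coeff (\<Prod>k\<in>I. [:- f k, 1:]) (card I) = 1"
      using lead_coeff_prod[of "\<lambda>k. [:- f k, 1:]" I] by (simp add: d)
  qed
  then show "degree (\<Prod>k\<in>UNIV. [:- f k, 1:]) = CARD('n)" "coeff (\<Prod>k\<in>UNIV. [:- f k, 1:]) CARD('n) = 1"
    by auto
  have "coeff (\<Prod>k\<in>I. [:- f k, 1:]) (card I - 1) = - (\<Sum>k\<in>I. f k)" if "finite I" "I \<noteq> {}" for I
    using that
  proof (induction I rule: finite_ne_induct)
    case (insert i I)
    then obtain n where n: "card I = Suc n" by (cases "card I") auto
    have "coeff (\<Prod>k\<in>insert i I. [:- f k, 1:]) (card (insert i I) - 1)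
       = coeff ([:- f i, 1:] * (\<Prod>k\<in>I. [:- f k, 1:])) (Suc n)"
      using insert n by simp
    also have "\<dots> = - f i * coeff (\<Prod>k\<in>I. [:- f k, 1:]) (card I) + coeff (\<Prod>k\<in>I. [:- f k, 1:]) (card I - 1)"
      by (simp add: n)
    finally show ?case using insert * by simp
  qed simp
  from this[of UNIV] show "coeff (\<Prod>k\<in>UNIV. [:- f k, 1:]) (CARD('n) - 1) = - (\<Sum>k\<in>UNIV. f k)" by simp
qed

context secular begin

lemma W_nz: "W j t \<noteq> 0"
proof
  assume 0: "W j t = 0"
  have "W j t = - \<i> * \<epsilon> * (a j t + W j t * S1 j t)" by (rule W_eq)
  then have "0 = - \<i> * \<epsilon> * (a j t + 0 * S1 j t)" by (simp only: 0)
  then show False using a_pos[of j t] \<epsilon>_pos by simp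
qed

lemma z_minus_y: "z j t - y k t = W j t + gp j k t"
  by (simp add: z_def gp_def)

lemma z_neq_y: "z j t \<noteq> y k t"
proof (cases "j = k")
  case True then show ?thesis using W_nz by (simp add: z_def)
next
  case False
  then show ?thesis using shift_nz[OF False W(1)] z_minus_y[of j t k] by auto
qed

lemma secular_step:
  fixes w :: complex
  assumes "w \<noteq> 0" "\<And>k. k \<noteq> j \<Longrightarrow> w + gp j k t \<noteq> 0"
  shows "(\<Sum>k\<in>UNIV. a k t / (y j t + w - y k t)) = \<i> / \<epsilon> \<longleftrightarrow> step j t w = w"
proof -
  have e: "complex_of_real \<epsilon> \<noteq> 0" using \<epsilon>_pos by simp
  have "(\<Sum>k\<in>UNIV. a k t / (y j t + w - y k t)) = a j t / w + (\<Sum>k\<in>UNIV - {j}. a k t / (y j t + w - y k t))"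
    by (subst sum.remove[of _ j]) auto
  also have "(\<Sum>k\<in>UNIV - {j}. a k t / (y j t + w - y k t)) = S j t w"
    unfolding S_def by (intro sum.cong) (auto simp: gp_def algebra_simps)
  finally have "(\<Sum>k\<in>UNIV. a k t / (y j t + w - y k t)) = \<i> / \<epsilon> \<longleftrightarrow> a j t / w + S j t w = \<i> / \<epsilon>" by simp
  also have "\<dots> \<longleftrightarrow> \<epsilon> * (a j t + w * S j t w) = \<i> * w"
    using e assms(1) by (auto simp: field_simps)
  also have "\<dots> \<longleftrightarrow> step j t w = w"
  proof
    assume "\<epsilon> * (a j t + w * S j t w) = \<i> * w"
    then have "step j t w = - \<i> * (\<i> * w)" by (simp add: step_def mult.assoc)
    then show "step j t w = w" by simp
  next
    assume "step j t w = w"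
    then have "\<i> * w = \<i> * step j t w" by simp
    also have "\<dots> = \<epsilon> * (a j t + w * S j t w)" by (simp add: step_def mult.assoc)
    finally show "\<epsilon> * (a j t + w * S j t w) = \<i> * w" by simp
  qed
  finally show ?thesis .
qed

lemma z_secular: "(\<Sum>k\<in>UNIV. a k t / (z j t - y k t)) = \<i> / \<epsilon>"
proof -
  have "W j t + gp j k t \<noteq> 0" if "k \<noteq> j" for k
    using shift_nz[of j k "W j t" t] W(1) that by auto
  then show ?thesis
    using secular_step[of "W j t" j t] W_nz[of j t] W(2)[of j t] by (simp add: z_def)
qed

text \<open>Outside all discs of radius \<open>\<epsilon>\<close> the sum is strictly smaller than 1
  / \<epsilon>. Inside the disc about \<open>y j\<close> a root is a fixed point of
  \<open>step j t\<close>, and uniqueness identifies it with \<open>W j t\<close>; no separate count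
  of roots is made.\<close>

lemma secular_root:
  fixes w :: complex
  assumes nz: "\<And>k. w \<noteq> complex_of_real (y k t)"
    and sec: "(\<Sum>k\<in>UNIV. a k t / (w - y k t)) = \<i> / \<epsilon>"
  shows "\<exists>j. w = z j t"
proof -
  have "\<exists>j. cmod (w - y j t) \<le> \<epsilon>"
  proof (rule ccontr)
    assume "\<nexists>j. cmod (w - y j t) \<le> \<epsilon>"
    then have far: "\<epsilon> < cmod (w - y k t)" for k by (meson not_le)
    have "1 / \<epsilon> = cmod (\<Sum>k\<in>UNIV. a k t / (w - y k t))"
      using \<epsilon>_pos by (simp add: sec norm_divide)
    also have "\<dots> \<le> (\<Sum>k\<in>UNIV. a k t / cmod (w - y k t))"
      by (rule sum_norm_le) (use a_pos in \<open>auto simp: norm_divide less_imp_le\<close>)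
    also have "\<dots> < (\<Sum>k\<in>UNIV. a k t / \<epsilon>)"
    proof (intro sum_strict_mono divide_strict_left_mono)
      show "0 < cmod (w - y k t) * \<epsilon>" for k
        using far[of k] \<epsilon>_pos by (intro mult_pos_pos) linarith+
    qed (use far a_pos in auto)
    also have "\<dots> = 1 / \<epsilon>" by (simp add: sum_a flip: sum_divide_distrib)
    finally show False by simp
  qed
  then obtain j where j: "cmod (w - y j t) \<le> \<epsilon>" ..
  have "step j t (w - y j t) = w - y j t"
    using secular_step[of "w - y j t" j t] nz[of j] shift_nz[OF _ j] sec by simp
  then have "w - y j t = W j t" by (rule W_unique[OF j])
  then have "w = z j t" unfolding z_def by (metis add.commute diff_add_cancel)
  then show ?thesis ..
qed

lemma z_near: "cmod (z j t - y j t) \<le> \<epsilon>"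
  using W(1) by (simp add: z_def)

text \<open>The discs of radius \<open>\<epsilon>\<close> are disjoint because their centres are at
  least \<open>\<delta> \<ge> 8 * \<epsilon>\<close> apart.\<close>

lemma inj_z: "inj (\<lambda>j. z j t)"
proof (rule injI, rule ccontr)
  fix j k assume eq: "z j t = z k t" and "j \<noteq> k"
  have "\<delta> \<le> cmod (gp j k t)" by (rule norm_gp) fact
  also have "gp j k t = W k t - W j t" using eq by (simp add: z_def gp_def algebra_simps)
  also have "cmod \<dots> \<le> \<epsilon> + \<epsilon>"
    by (rule order_trans[OF norm_triangle_ineq4]) (intro add_mono W)
  finally show False using \<epsilon>_le \<epsilon>_pos by linarith
qed

text \<open>The imaginary part of the secular equation equates the positive number 1 / \<epsilon>
  with a nonnegative multiple of \<open>- Im (z j t)\<close>.\<close>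

lemma Im_z_neg: "Im (z j t) < 0"
proof -
  have im: "Im (b / w) = - b * Im w / (cmod w)\<^sup>2" for b :: real and w :: complex
    by (simp add: Im_divide cmod_power2)
  have "0 < 1 / \<epsilon>" using \<epsilon>_pos by simp
  also have "\<dots> = Im (\<Sum>k\<in>UNIV. a k t / (z j t - y k t))"
    unfolding z_secular by (simp add: Im_divide power2_eq_square)
  also have "\<dots> = - Im (z j t) * (\<Sum>k\<in>UNIV. a k t / (cmod (z j t - y k t))\<^sup>2)"
    by (simp add: im sum_distrib_left sum_negf mult_ac)
  finally have "0 < - Im (z j t) * (\<Sum>k\<in>UNIV. a k t / (cmod (z j t - y k t))\<^sup>2)" .
  moreover have "0 \<le> (\<Sum>k\<in>UNIV. a k t / (cmod (z j t - y k t))\<^sup>2)"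
    using a_pos by (intro sum_nonneg) (auto simp: less_imp_le)
  ultimately show ?thesis by (auto simp: mult_less_0_iff)
qed

text \<open>The right side is the secular function 1 + \<i> \<epsilon> \<Sum> a_k / (w - y_k) with
  denominators cleared. Both sides are monic of degree N and vanish at the N distinct points
  \<open>z j t\<close>, which identifies them without computing a determinant.\<close>

lemma prod_z_poly:
  "(\<Prod>k\<in>UNIV. [:- z k t, 1:]) = (\<Prod>k\<in>UNIV. [:- complex_of_real (y k t), 1:]) +
    (\<Sum>j\<in>UNIV. smult (\<i> * \<epsilon> * a j t) (\<Prod>k\<in>UNIV - {j}. [:- complex_of_real (y k t), 1:]))"
    (is "?Z = ?Y + ?A")
proof -
  let ?f = "\<lambda>k. [:- complex_of_real (y k t), 1:]"
  have degA: "degree ?A < CARD('n)"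
  proof -
    have "degree (smult (\<i> * \<epsilon> * a j t) (\<Prod>k\<in>UNIV - {j}. ?f k)) \<le> CARD('n) - 1" for j
      by (rule order_trans[OF degree_smult_le], subst degree_prod_sum_eq) auto
    then have "degree ?A \<le> CARD('n) - 1" by (intro degree_sum_le) auto
    then show ?thesis by (simp add: le_less_trans)
  qed
  have roots: "poly (?Y + ?A) (z j t) = 0" for j
  proof -
    have nz: "z j t - y k t \<noteq> 0" for k using z_neq_y[of j t k] by simp
    have "poly ?A (z j t) = (\<Sum>i\<in>UNIV. \<i> * \<epsilon> * a i t * (\<Prod>k\<in>UNIV - {i}. z j t - y k t))"
      by (simp add: poly_sum poly_prod)
    also have "\<dots> = (\<Sum>i\<in>UNIV. \<i> * \<epsilon> * (a i t / (z j t - y i t)) * (\<Prod>k\<in>UNIV. z j t - y k t))"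
    proof (intro sum.cong refl)
      fix i
      show "\<i> * \<epsilon> * a i t * (\<Prod>k\<in>UNIV - {i}. z j t - y k t) =
          \<i> * \<epsilon> * (a i t / (z j t - y i t)) * (\<Prod>k\<in>UNIV. z j t - y k t)"
        using nz[of i] prod.remove[of UNIV i "\<lambda>k. z j t - complex_of_real (y k t)"] by simp
    qed
    also have "\<dots> = \<i> * \<epsilon> * (\<Sum>i\<in>UNIV. a i t / (z j t - y i t)) * (\<Prod>k\<in>UNIV. z j t - y k t)"
      by (simp add: sum_distrib_left sum_distrib_right)
    also have "\<dots> = - (\<Prod>k\<in>UNIV. z j t - y k t)"
      unfolding z_secular using \<epsilon>_pos by simp
    finally show ?thesis by (simp add: poly_prod)
  qed
  show ?thesis
  proof (rule poly_eqI_degree_lead_coeff[where n = "CARD('n)" and A = "range (\<lambda>j. z j t)"])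
    show "coeff ?Z CARD('n) = coeff (?Y + ?A) CARD('n)"
      using degA by (simp add: lead_coeff_prod_linear coeff_eq_0)
    show "CARD('n) \<le> card (range (\<lambda>j. z j t))"
      by (simp add: card_image[OF inj_z])
    show "degree ?Z \<le> CARD('n)" by (simp add: degree_prod_linear)
    show "degree (?Y + ?A) \<le> CARD('n)"
      using degA by (intro degree_add_le) (auto simp: degree_prod_linear)
    fix w assume "w \<in> range (\<lambda>j. z j t)"
    then obtain j where w: "w = z j t" by auto
    have "poly ?Z w = 0" unfolding w by (auto simp: poly_prod)
    then show "poly ?Z w = poly (?Y + ?A) w" using roots w by simp
  qed
qed

text \<open>The coefficients of degree N - 1 in \<open>prod_z_poly\<close> give the trace identity
  \<Sum> z = \<Sum> y - \<i> \<epsilon>.\<close>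

lemma sum_Im_z: "(\<Sum>j\<in>UNIV. - Im (z j t)) = \<epsilon>"
proof -
  have 1: "coeff (\<Prod>k\<in>UNIV - {j}. [:- complex_of_real (y k t), 1:]) (CARD('n) - 1) = 1" for j
  proof -
    have d: "degree (\<Prod>k\<in>UNIV - {j}. [:- complex_of_real (y k t), 1:]) = CARD('n) - 1"
      by (subst degree_prod_sum_eq) auto
    then show ?thesis
      using lead_coeff_prod[of "\<lambda>k. [:- complex_of_real (y k t), 1:]" "UNIV - {j}"] by simp
  qed
  have "(\<Sum>k\<in>UNIV. complex_of_real (a k t)) = 1"
    using sum_a[of t] by (metis of_real_1 of_real_sum)
  then have "- (\<Sum>k\<in>UNIV. z k t) = - (\<Sum>k\<in>UNIV. complex_of_real (y k t)) + \<i> * \<epsilon>"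
    using arg_cong[OF prod_z_poly[of t], of "\<lambda>p. coeff p (CARD('n) - 1)"]
    unfolding coeff_add coeff_sum coeff_smult 1 subleading_coeff_prod_linear
    by (simp flip: sum_distrib_left)
  from arg_cong[OF this, of Im] show ?thesis by (simp add: sum_negf)
qed

text \<open>The remaining eigenvalues take a positive share of the total \<open>\<epsilon>\<close>;
  for N = 1 there would be equality.\<close>

lemma Im_z_less:
  assumes "2 \<le> CARD('n)"
  shows "- Im (z j t) < \<epsilon>"
proof -
  have "UNIV - {j} \<noteq> {}"
  proof
    assume "UNIV - {j} = {}"
    then have "CARD('n) = card {j}" by (metis Diff_eq_empty_iff UNIV_I subset_singletonD empty_iff)
    then show False using assms by simp
  qed
  then have "0 < (\<Sum>k\<in>UNIV - {j}. - Im (z k t))"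
    by (intro sum_pos) (auto simp: Im_z_neg)
  then show ?thesis
    using sum_Im_z[of t] by (subst (asm) (2) sum.remove[of _ j]) auto
qed

text \<open>Logarithmic derivative of \<open>\<Prod>\<^sub>k (s - z\<^sub>k) = \<Prod>\<^sub>k (s - y\<^sub>k) (1 + \<i> \<epsilon> \<Sum>\<^sub>k a\<^sub>k / (s - y\<^sub>k))\<close> on the real axis.\<close>

lemma lorentzian_sum:
  assumes s: "\<And>k. s \<noteq> y k t"
  shows "(\<Sum>j\<in>UNIV. 2 * (- Im (z j t)) / ((s - Re (z j t))\<^sup>2 + (Im (z j t))\<^sup>2)) =
    2 * \<epsilon> * (\<Sum>k\<in>UNIV. a k t / (s - y k t)\<^sup>2) / (1 + (\<epsilon> * (\<Sum>k\<in>UNIV. a k t / (s - y k t)))\<^sup>2)"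
proof -
  define F where "F w = 1 + \<i> * \<epsilon> * (\<Sum>k\<in>UNIV. a k t * (1 / (w - y k t)))" for w :: complex
  define Y where "Y w = (\<Prod>k\<in>UNIV. w - complex_of_real (y k t))" for w
  define Z where "Z w = (\<Prod>k\<in>UNIV. w - z k t)" for w
  let ?s = "complex_of_real s"
  define g h where "g = (\<Sum>k\<in>UNIV. a k t / (s - y k t))" and "h = (\<Sum>k\<in>UNIV. a k t / (s - y k t)\<^sup>2)"
  have snz: "?s - y k t \<noteq> 0" "?s - z k t \<noteq> 0" for k
  proof -
    have "?s \<noteq> z k t" using Im_z_neg[of k t] by (metis Im_complex_of_real less_irrefl)
    then show "?s - y k t \<noteq> 0" "?s - z k t \<noteq> 0" using s[of k] by auto
  qed
  have ZYF: "Z w = Y w * F w" if "\<And>k. w - complex_of_real (y k t) \<noteq> 0" for w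
  proof -
    have "Z w = poly (\<Prod>k\<in>UNIV. [:- z k t, 1:]) w" by (simp add: Z_def poly_prod)
    also have "\<dots> = Y w + (\<Sum>j\<in>UNIV. \<i> * \<epsilon> * a j t * (\<Prod>k\<in>UNIV - {j}. w - y k t))"
      unfolding prod_z_poly by (simp add: Y_def poly_prod poly_sum)
    also have "(\<Sum>j\<in>UNIV. \<i> * \<epsilon> * a j t * (\<Prod>k\<in>UNIV - {j}. w - y k t))
       = (\<Sum>j\<in>UNIV. \<i> * \<epsilon> * (a j t * (1 / (w - y j t))) * Y w)"
    proof (intro sum.cong refl)
      fix i
      show "\<i> * \<epsilon> * a i t * (\<Prod>k\<in>UNIV - {i}. w - y k t) = \<i> * \<epsilon> * (a i t * (1 / (w - y i t))) * Y w"
        using that[of i] prod.remove[of UNIV i "\<lambda>k. w - complex_of_real (y k t)"] by (simp add: Y_def)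
    qed
    also have "\<dots> = \<i> * \<epsilon> * (\<Sum>j\<in>UNIV. a j t * (1 / (w - y j t))) * Y w"
      by (simp add: sum_distrib_left sum_distrib_right)
    finally show ?thesis by (simp add: F_def algebra_simps)
  qed
  have dZ: "(Z has_field_derivative Z ?s * (\<Sum>k\<in>UNIV. 1 / (?s - z k t))) (at ?s)"
    unfolding Z_def[abs_def]
  proof (rule has_field_derivative_prod')
    fix k
    show "?s - z k t \<noteq> 0" by (rule snz)
    show "((\<lambda>w. w - z k t) has_field_derivative 1) (at ?s)"
      by (auto intro!: derivative_eq_intros)
  qed
  have dY: "(Y has_field_derivative Y ?s * (\<Sum>k\<in>UNIV. 1 / (?s - y k t))) (at ?s)"
    unfolding Y_def[abs_def]
  proof (rule has_field_derivative_prod')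
    fix k
    show "?s - complex_of_real (y k t) \<noteq> 0" by (rule snz)
    show "((\<lambda>w. w - complex_of_real (y k t)) has_field_derivative 1) (at ?s)"
      by (auto intro!: derivative_eq_intros)
  qed
  have dF: "(F has_field_derivative - \<i> * \<epsilon> * h) (at ?s)"
  proof -
    have "((\<lambda>w. 1 / (w - y k t)) has_field_derivative - (1 / (?s - y k t)\<^sup>2)) (at ?s)" for k
      using snz[of k] by (auto intro!: derivative_eq_intros simp: power2_eq_square)
    then have "(F has_field_derivative 0 + \<i> * \<epsilon> * (\<Sum>k\<in>UNIV. a k t * - (1 / (?s - y k t)\<^sup>2))) (at ?s)"
      unfolding F_def[abs_def]
      by (intro DERIV_add DERIV_const DERIV_cmult DERIV_sum)
    then show ?thesis by (simp add: h_def sum_negf)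
  qed
  \<comment> \<open>The factorisation holds off the poles \<open>y k t\<close>; they form a closed
    set avoiding \<open>s\<close>, so the derivative at \<open>s\<close> can be computed from
    it.\<close>
  have "open (UNIV - range (\<lambda>k. complex_of_real (y k t)))"
    by (intro open_Diff open_UNIV finite_imp_closed) auto
  then have "((\<lambda>w. Y w * F w) has_field_derivative Z ?s * (\<Sum>k\<in>UNIV. 1 / (?s - z k t))) (at ?s)"
  proof (rule has_field_derivative_transform_within_open[OF dZ])
    show "?s \<in> UNIV - range (\<lambda>k. complex_of_real (y k t))" using snz(1) by auto
    show "Z w = Y w * F w" if "w \<in> UNIV - range (\<lambda>k. complex_of_real (y k t))" for w
      by (rule ZYF) (use that in auto)
  qed
  from DERIV_unique[OF this DERIV_mult[OF dY dF]]
  have eq: "Z ?s * (\<Sum>k\<in>UNIV. 1 / (?s - z k t)) =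
      Y ?s * (\<Sum>k\<in>UNIV. 1 / (?s - y k t)) * F ?s + - \<i> * \<epsilon> * h * Y ?s" .
  have nz: "Z ?s \<noteq> 0" "Y ?s \<noteq> 0" using snz by (simp_all add: Z_def Y_def)
  have Zs: "Z ?s = Y ?s * F ?s" by (rule ZYF[OF snz(1)])
  then have Fnz: "F ?s \<noteq> 0" using nz by auto
  define A B where "A = (\<Sum>k\<in>UNIV. 1 / (?s - z k t))" and "B = (\<Sum>k\<in>UNIV. 1 / (s - y k t))"
  have B: "(\<Sum>k\<in>UNIV. 1 / (?s - y k t)) = complex_of_real B" by (simp add: B_def)
  have "Y ?s * (F ?s * A) = Y ?s * (B * F ?s - \<i> * \<epsilon> * h)"
    using eq unfolding Zs B A_def[symmetric] by (simp add: algebra_simps)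
  then have "F ?s * A = B * F ?s - \<i> * \<epsilon> * h" using nz(2) by simp
  then have "A = B - \<i> * \<epsilon> * h / F ?s"
    using Fnz by (simp add: field_simps)
  moreover have "F ?s = 1 + \<i> * complex_of_real (\<epsilon> * g)"
  proof -
    have "(\<Sum>k\<in>UNIV. a k t * (1 / (?s - y k t))) = complex_of_real g" by (simp add: g_def)
    then show ?thesis unfolding F_def by simp
  qed
  \<comment> \<open>\<open>B\<close> is real on the real axis, so the imaginary part comes only from
    the logarithmic derivative of the secular function.\<close>
  ultimately have "Im A = Im (B - \<i> * complex_of_real (\<epsilon> * h) / (1 + \<i> * complex_of_real (\<epsilon> * g)))"
    by (simp add: mult.assoc)
  also have "\<dots> = - (\<epsilon> * h / (1 + (\<epsilon> * g)\<^sup>2))"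
    by (simp add: Im_divide power2_eq_square)
  also have "Im A = (\<Sum>k\<in>UNIV. Im (z k t) / ((s - Re (z k t))\<^sup>2 + (Im (z k t))\<^sup>2))"
  proof -
    have "Im (1 / (?s - z k t)) = Im (z k t) / ((s - Re (z k t))\<^sup>2 + (Im (z k t))\<^sup>2)" for k
      by (simp add: Im_divide)
    then show ?thesis unfolding A_def Im_sum by simp
  qed
  finally have "(\<Sum>k\<in>UNIV. Im (z k t) / ((s - Re (z k t))\<^sup>2 + (Im (z k t))\<^sup>2)) = - (\<epsilon> * h / (1 + (\<epsilon> * g)\<^sup>2))" .
  moreover have "(\<Sum>j\<in>UNIV. 2 * (- Im (z j t)) / ((s - Re (z j t))\<^sup>2 + (Im (z j t))\<^sup>2))
     = - 2 * (\<Sum>k\<in>UNIV. Im (z k t) / ((s - Re (z k t))\<^sup>2 + (Im (z k t))\<^sup>2))"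
    by (simp add: sum_distrib_left sum_negf)
  ultimately show ?thesis unfolding g_def[symmetric] h_def[symmetric] by simp
qed

end

section \<open>Lorentzians\<close>

text \<open>2 pi times the Poisson kernel of width \<open>b\<close>, which equals -2 Im (1 / (s -
  z)) for z = \<alpha> - \<i> b; the total mass is 2 pi for every width.\<close>

definition lorentzian :: "real \<Rightarrow> real \<Rightarrow> real \<Rightarrow> real" where
  "lorentzian \<alpha> b s = 2 * b / ((s - \<alpha>)\<^sup>2 + b\<^sup>2)"

lemma borel_measurable_lorentzian [measurable]: "lorentzian \<alpha> b \<in> borel_measurable borel"
  unfolding lorentzian_def[abs_def] by measurable

lemma lorentzian_nonneg: "0 \<le> b \<Longrightarrow> 0 \<le> lorentzian \<alpha> b s"
  by (simp add: lorentzian_def)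

text \<open>Reduces to the half line, where explicit primitives give the integrals; the overlap of
  the two halves is the null set {0}.\<close>

lemma nn_integral_even:
  fixes g :: "real \<Rightarrow> ennreal"
  assumes [measurable]: "g \<in> borel_measurable borel"
  shows "(\<integral>\<^sup>+s. g \<bar>s - \<alpha>\<bar> \<partial>lborel) = 2 * (\<integral>\<^sup>+u. g u * indicator {0..} u \<partial>lborel)"
proof -
  have "(\<integral>\<^sup>+s. g \<bar>s - \<alpha>\<bar> \<partial>lborel) = (\<integral>\<^sup>+u. g \<bar>u\<bar> \<partial>lborel)"
    by (subst nn_integral_real_affine[where c = 1 and t = "\<alpha>"]) auto
  also have "\<dots> = (\<integral>\<^sup>+u. g u * indicator {0..} u + g (- u) * indicator {0<..} (- u) \<partial>lborel)"
    by (rule nn_integral_cong) (auto split: split_indicator)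
  also have "\<dots> = (\<integral>\<^sup>+u. g u * indicator {0..} u \<partial>lborel) + (\<integral>\<^sup>+u. g (- u) * indicator {0<..} (- u) \<partial>lborel)"
    by (rule nn_integral_add) auto
  also have "(\<integral>\<^sup>+u. g (- u) * indicator {0<..} (- u) \<partial>lborel) = (\<integral>\<^sup>+u. g u * indicator {0<..} u \<partial>lborel)"
    using nn_integral_real_affine[of "\<lambda>u. g u * indicator {0<..} u" "-1" 0] by simp
  also have "\<dots> = (\<integral>\<^sup>+u. g u * indicator {0..} u \<partial>lborel)"
    by (rule nn_integral_cong_AE, rule AE_I[where N = "{0}"]) (auto split: split_indicator)
  finally show ?thesis by (simp add: mult_2)
qed

lemma nn_integral_lorentzian:
  assumes "0 < b"
  shows "(\<integral>\<^sup>+s. ennreal (lorentzian \<alpha> b s) \<partial>lborel) = ennreal (2 * pi)"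
proof -
  have "(\<integral>\<^sup>+s. ennreal (lorentzian \<alpha> b s) \<partial>lborel) = (\<integral>\<^sup>+s. ennreal (lorentzian 0 b \<bar>s - \<alpha>\<bar>) \<partial>lborel)"
    by (simp add: lorentzian_def)
  also have "\<dots> = 2 * (\<integral>\<^sup>+u. ennreal (lorentzian 0 b u) * indicator {0..} u \<partial>lborel)"
    by (rule nn_integral_even) auto
  also have "(\<integral>\<^sup>+u. ennreal (lorentzian 0 b u) * indicator {0..} u \<partial>lborel) = ennreal (pi - 2 * arctan (0 / b))"
  proof (rule nn_integral_FTC_atLeast)
    show "((\<lambda>u. 2 * arctan (u / b)) has_real_derivative lorentzian 0 b u) (at u)" for u
      using assms by (auto intro!: derivative_eq_intros simp: lorentzian_def divide_simps power2_eq_square)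
    have "filterlim (\<lambda>u. 1 / b * u) at_top at_top"
      using assms by (intro filterlim_tendsto_pos_mult_at_top[OF tendsto_const _ filterlim_ident]) simp
    then have "((\<lambda>u. 2 * arctan (1 / b * u)) \<longlongrightarrow> 2 * (pi / 2)) at_top"
      by (intro tendsto_mult tendsto_const filterlim_compose[OF tendsto_arctan_at_top])
    then show "((\<lambda>u. 2 * arctan (u / b)) \<longlongrightarrow> pi) at_top" by simp
  qed (use assms lorentzian_nonneg in auto)
  also have "2 * ennreal (pi - 2 * arctan (0 / b)) = ennreal (2 * pi)"
    by (simp add: ennreal_mult)
  finally show ?thesis .
qed

lemma lorentzian_has_integral:
  assumes "0 < b"
  shows "integrable lborel (lorentzian \<alpha> b)" "(\<integral>s. lorentzian \<alpha> b s \<partial>lborel) = 2 * pi"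
proof -
  show "integrable lborel (lorentzian \<alpha> b)"
    using nn_integral_lorentzian[OF assms, of \<alpha>] lorentzian_nonneg[of b \<alpha>] assms
    by (intro integrableI_nonneg) auto
  show "(\<integral>s. lorentzian \<alpha> b s \<partial>lborel) = 2 * pi"
    using nn_integral_lorentzian[OF assms, of \<alpha>] lorentzian_nonneg[of b \<alpha>] assms
    by (intro integral_eq_nn_integral[THEN trans]) auto
qed

text \<open>\<open>b ln ((u + b) / (1 + u))\<close> has derivative \<open>b (1 - b) / ((u + b) (1 + u))\<close>, which dominates
  \<open>2 b min(2, u) / (u\<^sup>2 + b\<^sup>2)\<close> up to a constant.\<close>

lemma lorentzian_moment:
  assumes b: "0 < b" "b \<le> 1 / 2"
  shows "(\<integral>\<^sup>+s. ennreal (lorentzian \<alpha> b s * min 2 \<bar>s - \<alpha>\<bar>) \<partial>lborel) \<le> ennreal (36 * b * \<bar>ln b\<bar>)"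
proof -
  \<comment> \<open>18 is 2 times 9: \<open>2 * b\<close> is the numerator of the Lorentzian, and 9
    comes from the polynomial inequality below.\<close>
  define f where "f u = 18 * b * (1 / (u + b) - 1 / (1 + u))" for u :: real
  have f: "f \<in> borel_measurable borel" unfolding f_def[abs_def] by measurable
  have "(\<integral>\<^sup>+s. ennreal (lorentzian \<alpha> b s * min 2 \<bar>s - \<alpha>\<bar>) \<partial>lborel) =
     (\<integral>\<^sup>+s. ennreal (lorentzian 0 b \<bar>s - \<alpha>\<bar> * min 2 \<bar>s - \<alpha>\<bar>) \<partial>lborel)"
    by (simp add: lorentzian_def)
  also have "\<dots> = 2 * (\<integral>\<^sup>+u. ennreal (lorentzian 0 b u * min 2 u) * indicator {0..} u \<partial>lborel)"
    by (rule nn_integral_even) auto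
  also have "\<dots> \<le> 2 * (\<integral>\<^sup>+u. ennreal (f u) * indicator {0..} u \<partial>lborel)"
  proof (intro mult_left_mono nn_integral_mono)
    fix u :: real
    have "lorentzian 0 b u * min 2 u \<le> f u" if u: "0 \<le> u"
    proof -
      have pos: "0 < u\<^sup>2 + b\<^sup>2" "0 < (u + b) * (1 + u)"
        using b u by (auto intro: add_nonneg_pos mult_pos_pos)
      have "min 2 u * ((u + b) * (1 + u)) \<le> 9 * (1 - b) * (u\<^sup>2 + b\<^sup>2)"
      proof -
        have "min 2 u * ((u + b) * (1 + u)) \<le> 9 / 2 * (u\<^sup>2 + b\<^sup>2)"
        proof (cases "u \<le> 2")
          case True
          have ub: "2 * (u * b) \<le> u\<^sup>2 + b\<^sup>2" using sum_squares_bound[of u b] by (simp add: mult.assoc)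
          have "min 2 u * ((u + b) * (1 + u)) = (u * (u + b)) * (1 + u)" using True by simp
          also have "\<dots> \<le> (u * (u + b)) * 3" using True b u by (intro mult_left_mono) auto
          also have "\<dots> = 3 * u\<^sup>2 + 3 * (u * b)" by (simp add: algebra_simps power2_eq_square)
          also have "\<dots> \<le> 9 / 2 * (u\<^sup>2 + b\<^sup>2)" 
          proof -
            have "3 * U + 3 * V \<le> 9 / 2 * (U + Q)" if "2 * V \<le> U + Q" "0 \<le> Q" for U V Q :: real
              using that by argo
            from this[OF ub] show ?thesis by simp
          qed
          finally show ?thesis .
        next
          case False
          have "min 2 u * ((u + b) * (1 + u)) = 2 * ((u + b) * (1 + u))" using False by simp
          \<comment> \<open>For u > 2 one has b \<le> 1/2 \<le> u/4 and 1 \<le> u/2; the product is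
            15/4 u^2, below 9/2 u^2.\<close>
          also have "\<dots> \<le> 2 * ((5/4 * u) * (3/2 * u))" using False b u
            by (intro mult_left_mono mult_mono) auto
          also have "\<dots> \<le> 9 / 2 * (u\<^sup>2 + b\<^sup>2)" by (simp add: power2_eq_square)
          finally show ?thesis .
        qed
        \<comment> \<open>Width at most 1/2 makes 1 - b at least 1/2; the factor 1 - b is the one in
          the derivative of the logarithm.\<close>
        also have "9 / 2 * (u\<^sup>2 + b\<^sup>2) \<le> 9 * (1 - b) * (u\<^sup>2 + b\<^sup>2)"
          using b pos by (intro mult_right_mono) auto
        finally show ?thesis .
      qed
      then have "min 2 u / (u\<^sup>2 + b\<^sup>2) \<le> 9 * (1 - b) / ((u + b) * (1 + u))"
        using pos by (simp add: divide_simps)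
      then have "2 * b * (min 2 u / (u\<^sup>2 + b\<^sup>2)) \<le> 2 * b * (9 * (1 - b) / ((u + b) * (1 + u)))"
        using b by (intro mult_left_mono) auto
      also have "2 * b * (9 * (1 - b) / ((u + b) * (1 + u))) = f u"
        unfolding f_def
        using b u by (simp add: divide_simps)
      finally show ?thesis by (simp add: lorentzian_def)
    qed
    then show "ennreal (lorentzian 0 b u * min 2 u) * indicator {0..} u \<le> ennreal (f u) * indicator {0..} u"
      by (auto split: split_indicator intro: ennreal_leI)
  qed auto
  also have "(\<integral>\<^sup>+u. ennreal (f u) * indicator {0..} u \<partial>lborel) = ennreal (0 - 18 * b * (ln (0 + b) - ln (1 + 0)))"
  proof (rule nn_integral_FTC_atLeast[OF f])
    fix u :: real assume u: "0 \<le> u"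
    show "((\<lambda>u. 18 * b * (ln (u + b) - ln (1 + u))) has_real_derivative f u) (at u)"
      unfolding f_def using u b by (auto intro!: derivative_eq_intros)
    show "0 \<le> f u"
      unfolding f_def using u b by (simp add: frac_le)
  next
    \<comment> \<open>Each logarithm diverges, so their difference is rewritten as a single one
      whose argument tends to 1.\<close>
    have "((\<lambda>u. ln (u + b) - ln (1 + u)) \<longlongrightarrow> 0) at_top"
    proof -
      have "((\<lambda>u. (1 - b) / (1 + u)) \<longlongrightarrow> 0) at_top"
        by (intro tendsto_divide_0[OF tendsto_const] filterlim_at_top_imp_at_infinity
            filterlim_tendsto_add_at_top[OF tendsto_const filterlim_ident])
      then have "((\<lambda>u. ln (1 - (1 - b) / (1 + u))) \<longlongrightarrow> ln (1 - 0)) at_top"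
        by (intro tendsto_intros) auto
      moreover have "\<forall>\<^sub>F u in at_top. ln (1 - (1 - b) / (1 + u)) = ln (u + b) - ln (1 + u)"
        using eventually_ge_at_top[of 0]
      proof eventually_elim
        case (elim u)
        then have "1 - (1 - b) / (1 + u) = (u + b) / (1 + u)" by (simp add: field_simps)
        then show ?case using elim b by (simp add: ln_div)
      qed
      ultimately show ?thesis
        by (simp add: tendsto_cong)
    qed
    then show "((\<lambda>u. 18 * b * (ln (u + b) - ln (1 + u))) \<longlongrightarrow> 0) at_top"
      by (rule tendsto_mult_right_zero)
  qed
  also have "2 * ennreal (0 - 18 * b * (ln (0 + b) - ln (1 + 0))) = ennreal (36 * b * \<bar>ln b\<bar>)"
  proof -
    have "2 * ennreal c = ennreal (2 * c)" for c
      by (metis ennreal_mult' ennreal_numeral zero_le_numeral)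
    moreover have "ln b \<le> 0" using b by simp
    ultimately show ?thesis by (simp add: mult.assoc)
  qed
  finally show ?thesis .
qed

text \<open>No lower bound for \<open>b\<close> in terms of \<open>\<epsilon>\<close> is available,
  so |ln b| cannot be compared with |ln \<epsilon>| directly. The excess b ln (\<epsilon> / b) is at
  most \<open>\<epsilon>\<close>, by ln r \<le> r - 1.\<close>

lemma entropy_bound:
  fixes b \<epsilon> :: real
  assumes "0 < b" "b \<le> \<epsilon>" "\<epsilon> \<le> 1"
  shows "b * \<bar>ln b\<bar> \<le> \<epsilon> * (1 + \<bar>ln \<epsilon>\<bar>)"
proof -
  have "ln b \<le> 0" "ln \<epsilon> \<le> 0" using assms by simp_all
  have "b * ln (\<epsilon> / b) \<le> b * (\<epsilon> / b)"
    using assms ln_le_minus_one[of "\<epsilon> / b"] by (intro mult_left_mono) auto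
  then have "b * (ln \<epsilon> - ln b) \<le> \<epsilon>" using assms by (simp add: ln_div)
  moreover have "b * - ln \<epsilon> \<le> \<epsilon> * - ln \<epsilon>"
    using assms \<open>ln \<epsilon> \<le> 0\<close> by (intro mult_right_mono) auto
  ultimately show ?thesis using \<open>ln b \<le> 0\<close> \<open>ln \<epsilon> \<le> 0\<close> by (simp add: algebra_simps)
qed

text \<open>The comparison goes through f(\<alpha>). A Lorentzian has no finite first moment, so
  |f(s) - f(\<alpha>)| is bounded by |s - \<alpha>| near the centre and by 2 in the tails; the
  truncated moment is what produces the logarithm.\<close>

lemma lorentzian_test:
  fixes f :: "real \<Rightarrow> real"
  assumes b: "0 < b" "b \<le> 1 / 2" and f: "\<And>s. \<bar>f s\<bar> \<le> 1" "lipschitz_on 1 UNIV f"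
  shows "integrable lborel (\<lambda>s. lorentzian \<alpha> b s * f s)"
    "\<bar>(\<integral>s. lorentzian \<alpha> b s * f s \<partial>lborel) - 2 * pi * f p\<bar> \<le> 2 * pi * \<bar>\<alpha> - p\<bar> + 36 * b * \<bar>ln b\<bar>"
proof -
  have lip: "\<bar>f s - f r\<bar> \<le> \<bar>s - r\<bar>" for s r
    using lipschitz_onD[OF f(2), of s r] by (simp add: dist_real_def)
  have fm [measurable]: "f \<in> borel_measurable borel"
    using lipschitz_on_continuous_on[OF f(2)] by (rule borel_measurable_continuous_onI)
  note L = lorentzian_has_integral[OF b(1), of \<alpha>]
  have nn: "0 \<le> lorentzian \<alpha> b s" for s using b by (simp add: lorentzian_nonneg)
  show int: "integrable lborel (\<lambda>s. lorentzian \<alpha> b s * f s)"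
    by (rule Bochner_Integration.integrable_bound[OF L(1)])
      (use nn f(1) in \<open>auto simp: abs_mult mult_left_le\<close>)
  let ?m = "\<lambda>s. lorentzian \<alpha> b s * min 2 \<bar>s - \<alpha>\<bar>"
  have mi: "integrable lborel ?m"
    using le_less_trans[OF lorentzian_moment[OF b, of \<alpha>] ennreal_less_top] nn
    by (intro integrableI_nonneg) auto
  have ml: "(\<integral>s. ?m s \<partial>lborel) \<le> 36 * b * \<bar>ln b\<bar>"
  proof -
    have "(\<integral>s. ?m s \<partial>lborel) = enn2real (\<integral>\<^sup>+s. ennreal (?m s) \<partial>lborel)"
      using nn by (intro integral_eq_nn_integral) auto
    also have "\<dots> \<le> 36 * b * \<bar>ln b\<bar>"
      by (rule enn2real_leI[OF _ lorentzian_moment[OF b]], intro mult_nonneg_nonneg) (use b in auto)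
    finally show ?thesis .
  qed
  have "(\<integral>s. lorentzian \<alpha> b s * f s \<partial>lborel) - 2 * pi * f p = (\<integral>s. lorentzian \<alpha> b s * (f s - f p) \<partial>lborel)"
    using L int by (simp add: right_diff_distrib)
  also have "\<bar>\<dots>\<bar> \<le> (\<integral>s. lorentzian \<alpha> b s * \<bar>\<alpha> - p\<bar> + ?m s \<partial>lborel)"
  proof -
    have "\<bar>lorentzian \<alpha> b s * (f s - f p)\<bar> \<le> lorentzian \<alpha> b s * \<bar>\<alpha> - p\<bar> + ?m s" for s
    proof -
      have "\<bar>f s - f p\<bar> \<le> \<bar>f s - f \<alpha>\<bar> + \<bar>f \<alpha> - f p\<bar>" by simp
      also have "\<dots> \<le> min 2 \<bar>s - \<alpha>\<bar> + \<bar>\<alpha> - p\<bar>"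
      proof (rule add_mono[OF min.boundedI])
        show "\<bar>f s - f \<alpha>\<bar> \<le> 2"
          using f(1)[of s] f(1)[of \<alpha>] by (simp add: abs_le_iff)
      qed (rule lip)+
      finally have "lorentzian \<alpha> b s * \<bar>f s - f p\<bar> \<le> lorentzian \<alpha> b s * (min 2 \<bar>s - \<alpha>\<bar> + \<bar>\<alpha> - p\<bar>)"
        using nn by (intro mult_left_mono)
      then show ?thesis using nn[of s] by (simp only: abs_mult abs_of_nonneg distrib_left add.commute)
    qed
    moreover have "integrable lborel (\<lambda>s. lorentzian \<alpha> b s * (f s - f p))"
      using L int by (simp add: right_diff_distrib)
    ultimately show ?thesis
      using L mi by (intro order_trans[OF integral_abs_bound] integral_mono) auto
  qed
  also have "\<dots> = 2 * pi * \<bar>\<alpha> - p\<bar> + (\<integral>s. ?m s \<partial>lborel)"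
    using L mi by simp
  finally show "\<bar>(\<integral>s. lorentzian \<alpha> b s * f s \<partial>lborel) - 2 * pi * f p\<bar> \<le> 2 * pi * \<bar>\<alpha> - p\<bar> + 36 * b * \<bar>ln b\<bar>"
    using ml by linarith
qed

section \<open>Bounded Lipschitz distance to a sum of point masses\<close>

lemma scale_measure_eq_density: "scale_measure r M = density M (\<lambda>_. r)"
  by (rule measure_eqI) (auto simp: emeasure_density_const)

lemma integral_scale_dirac_sum:
  fixes f :: "real \<Rightarrow> real" and p :: "'n::finite \<Rightarrow> real"
  assumes [measurable]: "f \<in> borel_measurable borel" and "0 \<le> b"
  shows "(\<integral>s. f s \<partial>scale_measure (ennreal b) (dirac_sum p)) = b * (\<Sum>j\<in>UNIV. f (p j))"
proof -
  have "(\<integral>s. f s \<partial>scale_measure (ennreal b) (dirac_sum p)) = (\<integral>s. b *\<^sub>R f s \<partial>dirac_sum p)"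
    unfolding scale_measure_eq_density
    by (rule integral_density) (use assms in \<open>auto simp: dirac_sum_def\<close>)
  also have "\<dots> = (\<Sum>j\<in>UNIV. b *\<^sub>R f (p j))"
    unfolding dirac_sum_def
    by (subst integral_distr) (auto simp: lebesgue_integral_count_space_finite sum_distrib_left)
  finally show ?thesis by (simp add: sum_distrib_left)
qed

text \<open>Agreement is asked only off a finite set, because the density formula excludes the
  points \<open>y k\<close>; a null set affects neither the measure nor the distance. The
  second-order shift of the centres is absorbed by \<epsilon>^2 \<le> \<epsilon> (1 + |ln
  \<epsilon>|).\<close>

lemma d_BL_lorentzian_sum:
  fixes g :: "real \<Rightarrow> real" and \<alpha> b p :: "'n::finite \<Rightarrow> real"
  assumes g: "\<And>s. s \<notin> F \<Longrightarrow> g s = (\<Sum>j\<in>UNIV. lorentzian (\<alpha> j) (b j) s)" "finite F"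
    and b: "\<And>j. 0 < b j" "\<And>j. b j \<le> \<epsilon>" and e: "\<epsilon> \<le> 1 / 2"
    and \<alpha>: "\<And>j. \<bar>\<alpha> j - p j\<bar> \<le> B * \<epsilon>\<^sup>2" and B: "0 \<le> B"
  defines "\<mu> \<equiv> density lborel (\<lambda>s. ennreal (g s))"
  shows "finite_measure \<mu>"
    "d_BL \<mu> (scale_measure (ennreal (2 * pi)) (dirac_sum p))
      \<le> CARD('n) * (2 * pi * B + 36) * \<epsilon> * (1 + \<bar>ln \<epsilon>\<bar>)"
proof -
  let ?h = "\<lambda>s. \<Sum>j\<in>UNIV. lorentzian (\<alpha> j) (b j) s"
  have hm [measurable]: "?h \<in> borel_measurable borel" by measurable
  have hn: "0 \<le> ?h s" for s using b(1) by (intro sum_nonneg lorentzian_nonneg) (simp add: less_imp_le)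
  have gm [measurable]: "g \<in> borel_measurable borel"
    by (rule measurable_discrete_difference[OF hm, of F]) (use g in \<open>auto intro: countable_finite\<close>)
  have \<mu>: "\<mu> = density lborel (\<lambda>s. ennreal (?h s))"
    unfolding \<mu>_def
  proof (rule density_cong)
    have "F \<in> null_sets lborel" using g(2) by (rule finite_imp_null_set_lborel)
    then show "AE s in lborel. ennreal (g s) = ennreal (?h s)"
    proof (rule AE_I', intro subsetI)
      fix s assume "s \<in> {s \<in> space lborel. ennreal (g s) \<noteq> ennreal (?h s)}"
      then show "s \<in> F" by (rule contrapos_pp) (simp add: g(1))
    qed
  qed auto
  have \<epsilon>: "0 < \<epsilon>" using b by (meson less_le_trans)
  show "finite_measure \<mu>"
  proof
    have "emeasure \<mu> (space \<mu>) = (\<integral>\<^sup>+s. ennreal (?h s) \<partial>lborel)"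
      unfolding \<mu> by (simp add: emeasure_density)
    also have "\<dots> = (\<integral>\<^sup>+s. (\<Sum>j\<in>UNIV. ennreal (lorentzian (\<alpha> j) (b j) s)) \<partial>lborel)"
      using b(1) by (intro nn_integral_cong sum_ennreal[symmetric] lorentzian_nonneg) (simp add: less_imp_le)
    also have "\<dots> = (\<Sum>j\<in>UNIV. \<integral>\<^sup>+s. ennreal (lorentzian (\<alpha> j) (b j) s) \<partial>lborel)"
      by (rule nn_integral_sum) auto
    also have "\<dots> = (\<Sum>j\<in>(UNIV :: 'n set). ennreal (2 * pi))"
      using nn_integral_lorentzian[OF b(1)] by simp
    also have "\<dots> < \<infinity>" by (simp add: ennreal_mult_less_top of_nat_less_top)
    finally show "emeasure \<mu> (space \<mu>) \<noteq> \<infinity>" by simp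
  qed
  have single: "(\<integral>s. f s \<partial>\<mu>) - (\<integral>s. f s \<partial>scale_measure (ennreal (2 * pi)) (dirac_sum p))
      \<le> CARD('n) * (2 * pi * B + 36) * \<epsilon> * (1 + \<bar>ln \<epsilon>\<bar>)"
    if f: "\<And>s. \<bar>f s\<bar> \<le> 1" "lipschitz_on 1 UNIV f" for f :: "real \<Rightarrow> real"
  proof -
    have fm [measurable]: "f \<in> borel_measurable borel"
      using lipschitz_on_continuous_on[OF f(2)] by (rule borel_measurable_continuous_onI)
    have b2: "b j \<le> 1 / 2" for j using b(2)[of j] e by linarith
    have "(\<integral>s. f s \<partial>\<mu>) = (\<integral>s. ?h s *\<^sub>R f s \<partial>lborel)"
      unfolding \<mu> by (rule integral_density) (use hn in auto)
    also have "\<dots> = (\<integral>s. (\<Sum>j\<in>UNIV. lorentzian (\<alpha> j) (b j) s * f s) \<partial>lborel)"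
      by (simp add: sum_distrib_right)
    also have "\<dots> = (\<Sum>j\<in>UNIV. \<integral>s. lorentzian (\<alpha> j) (b j) s * f s \<partial>lborel)"
      by (rule Bochner_Integration.integral_sum) (rule lorentzian_test(1)[OF b(1) b2 f])
    finally have "(\<integral>s. f s \<partial>\<mu>) - (\<integral>s. f s \<partial>scale_measure (ennreal (2 * pi)) (dirac_sum p))
       = (\<Sum>j\<in>UNIV. (\<integral>s. lorentzian (\<alpha> j) (b j) s * f s \<partial>lborel) - 2 * pi * f (p j))"
      by (simp add: integral_scale_dirac_sum sum_subtractf sum_distrib_left)
    also have "\<dots> \<le> (\<Sum>j\<in>(UNIV :: 'n set). (2 * pi * B + 36) * (\<epsilon> * (1 + \<bar>ln \<epsilon>\<bar>)))"
    proof (rule sum_mono)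
      fix j
      have "(\<integral>s. lorentzian (\<alpha> j) (b j) s * f s \<partial>lborel) - 2 * pi * f (p j)
          \<le> 2 * pi * \<bar>\<alpha> j - p j\<bar> + 36 * (b j * \<bar>ln (b j)\<bar>)"
        using abs_le_D1[OF lorentzian_test(2)[OF b(1)[of j] b2[of j] f, of "\<alpha> j" "p j"]] by (simp add: mult.assoc)
      also have "\<dots> \<le> 2 * pi * (B * (\<epsilon> * (1 + \<bar>ln \<epsilon>\<bar>))) + 36 * (\<epsilon> * (1 + \<bar>ln \<epsilon>\<bar>))"
      proof (intro add_mono mult_left_mono)
        have "\<epsilon>\<^sup>2 \<le> \<epsilon> * (1 + \<bar>ln \<epsilon>\<bar>)"
        proof -
          have "\<epsilon> \<le> 1 + \<bar>ln \<epsilon>\<bar>" using e abs_ge_zero[of "ln \<epsilon>"] by linarith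
          then show ?thesis unfolding power2_eq_square using \<epsilon> by (intro mult_left_mono) auto
        qed
        then have "B * \<epsilon>\<^sup>2 \<le> B * (\<epsilon> * (1 + \<bar>ln \<epsilon>\<bar>))" using B by (rule mult_left_mono)
        then show "\<bar>\<alpha> j - p j\<bar> \<le> B * (\<epsilon> * (1 + \<bar>ln \<epsilon>\<bar>))" using \<alpha>[of j] by linarith
        show "b j * \<bar>ln (b j)\<bar> \<le> \<epsilon> * (1 + \<bar>ln \<epsilon>\<bar>)"
          by (rule entropy_bound[OF b(1) b(2)]) (use e in simp)
      qed auto
      also have "\<dots> = (2 * pi * B + 36) * (\<epsilon> * (1 + \<bar>ln \<epsilon>\<bar>))" by (simp add: algebra_simps)
      finally show "(\<integral>s. lorentzian (\<alpha> j) (b j) s * f s \<partial>lborel) - 2 * pi * f (p j)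
          \<le> (2 * pi * B + 36) * (\<epsilon> * (1 + \<bar>ln \<epsilon>\<bar>))" .
    qed
    finally show ?thesis by (simp add: mult_ac)
  qed
  \<comment> \<open>A supremum of reals is bounded by its upper bounds only over a nonempty set of
    test functions.\<close>
  have "(\<lambda>_. 0) \<in> {f :: real \<Rightarrow> real. (\<forall>s. \<bar>f s\<bar> \<le> 1) \<and> lipschitz_on 1 UNIV f}"
    by (auto simp: lipschitz_on_def)
  then have ne: "{f :: real \<Rightarrow> real. (\<forall>s. \<bar>f s\<bar> \<le> 1) \<and> lipschitz_on 1 UNIV f} \<noteq> {}"
    by (rule ex_in_conv[THEN iffD1, OF exI])
  show "d_BL \<mu> (scale_measure (ennreal (2 * pi)) (dirac_sum p))
      \<le> CARD('n) * (2 * pi * B + 36) * \<epsilon> * (1 + \<bar>ln \<epsilon>\<bar>)"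
    unfolding d_BL_def
  proof (rule cSUP_least[OF ne])
    fix f :: "real \<Rightarrow> real" assume "f \<in> {f. (\<forall>s. \<bar>f s\<bar> \<le> 1) \<and> lipschitz_on 1 UNIV f}"
    then have "\<forall>s. \<bar>f s\<bar> \<le> 1" "lipschitz_on 1 UNIV f" by blast+
    then show "(\<integral>s. f s \<partial>\<mu>) - (\<integral>s. f s \<partial>scale_measure (ennreal (2 * pi)) (dirac_sum p))
      \<le> CARD('n) * (2 * pi * B + 36) * \<epsilon> * (1 + \<bar>ln \<epsilon>\<bar>)"
      by (intro single) auto
  qed
qed

section \<open>Choice of constants and conclusion\<close>

theorem theorem3p1:
  fixes x0 v0 :: "'n::{finite,linorder} \<Rightarrow> real"
  assumes "CARD('n) \<ge> 2"
  shows "\<exists>C::real. \<forall>(x :: 'n \<Rightarrow> real \<Rightarrow> real) (c :: 'n \<Rightarrow> real) (\<gamma> :: 'n \<Rightarrow> real) (m :: 'n).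
    calogero_moser_solution x \<and> (\<forall>j. x j 0 = x0 j \<and> deriv (x j) 0 = v0 j) \<and>
    moser_data x0 v0 c \<gamma> \<longrightarrow>
    (let y = (\<lambda>j t. x j t - c m * t);
         tr = (\<lambda>j t. trace (basis_proj m **
                         spectral_proj (moser_H c \<gamma> t) (complex_of_real (x j t))));
         a = (\<lambda>j t. Re (tr j t))
     in
     \<exists>\<epsilon>0>0. \<forall>\<epsilon>. 0 < \<epsilon> \<and> \<epsilon> < \<epsilon>0 \<longrightarrow>
      (\<exists>(z :: 'n \<Rightarrow> real \<Rightarrow> complex) (r :: 'n \<Rightarrow> real \<Rightarrow> complex).
        (\<forall>t. bij_betw (\<lambda>j. z j t) UNIV {w. eigenvalue (moser_M c \<gamma> m \<epsilon> t) w}) \<and>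
        (\<forall>t w. eigenvalue (moser_M c \<gamma> m \<epsilon> t) w \<longrightarrow>
                 simple_eigenvalue (moser_M c \<gamma> m \<epsilon> t) w \<and> Im w < 0) \<and>
        (\<forall>t j. cmod (z j t - complex_of_real (y j t)) \<le> \<epsilon>) \<and>
        (\<forall>t j. tr j t \<in> \<real> \<and> a j t > 0) \<and>
        (\<forall>t. (\<Sum>j\<in>UNIV. a j t) = 1) \<and>
        (\<forall>t j. z j t = complex_of_real (y j t) - \<i> * complex_of_real (\<epsilon> * a j t)
                 - complex_of_real (\<epsilon>\<^sup>2 * a j t * (\<Sum>k\<in>UNIV - {j}. a k t / (y j t - y k t)))
                 + r j t) \<and>
        (\<forall>t j. r j differentiable (at t) \<and>
                 cmod (r j t) + cmod (vector_derivative (r j) (at t)) \<le> C * \<epsilon> ^ 3) \<and>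
        (\<forall>t j. \<bar>Re (z j t) - y j t\<bar> \<le> C * \<epsilon>\<^sup>2) \<and>
        (\<forall>t j. z j differentiable (at t) \<and>
                 \<bar>Re (vector_derivative (z j) (at t)) - deriv (y j) t\<bar> \<le> C * \<epsilon>\<^sup>2) \<and>
        (\<forall>t j. 0 < - Im (z j t) \<and> - Im (z j t) < \<epsilon>) \<and>
        (\<forall>t. (\<Sum>j\<in>UNIV. - Im (z j t)) = \<epsilon>) \<and>
        (\<forall>t j. \<bar>- Im (z j t) - \<epsilon> * a j t\<bar> \<le> C * \<epsilon> ^ 3)) \<and>
      (\<forall>\<phi> t. let \<mu> = density lborel (\<lambda>s. ennreal ((cmod (multisoliton c \<gamma> m \<phi> \<epsilon> t s))\<^sup>2))
              in finite_measure \<mu> \<and>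
                 d_BL \<mu> (scale_measure (ennreal (2 * pi)) (dirac_sum (\<lambda>j. y j t)))
                   \<le> C * \<epsilon> * (1 + \<bar>ln \<epsilon>\<bar>)))"
proof -
  \<comment> \<open>All constants are built from the initial energy and N before any solution or
    Moser data are introduced.\<close>
  define K where "K = sqrt (energy x0 v0)"
  define \<delta> where "\<delta> = 2 / K"
  \<comment> \<open>\<open>2 * K\<close> bounds the velocity of \<open>x j\<close> minus
    \<open>c m\<close>, and the second summand bounds the derivative of a weight.\<close>
  define D where "D = 2 * K + CARD('n) * (CARD('n) * K * K)"
  \<comment> \<open>Seen from outside the locale, \<open>qc\<close> and \<open>rc\<close> depend
    only on the index type, \<open>\<delta>\<close> and \<open>D\<close>; this is the independence
    of \<open>C\<close> from \<open>t\<close> and \<open>\<epsilon>\<close>.\<close>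
  define q where "q = secular.qc TYPE('n) \<delta> D"
  define b where "b = secular.rc TYPE('n) \<delta> D"
  \<comment> \<open>A sum of nonnegative terms dominating the constants of the remainder, of the
    real parts and of the distance estimate.\<close>
  define C where "C = 2 * b + q + CARD('n) * (2 * pi * (q + b) + 36)"
  show ?thesis
  proof (rule exI[of _ C], intro allI impI, elim conjE, goal_cases)
    case (1 x c \<gamma> m)
    note cm = \<open>calogero_moser_solution x\<close> and init = \<open>\<forall>j. x j 0 = x0 j \<and> deriv (x j) 0 = v0 j\<close>
      and data = \<open>moser_data x0 v0 c \<gamma>\<close>
    have init': "(\<lambda>j. x j 0) = x0" "(\<lambda>j. deriv (x j) 0) = v0" using init by auto
    have en: "energy (\<lambda>j. x j t) (\<lambda>j. deriv (x j) t) = energy x0 v0" for t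
      using energy_conserved[OF cm, of t] unfolding init' .
    have inj_c: "inj c" using data by (simp add: moser_data_def)
    have inj_x: "inj (\<lambda>j. x j t)" for t
      using calogero_moser_derivs(1)[OF cm] by (rule strict_mono_imp_inj_on)
    \<comment> \<open>Since N is at least 2 there is a pair of particles, whose interaction term is
      positive; hence \<open>K > 0\<close> and \<open>\<delta>\<close> is a genuine gap.\<close>
    have "0 < energy x0 v0"
    proof -
      obtain j k :: 'n where jk: "j \<noteq> k"
        using assms by (metis One_nat_def card_le_Suc0_iff_eq finite UNIV_I not_less_eq_eq numeral_2_eq_2)
      have "0 < 4 / (x j 0 - x k 0)\<^sup>2" using calogero_moser_neq[OF cm jk, of 0] by simp
      also have "\<dots> \<le> energy (\<lambda>j. x j 0) (\<lambda>j. deriv (x j) 0)" by (rule gap_le_energy)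
      finally show ?thesis by (simp only: en)
    qed
    then have K: "0 < K" and K2: "K\<^sup>2 = energy x0 v0" by (simp_all add: K_def)
    have v_le: "\<bar>deriv (x j) t\<bar> \<le> K" for j t
      using velocity_sq_le_energy[of "\<lambda>j. deriv (x j) t" j "\<lambda>j. x j t"] K
      unfolding en K2[symmetric] by (simp add: abs_le_square_iff[symmetric])
    have c_le: "\<bar>c j\<bar> \<le> K" for j
    proof -
      have "(c j)\<^sup>2 \<le> (\<Sum>j\<in>UNIV. (c j)\<^sup>2)" by (rule member_le_sum) auto
      also have "\<dots> = K\<^sup>2" unfolding K2 by (rule sum_sq_moser_data[OF data])
      finally show ?thesis using K by (simp add: abs_le_square_iff[symmetric])
    qed
    have gap: "2 / K \<le> \<bar>x j t - x k t\<bar>" if "j \<noteq> k" for j k t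
    proof -
      have d: "0 < \<bar>x j t - x k t\<bar>" using calogero_moser_neq[OF cm that, of t] by simp
      have "4 / (x j t - x k t)\<^sup>2 \<le> K\<^sup>2"
        using gap_le_energy[of "\<lambda>j. x j t" j k "\<lambda>j. deriv (x j) t"] unfolding en K2 .
      then have "(2 / \<bar>x j t - x k t\<bar>)\<^sup>2 \<le> K\<^sup>2" by (simp add: power_divide)
      then have "2 / \<bar>x j t - x k t\<bar> \<le> K" using K by (simp add: abs_le_square_iff[symmetric])
      then show ?thesis using d K by (simp add: field_simps)
    qed
    have "\<exists>u. eigenbasis (moser_H c \<gamma> t) (\<lambda>j. x j t) u" for t
    proof -
      have "eigenvalue (moser_H c \<gamma> t) (complex_of_real (x j t))" for j
        by (rule eigenvalue_moser_H[OF cm]) (simp add: init' data)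
      then show ?thesis by (rule hermitian_eigenbasis[OF hermitian_moser_H inj_x])
    qed
    \<comment> \<open>One basis per time, picked by choice and hence without any regularity in
      \<open>t\<close>.\<close>
    then have "\<forall>t. \<exists>u. eigenbasis (moser_H c \<gamma> t) (\<lambda>j. x j t) u" ..
    then obtain u where u: "\<And>t. eigenbasis (moser_H c \<gamma> t) (\<lambda>j. x j t) (u t)"
      unfolding choice_iff by blast
    interpret flow: spectral_flow c \<gamma> x "\<lambda>j. deriv (x j)" u K
      by (rule spectral_flow.intro[OF u inj_c calogero_moser_derivs(2)[OF cm] v_le c_le K gap])
    let ?y = "\<lambda>j t. x j t - c m * t"
    let ?dy = "\<lambda>j t. deriv (x j) t - c m"
    have tr: "trace (basis_proj m ** spectral_proj (moser_H c \<gamma> t) (complex_of_real (x j t)))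
        = complex_of_real (flow.weight m j t)" for j t
      unfolding flow.weight_def by (rule eigenbasis.trace_spectral_proj[OF u])
    have y_deriv: "(?y j has_real_derivative ?dy j t) (at t)" for j t
      by (auto intro!: derivative_eq_intros calogero_moser_derivs(2)[OF cm])
    have deriv_y: "deriv (?y j) t = ?dy j t" for j t
      using y_deriv by (rule DERIV_imp_deriv)
    \<comment> \<open>\<open>\<delta> / 8\<close> serves the contraction, \<open>1 / 2\<close> the
      truncated moment of the Lorentzians.\<close>
    define \<epsilon>0 where "\<epsilon>0 = min (\<delta> / 8) (1 / 2)"
    have \<delta>: "0 < \<delta>" using K by (simp add: \<delta>_def)
    have \<epsilon>0: "0 < \<epsilon>0" using \<delta> by (simp add: \<epsilon>0_def)
    have sec: "secular ?y ?dy (flow.weight m) (flow.weight_deriv m) \<delta> D \<epsilon>" if \<epsilon>: "0 < \<epsilon>" "\<epsilon> < \<epsilon>0" for \<epsilon>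
    proof
      fix j k :: 'n and t :: real
      show "(?y j has_real_derivative ?dy j t) (at t)" by (rule y_deriv)
      have "0 \<le> CARD('n) * (CARD('n) * K * K)" using K by simp
      then show "\<bar>?dy j t\<bar> \<le> D" using v_le[of j t] c_le[of m] unfolding D_def by linarith
      show "\<bar>flow.weight_deriv m j t\<bar> \<le> D"
        using flow.weight_deriv_le[of m j t] K unfolding D_def by linarith
      show "\<delta> \<le> \<bar>?y j t - ?y k t\<bar>" if "j \<noteq> k" using gap[OF that, of t] by (simp add: \<delta>_def)
    qed (use \<epsilon> \<delta> flow.has_derivative_weight flow.weight_pos flow.sum_weight in \<open>auto simp: \<epsilon>0_def\<close>)
    have eig: "eigenvalue (moser_M c \<gamma> m \<epsilon> t) w \<longleftrightarrow>
        (\<forall>k. w \<noteq> ?y k t) \<and> (\<Sum>k\<in>UNIV. flow.weight m k t / (w - ?y k t)) = \<i> / \<epsilon>"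
      and dens: "(\<And>k. s \<noteq> ?y k t) \<Longrightarrow> (cmod (multisoliton c \<gamma> m \<phi> \<epsilon> t s))\<^sup>2 =
        2 * \<epsilon> * (\<Sum>k\<in>UNIV. flow.weight m k t / (s - ?y k t)\<^sup>2)
          / (1 + (\<epsilon> * (\<Sum>k\<in>UNIV. flow.weight m k t / (s - ?y k t)))\<^sup>2)"
      if "0 < \<epsilon>" for \<epsilon> t \<phi> s and w :: complex
    proof -
      interpret mb: moser_eigenbasis c \<gamma> t "\<lambda>j. x j t" "u t" m
        by (rule moser_eigenbasis.intro[OF u]) (unfold_locales, rule inj_c)
      show "eigenvalue (moser_M c \<gamma> m \<epsilon> t) w \<longleftrightarrow>
        (\<forall>k. w \<noteq> ?y k t) \<and> (\<Sum>k\<in>UNIV. flow.weight m k t / (w - ?y k t)) = \<i> / \<epsilon>"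
        using mb.eigenvalue_moser_M[OF that, of w] unfolding mb.y_def mb.a_def flow.weight_def .
      show "(cmod (multisoliton c \<gamma> m \<phi> \<epsilon> t s))\<^sup>2 =
        2 * \<epsilon> * (\<Sum>k\<in>UNIV. flow.weight m k t / (s - ?y k t)\<^sup>2)
          / (1 + (\<epsilon> * (\<Sum>k\<in>UNIV. flow.weight m k t / (s - ?y k t)))\<^sup>2)"
        if "\<And>k. s \<noteq> ?y k t"
        using mb.multisoliton_density[OF \<open>0 < \<epsilon>\<close>, of s \<phi>] that unfolding mb.y_def mb.a_def flow.weight_def by blast
    qed
    have bl: "finite_measure (density lborel (\<lambda>s. ennreal ((cmod (multisoliton c \<gamma> m \<phi> \<epsilon> t s))\<^sup>2))) \<and>
        d_BL (density lborel (\<lambda>s. ennreal ((cmod (multisoliton c \<gamma> m \<phi> \<epsilon> t s))\<^sup>2)))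
          (scale_measure (ennreal (2 * pi)) (dirac_sum (\<lambda>j. ?y j t))) \<le> C * \<epsilon> * (1 + \<bar>ln \<epsilon>\<bar>)"
      if \<epsilon>: "0 < \<epsilon> \<and> \<epsilon> < \<epsilon>0" for \<epsilon> \<phi> t
    proof -
      interpret secular ?y ?dy "flow.weight m" "flow.weight_deriv m" \<delta> D \<epsilon> using \<epsilon> by (intro sec) auto
      have qb: "0 \<le> q" "0 \<le> b" using rc_nonneg qc_nonneg by (simp_all add: q_def b_def)
      let ?g = "\<lambda>s. (cmod (multisoliton c \<gamma> m \<phi> \<epsilon> t s))\<^sup>2"
      \<comment> \<open>The resolvent computation and the logarithmic derivative end in the same
        expression in the weights and the \<open>y k\<close>, so the density is a sum of
        Lorentzians.\<close>
      have g: "?g s = (\<Sum>j\<in>UNIV. lorentzian (Re (z j t)) (- Im (z j t)) s)" if "s \<notin> range (\<lambda>k. ?y k t)" for s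
      proof -
        have s: "s \<noteq> ?y k t" for k using that by auto
        show ?thesis
          unfolding dens[OF \<epsilon>_pos s] lorentzian_def power2_minus by (rule lorentzian_sum[OF s, symmetric])
      qed
      have pos: "0 < - Im (z j t)" and less: "- Im (z j t) \<le> \<epsilon>" for j
        using Im_z_neg[of j t] Im_z_less[OF assms, of j t] by linarith+
      have half: "\<epsilon> \<le> 1 / 2" using \<epsilon> by (simp add: \<epsilon>0_def)
      have Re: "\<bar>Re (z j t) - ?y j t\<bar> \<le> (q + b) * \<epsilon>\<^sup>2" for j
        using Re_z[of j t] unfolding q_def b_def .
      have B: "0 \<le> q + b" using qb by simp
      note bl = d_BL_lorentzian_sum[of "range (\<lambda>k. ?y k t)" ?g, OF g _ pos less half Re B]
      have "CARD('n) * (2 * pi * (q + b) + 36) \<le> C" using qb unfolding C_def by linarith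
      then have "CARD('n) * (2 * pi * (q + b) + 36) * (\<epsilon> * (1 + \<bar>ln \<epsilon>\<bar>)) \<le> C * (\<epsilon> * (1 + \<bar>ln \<epsilon>\<bar>))"
        using \<epsilon>_pos by (intro mult_right_mono) auto
      then show ?thesis using bl by (simp add: mult.assoc)
    qed
    show ?case
      unfolding Let_def tr Re_complex_of_real
    proof (rule exI[of _ \<epsilon>0], intro conjI allI impI, rule \<epsilon>0, goal_cases)
      case (1 \<epsilon>)
      then interpret secular ?y ?dy "flow.weight m" "flow.weight_deriv m" \<delta> D \<epsilon> by (intro sec) auto
      have qb: "0 \<le> q" "0 \<le> b" using rc_nonneg qc_nonneg by (simp_all add: q_def b_def)
      have "0 \<le> CARD('n) * (2 * pi * (q + b) + 36)" using qb by simp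
      then have C: "2 * b \<le> C" "q + b \<le> C" "b \<le> C"
        using qb unfolding C_def by linarith+
      have range_z: "range (\<lambda>j. z j t) = {w. eigenvalue (moser_M c \<gamma> m \<epsilon> t) w}" for t
      proof safe
        show "eigenvalue (moser_M c \<gamma> m \<epsilon> t) (z j t)" for j
          unfolding eig[OF \<epsilon>_pos] using z_neq_y z_secular by blast
        show "w \<in> range (\<lambda>j. z j t)" if "eigenvalue (moser_M c \<gamma> m \<epsilon> t) w" for w
          using secular_root[of w t] that unfolding eig[OF \<epsilon>_pos] by blast
      qed
      show ?case
      proof (rule exI[of _ z], rule exI[of _ rem], intro conjI allI impI, goal_cases)
        case (1 t)
        show ?case unfolding bij_betw_def using inj_z range_z by blast
      next
        case (2 t w)
        have "card {w. eigenvalue (moser_M c \<gamma> m \<epsilon> t) w} = CARD('n)"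
          unfolding range_z[symmetric] by (rule card_image[OF inj_z])
        then show ?case using 2 by (rule simple_eigenvalue_if_card)
      next
        case (3 t w)
        then have "w \<in> range (\<lambda>j. z j t)" unfolding range_z by simp
        then show ?case using Im_z_neg by auto
      next
        case (4 t j)
        show ?case by (rule z_near)
      next
        case (5 t j)
        show ?case by simp
      next
        case (6 t j)
        show ?case by (rule flow.weight_pos)
      next
        case (7 t)
        show ?case by (rule flow.sum_weight)
      next
        case (8 t j)
        show ?case by (rule z_expansion)
      next
        case (9 t j)
        show ?case by (rule C1_leD(2)[OF C1_rem])
      next
        case (10 t j)
        have "2 * b * \<epsilon> ^ 3 \<le> C * \<epsilon> ^ 3" using C \<epsilon>_pos by (intro mult_right_mono) auto
        then show ?case using rem_bound[of j t] unfolding b_def by linarith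
      next
        case (11 t j)
        have "(q + b) * \<epsilon>\<^sup>2 \<le> C * \<epsilon>\<^sup>2" using C by (intro mult_right_mono) auto
        then show ?case using Re_z[of j t] unfolding b_def q_def by linarith
      next
        case (12 t j)
        show ?case by (rule z_differentiable)
      next
        case (13 t j)
        have "(q + b) * \<epsilon>\<^sup>2 \<le> C * \<epsilon>\<^sup>2" using C by (intro mult_right_mono) auto
        then show ?case using Re_z_deriv[of j t] unfolding b_def q_def deriv_y by linarith
      next
        case (14 t j)
        show ?case using Im_z_neg[of j t] by simp
      next
        case (15 t j)
        show ?case by (rule Im_z_less[OF assms])
      next
        case (16 t)
        show ?case by (rule sum_Im_z)
      next
        case (17 t j)
        have "b * \<epsilon> ^ 3 \<le> C * \<epsilon> ^ 3" using C \<epsilon>_pos by (intro mult_right_mono) auto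
        then show ?case using Im_z[of j t] unfolding b_def by linarith
      qed
    next
      case (2 \<epsilon> \<phi> t)
      show ?case using bl 2 by blast
    next
      case (3 \<epsilon> \<phi> t)
      show ?case using bl 3 by blast
    qed
  qed
qed

end
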